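(* A GBS group is residually finite if and only if it is solvable or unimodular (virtually $F\times\mathbb{Z}$ with $F$ free).
   Context: A generalized Baumslag-Solitar (GBS) group is a finitely generated group acting on a tree (without inversions) with all vertex and edge stabilizers infinite cyclic. A group is virtually $F\times\mathbb{Z}$ with $F$ free if it has a finite index subgroup isomorphic to $F\times\mathbb{Z}$ for some free group $F$. For a GBS group which is not isomorphic to $\mathbb{Z}$, $\mathbb{Z}^2$ or the Klein bottle group, unimodular means that the modular homomorphism $\Delta_G:G\to\mathbb{Q}^*$ takes values in $\{1,-1\}$; this is equivalent to being virtually $F\times\mathbb{Z}$ with $F$ free. Here $\Delta_G(g)=\frac mn$ whenever $ga^mg^{-1}=a^n$ with $m,n\ne0$ and $a$ a non-trivial element fixing a point of the tree. *)

theory Defs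
  imports
    "HOL-Algebra.Group_Action"
    "HOL-Algebra.Solvable_Groups"
    "HOL-Algebra.Elementary_Groups"
    "Graph_Theory.Digraph_Component"
begin

(* A graph is a symmetric loop-free digraph, possibly infinite, an undirected edge
   being a pair of opposite arcs. The predicate tree of Digraph_Component forbids directed
   cycles only; in a symmetric digraph these include the closed walks u, v, u of length 2
   along a single edge. Cycles of length at least 3 are the genuine undirected cycles.
   The predicate connected requires the vertex set to be nonempty. *)
definition undirected_tree :: "'v pair_pre_digraph \<Rightarrow> bool" where
  "undirected_tree T \<longleftrightarrow>
     pair_bidirected_digraph T \<and> connected (with_proj T) \<and>
     \<not> (\<exists>p. pre_digraph.cycle (with_proj T) p \<and> length p \<ge> 3)"

definition tree_action ::
    "('a, 'b) monoid_scheme \<Rightarrow> 'v pair_pre_digraph \<Rightarrow> ('a \<Rightarrow> 'v \<Rightarrow> 'v) \<Rightarrow> bool" where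
  "tree_action G T \<phi> \<longleftrightarrow>
     undirected_tree T \<and> group_action G (pverts T) \<phi> \<and>
     (\<forall>g\<in>carrier G. \<forall>(u, v)\<in>parcs T. (\<phi> g u, \<phi> g v) \<in> parcs T)"

definition without_inversions ::
    "('a, 'b) monoid_scheme \<Rightarrow> 'v pair_pre_digraph \<Rightarrow> ('a \<Rightarrow> 'v \<Rightarrow> 'v) \<Rightarrow> bool" where
  "without_inversions G T \<phi> \<longleftrightarrow>
     (\<forall>g\<in>carrier G. \<forall>(u, v)\<in>parcs T. \<not> (\<phi> g u = v \<and> \<phi> g v = u))"

definition edge_stabilizer ::
    "('a, 'b) monoid_scheme \<Rightarrow> ('a \<Rightarrow> 'v \<Rightarrow> 'v) \<Rightarrow> 'v \<times> 'v \<Rightarrow> 'a set" where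
  "edge_stabilizer G \<phi> e = {g \<in> carrier G. \<phi> g (fst e) = fst e \<and> \<phi> g (snd e) = snd e}"

definition infinite_cyclic_subgroup :: "('a, 'b) monoid_scheme \<Rightarrow> 'a set \<Rightarrow> bool" where
  "infinite_cyclic_subgroup G H \<longleftrightarrow> subgroup H G \<and> G\<lparr>carrier := H\<rparr> \<cong> integer_group"

definition finitely_generated :: "('a, 'b) monoid_scheme \<Rightarrow> bool" where
  "finitely_generated G \<longleftrightarrow> (\<exists>S. finite S \<and> S \<subseteq> carrier G \<and> generate G S = carrier G)"

(* G is a GBS group, as witnessed by its action \<phi> on the tree T. *)
definition gbs_group ::
    "('a, 'b) monoid_scheme \<Rightarrow> 'v pair_pre_digraph \<Rightarrow> ('a \<Rightarrow> 'v \<Rightarrow> 'v) \<Rightarrow> bool" where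
  "gbs_group G T \<phi> \<longleftrightarrow>
     group G \<and> finitely_generated G \<and> tree_action G T \<phi> \<and> without_inversions G T \<phi> \<and>
     (\<forall>v\<in>pverts T. infinite_cyclic_subgroup G (stabilizer G \<phi> v)) \<and>
     (\<forall>e\<in>parcs T. infinite_cyclic_subgroup G (edge_stabilizer G \<phi> e))"

(* For a GBS group the number described is unique and exists: stabilizers of any two vertices
   are infinite cyclic and commensurable, so it does not depend on a, m, n. *)
definition modular_hom ::
    "('a, 'b) monoid_scheme \<Rightarrow> 'v pair_pre_digraph \<Rightarrow> ('a \<Rightarrow> 'v \<Rightarrow> 'v) \<Rightarrow> 'a \<Rightarrow> rat" where
  "modular_hom G T \<phi> g =
     (THE q. \<exists>v\<in>pverts T. \<exists>a\<in>stabilizer G \<phi> v. \<exists>(m::int) (n::int).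
        a \<noteq> \<one>\<^bsub>G\<^esub> \<and> m \<noteq> 0 \<and> n \<noteq> 0 \<and>
        g \<otimes>\<^bsub>G\<^esub> (a [^]\<^bsub>G\<^esub> m) \<otimes>\<^bsub>G\<^esub> inv\<^bsub>G\<^esub> g = a [^]\<^bsub>G\<^esub> n \<and> q = of_int m / of_int n)"

(* Outside Z, Z^2 and the Klein bottle group (which are all solvable) the modular homomorphism
   does not depend on the choice of the action. *)
definition unimodular ::
    "('a, 'b) monoid_scheme \<Rightarrow> 'v pair_pre_digraph \<Rightarrow> ('a \<Rightarrow> 'v \<Rightarrow> 'v) \<Rightarrow> bool" where
  "unimodular G T \<phi> \<longleftrightarrow> (\<forall>g\<in>carrier G. modular_hom G T \<phi> g \<in> {1, -1})"

definition residually_finite :: "('a, 'b) monoid_scheme \<Rightarrow> bool" where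
  "residually_finite G \<longleftrightarrow>
     (\<forall>g\<in>carrier G. g \<noteq> \<one>\<^bsub>G\<^esub> \<longrightarrow> (\<exists>N. N \<lhd> G \<and> finite (carrier (G Mod N)) \<and> g \<notin> N))"

(* Words in X and inverses: (x, True) stands for x and (x, False) for its inverse. *)
definition eval_word :: "('a, 'b) monoid_scheme \<Rightarrow> ('a \<times> bool) list \<Rightarrow> 'a" where
  "eval_word F w =
     foldr (\<lambda>(x, s) y. (if s then x else inv\<^bsub>F\<^esub> x) \<otimes>\<^bsub>F\<^esub> y) w \<one>\<^bsub>F\<^esub>"

definition reduced_words :: "'a set \<Rightarrow> ('a \<times> bool) list set" where
  "reduced_words X =
     {w. fst ` set w \<subseteq> X \<and> successively (\<lambda>p q. \<not> (fst p = fst q \<and> snd p \<noteq> snd q)) w}"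

(* F is free on X: every element is represented by exactly one reduced word.
   The rank may be 0, finite or infinite. *)
definition free_group :: "('a, 'b) monoid_scheme \<Rightarrow> bool" where
  "free_group F \<longleftrightarrow>
     group F \<and> (\<exists>X\<subseteq>carrier F. bij_betw (eval_word F) (reduced_words X) (carrier F))"

(* Taking F on the same type as G loses nothing, as F embeds in G. *)
definition virtually_free_times_Z :: "('a, 'b) monoid_scheme \<Rightarrow> bool" where
  "virtually_free_times_Z G \<longleftrightarrow>
     (\<exists>H (F :: 'a monoid). subgroup H G \<and> finite (rcosets\<^bsub>G\<^esub> H) \<and> free_group F \<and>
        G\<lparr>carrier := H\<rparr> \<cong> F \<times>\<times> integer_group)"

end

(* Fix a generator a of a vertex stabilizer. Elliptic elements are commensurable with a, which
   measures them by rational numbers lam; conjugation scales lam by the modular character Del. Since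
   the tree is simply connected, lam extends to a crossed homomorphism trans on G, so that
   g |-> (x |-> Del g * x + trans g) is an affine action of G on the rationals whose kernel Ker
   meets every vertex stabilizer trivially. Hence Ker is free.

   If Del takes values in {1, -1}, the elements acting by translations by multiples of trans z, for a
   suitable power z of a, form a finite index subgroup Ker x <z>, and this gives residual finiteness.

   Suppose now that Del g is not 1 or -1 for some g. If G is solvable or residually finite, then Ker
   is trivial: otherwise some non-trivial k in Ker commutes with all conjugates of a non-trivial
   elliptic element c; these conjugates then fix the axis of k, so they lie in one cyclic group,
   which forces Del to be 1 or -1. (In the residually finite case, c is a power b of a that generates
   a normal subgroup in each finite quotient of G, so that the conjugates of b commute.) When Ker is
   trivial, G is a finitely generated group of affine maps, hence metabelian, and residually finite
   by reduction modulo a prime. *)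

theory Submission
  imports Defs "HOL-Algebra.Multiplicative_Group" "HOL-Computational_Algebra.Primes"
begin

section \<open>Trees\<close>

text \<open>Behind \<open>trans\<close> stands the Mayer-Vietoris sequence of the action: on each
  vertex stabilizer \<open>lam\<close> is a homomorphism to the rationals, these homomorphisms agree
  on edge stabilizers, and so they come from a class in the first cohomology of \<open>G\<close>
  with coefficients in the rationals twisted by \<open>Del\<close>. An explicit cocycle is written
  down instead, from orbit representatives and a potential on the tree, so that no graph of groups,
  presentation or cohomology has to be set up. The difficulty in the non-unimodular case is to find
  one element that commutes with all conjugates of an elliptic element. \<open>Ker\<close> provides
  it because its elements preserve \<open>lam\<close>, and \<open>lam\<close> is injective on each
  vertex stabilizer: an elliptic element and its conjugate by \<open>k\<close> in \<open>Ker\<close>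
  coincide as soon as they fix a common vertex. In the solvable case freeness of the action of
  \<open>Ker\<close> replaces this comparison. Solvable groups are reached only through the
  triviality of \<open>Ker\<close>; their classification as Baumslag-Solitar groups is
  bypassed.\<close>

locale metric_tree =
  fixes V :: "'v set" and A :: "'v rel"
  assumes A_sub: "(u, v) \<in> A \<Longrightarrow> u \<in> V \<and> v \<in> V"
    and A_sym: "(u, v) \<in> A \<Longrightarrow> (v, u) \<in> A"
    and A_irrefl: "(u, u) \<notin> A"
    and A_conn: "u \<in> V \<Longrightarrow> v \<in> V \<Longrightarrow> \<exists>n. (u, v) \<in> A ^^ n"
    and A_acyclic: "n \<ge> 1 \<Longrightarrow> (\<And>i. i < n \<Longrightarrow> (c i, c (Suc i)) \<in> A) \<Longrightarrow>
      (\<And>i. i + 2 \<le> n \<Longrightarrow> c i \<noteq> c (i + 2)) \<Longrightarrow> c 0 \<noteq> c n"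
begin

definition dst :: "'v \<Rightarrow> 'v \<Rightarrow> nat" where
  "dst x y = (LEAST n. (x, y) \<in> A ^^ n)"

lemma relpow_sym: "(x, y) \<in> A ^^ n \<Longrightarrow> (y, x) \<in> A ^^ n"
proof (induction n arbitrary: y)
  case (Suc n)
  then obtain z where "(x, z) \<in> A ^^ n" "(z, y) \<in> A" by auto
  then have "(y, z) \<in> A" "(z, x) \<in> A ^^ n" using Suc.IH A_sym by auto
  then show ?case by (rule relpow_Suc_I2)
qed simp

lemma dst_relpow: "x \<in> V \<Longrightarrow> y \<in> V \<Longrightarrow> (x, y) \<in> A ^^ dst x y"
  unfolding dst_def using A_conn by (auto intro: LeastI_ex)

lemma dst_le: "(x, y) \<in> A ^^ n \<Longrightarrow> dst x y \<le> n"
  unfolding dst_def by (rule Least_le)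

lemma dst_refl [simp]: "dst x x = 0"
  using dst_le[of x x 0] by simp

lemma dst_sym: "dst x y = dst y x"
  unfolding dst_def using relpow_sym by metis

lemma dst_eq_0: "x \<in> V \<Longrightarrow> y \<in> V \<Longrightarrow> dst x y = 0 \<longleftrightarrow> x = y"
  using dst_relpow[of x y] by auto

lemma dst_triangle: "x \<in> V \<Longrightarrow> y \<in> V \<Longrightarrow> z \<in> V \<Longrightarrow> dst x z \<le> dst x y + dst y z"
  by (rule dst_le) (auto simp: relpow_add intro: dst_relpow)

lemma dst_adj: "(x, y) \<in> A \<Longrightarrow> dst x y = 1"
  using dst_le[of x y 1] A_irrefl dst_eq_0[of x y] A_sub[of x y]
  by (metis One_nat_def le_Suc_eq le_zero_eq relpow_1)

lemma dst_step: "(x, z) \<in> A \<Longrightarrow> y \<in> V \<Longrightarrow> dst x y \<le> Suc (dst z y)"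
  using dst_triangle[of x z y] dst_adj[of x z] A_sub[of x z] by simp

lemma closer_ex:
  assumes "x \<in> V" "y \<in> V" "x \<noteq> y"
  shows "\<exists>z. (x, z) \<in> A \<and> Suc (dst z y) = dst x y"
proof -
  obtain n where n: "dst x y = Suc n" using dst_eq_0[of x y] assms by (cases "dst x y") auto
  then obtain z where z: "(x, z) \<in> A" "(z, y) \<in> A ^^ n"
    using dst_relpow[OF assms(1,2)] by (metis relpow_Suc_E2)
  then show ?thesis using dst_le[OF z(2)] dst_step[OF z(1) assms(2)] n by force
qed

text \<open>The choice turns out to be forced (\<open>closer_unique\<close>); iterating
  \<open>nxt y\<close> traces the geodesic towards \<open>y\<close>.\<close>

definition nxt :: "'v \<Rightarrow> 'v \<Rightarrow> 'v" where
  "nxt y x = (SOME z. (x, z) \<in> A \<and> Suc (dst z y) = dst x y)"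

lemma nxt: 
  assumes "x \<in> V" "y \<in> V" "x \<noteq> y"
  shows "(x, nxt y x) \<in> A" "Suc (dst (nxt y x) y) = dst x y" "nxt y x \<in> V"
proof -
  have "(x, nxt y x) \<in> A \<and> Suc (dst (nxt y x) y) = dst x y"
    using someI_ex[OF closer_ex[OF assms]] unfolding nxt_def .
  then show "(x, nxt y x) \<in> A" "Suc (dst (nxt y x) y) = dst x y" "nxt y x \<in> V"
    using A_sub by auto
qed

lemma nxt_iter:
  assumes "x \<in> V" "y \<in> V" "i \<le> dst x y"
  shows "(nxt y ^^ i) x \<in> V \<and> dst ((nxt y ^^ i) x) y = dst x y - i"
  using assms(3)
proof (induction i)
  case (Suc i)
  then have IH: "(nxt y ^^ i) x \<in> V" "dst ((nxt y ^^ i) x) y = dst x y - i" by auto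
  with Suc.prems have "(nxt y ^^ i) x \<noteq> y" by auto
  from nxt[OF IH(1) assms(2) this] IH(2) show ?case by simp
qed (use assms in simp)

lemma nxt_iter_adj:
  assumes "x \<in> V" "y \<in> V" "i < dst x y"
  shows "((nxt y ^^ i) x, (nxt y ^^ Suc i) x) \<in> A"
proof -
  have IH: "(nxt y ^^ i) x \<in> V" "dst ((nxt y ^^ i) x) y = dst x y - i"
    using nxt_iter[OF assms(1,2), of i] assms(3) by auto
  with assms have "(nxt y ^^ i) x \<noteq> y" by auto
  from nxt(1)[OF IH(1) assms(2) this] show ?thesis by simp
qed

lemma nxt_iter_end: "x \<in> V \<Longrightarrow> y \<in> V \<Longrightarrow> (nxt y ^^ dst x y) x = y"
  using nxt_iter[of x y "dst x y"] dst_eq_0 by auto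

text \<open>Two distinct closer neighbours would close up a walk: along a geodesic from
  \<open>y\<close> to \<open>p\<close>, over \<open>u\<close>, and down from \<open>q\<close> to
  \<open>y\<close>. The distance to \<open>y\<close> rises by one at each step up to
  \<open>u\<close> and then falls, so backtracking could only happen at \<open>u\<close>, where it
  would mean \<open>p = q\<close>.\<close>

lemma closer_unique:
  assumes "y \<in> V" "(u, p) \<in> A" "(u, q) \<in> A" "dst p y < dst u y" "dst q y < dst u y"
  shows "p = q"
proof (rule ccontr)
  assume "p \<noteq> q"
  define n where "n = dst p y"
  have V: "p \<in> V" "q \<in> V" "u \<in> V" using assms A_sub by auto
  have u: "dst u y = Suc n" using assms dst_step[of u p y] n_def by auto
  have q: "dst q y = n" using assms dst_step[of u q y] u by auto
  define c where "c i = (if i \<le> n then (nxt y ^^ (n - i)) p else if i = Suc n then u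
     else (nxt y ^^ (i - (n + 2))) q)" for i
  have lev: "dst (c i) y = (if i \<le> Suc n then i else 2 * n + 2 - i)" if "i \<le> 2 * n + 2" for i
    using that nxt_iter[of p y "n - i"] nxt_iter[of q y "i - (n + 2)"] V assms(1) u q n_def
    by (auto simp: c_def)
  have "c 0 \<noteq> c (2 * n + 2)"
  proof (rule A_acyclic)
    fix i assume i: "i < 2 * n + 2"
    consider "i < n" | "i = n" | "i = Suc n" | "i > Suc n" by linarith
    then show "(c i, c (Suc i)) \<in> A"
    proof cases
      case 1
      then have "Suc (n - Suc i) = n - i" by simp
      then have "((nxt y ^^ (n - Suc i)) p, (nxt y ^^ (n - i)) p) \<in> A"
        using nxt_iter_adj[of p y "n - Suc i"] V assms(1) n_def 1 by simp
      with 1 show ?thesis by (simp add: c_def A_sym)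
    next
      case 2 then show ?thesis using assms A_sym by (simp add: c_def)
    next
      case 3 then show ?thesis using assms A_sym by (simp add: c_def)
    next
      case 4
      then have "Suc i - (n + 2) = Suc (i - (n + 2))" by simp
      then show ?thesis using 4 i nxt_iter_adj[of q y "i - (n + 2)"] V assms(1) q by (simp add: c_def)
    qed
  next
    fix i assume i: "i + 2 \<le> 2 * n + 2"
    show "c i \<noteq> c (i + 2)"
    proof
      assume eq: "c i = c (i + 2)"
      then have "dst (c i) y = dst (c (i + 2)) y" by simp
      then have "i = n" using lev[of i] lev[of "i + 2"] i by (auto split: if_splits)
      with eq \<open>p \<noteq> q\<close> show False by (simp add: c_def)
    qed
  qed simp
  moreover have "c 0 = y" using nxt_iter_end[of p y] V assms n_def by (simp add: c_def)
  moreover have "c (2 * n + 2) = y" using nxt_iter_end[of q y] V assms q by (simp add: c_def)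
  ultimately show False by simp
qed

text \<open>A tree is bipartite. Two geodesics from \<open>y\<close>, joined by an edge between
  equidistant vertices, form a closed walk of odd length; vertices two steps apart on it never have
  the same distance to \<open>y\<close> (across the joining edge by parity), so it does not
  backtrack.\<close>

lemma dst_adj_neq:
  assumes "y \<in> V" "(u, p) \<in> A"
  shows "dst u y \<noteq> dst p y"
proof
  assume eq: "dst u y = dst p y"
  define n where "n = dst p y"
  have V: "p \<in> V" "u \<in> V" using assms A_sub by auto
  define c where "c i = (if i \<le> n then (nxt y ^^ (n - i)) p else (nxt y ^^ (i - (n + 1))) u)" for i
  have lev: "dst (c i) y = (if i \<le> n then i else 2 * n + 1 - i)" if "i \<le> 2 * n + 1" for i
    using that nxt_iter[of p y "n - i"] nxt_iter[of u y "i - (n + 1)"] V assms(1) eq n_def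
    by (auto simp: c_def)
  have "c 0 \<noteq> c (2 * n + 1)"
  proof (rule A_acyclic)
    fix i assume i: "i < 2 * n + 1"
    consider "i < n" | "i = n" | "i > n" by linarith
    then show "(c i, c (Suc i)) \<in> A"
    proof cases
      case 1
      then have "Suc (n - Suc i) = n - i" by simp
      then have "((nxt y ^^ (n - Suc i)) p, (nxt y ^^ (n - i)) p) \<in> A"
        using nxt_iter_adj[of p y "n - Suc i"] V assms(1) n_def 1 by simp
      with 1 show ?thesis by (simp add: c_def A_sym)
    next
      case 2 then show ?thesis using assms A_sym by (simp add: c_def)
    next
      case 3
      then have "Suc i - (n + 1) = Suc (i - (n + 1))" by simp
      then show ?thesis using 3 i nxt_iter_adj[of u y "i - (n + 1)"] V assms(1) eq n_def by (simp add: c_def)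
    qed
  next
    fix i assume i: "i + 2 \<le> 2 * n + 1"
    show "c i \<noteq> c (i + 2)"
    proof
      assume "c i = c (i + 2)"
      then have "dst (c i) y = dst (c (i + 2)) y" by simp
      then show False using lev[of i] lev[of "i + 2"] i by (auto split: if_splits) presburger
    qed
  qed simp
  moreover have "c 0 = y" using nxt_iter_end[of p y] V assms n_def by (simp add: c_def)
  moreover have "c (2 * n + 1) = y" using nxt_iter_end[of u y] V assms eq n_def by (simp add: c_def)
  ultimately show False by simp
qed

lemma dst_adj_cases:
  assumes "y \<in> V" "(u, p) \<in> A"
  shows "dst u y = Suc (dst p y) \<or> dst p y = Suc (dst u y)"
  using dst_adj_neq[OF assms] dst_step[OF assms(2,1)] dst_step[OF A_sym[OF assms(2)] assms(1)] by linarith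

text \<open>The edge from \<open>u\<close> to \<open>v\<close> separates \<open>x\<close> from \<open>z\<close>, so every path between them crosses it.\<close>

lemma dst_across_edge:
  assumes "(u, v) \<in> A" "x \<in> V" "z \<in> V" "dst v x = Suc (dst u x)" "dst u z = Suc (dst v z)"
  shows "dst x z = dst x u + 1 + dst v z"
  using assms(3,5)
proof (induction "dst v z" arbitrary: z rule: less_induct)
  case less
  have V: "u \<in> V" "v \<in> V" using assms A_sub by auto
  note z = less.prems
  show ?case
  proof (cases "z = v")
    case True
    then show ?thesis using assms(4) by (simp add: dst_sym)
  next
    case False
    obtain z' where z': "(z, z') \<in> A" "Suc (dst z' v) = dst z v" using closer_ex[of z v] z V False by auto
    have z'V: "z' \<in> V" using z' A_sub by auto
    have down: "dst u w' = Suc (dst v w')"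
      if "(w, w') \<in> A" "Suc (dst w' v) = dst w v" "dst u w = Suc (dst v w)" for w w'
    proof -
      have wV: "w' \<in> V" "w \<in> V" using that A_sub by auto
      have "dst w u \<le> Suc (dst w' u)" using dst_step[OF that(1) V(1)] .
      moreover have "dst u w' \<le> Suc (dst v w')" using dst_step[OF assms(1) wV(1)] .
      ultimately show ?thesis using that by (simp add: dst_sym)
    qed
    have dz': "dst u z' = Suc (dst v z')" using down[OF z' z(2)] .
    have eq': "dst x z' = dst x u + 1 + dst v z'"
      using less.hyps[OF _ z'V dz'] z' by (simp add: dst_sym)
    \<comment> \<open>If \<open>z\<close> were closer to \<open>x\<close> than \<open>z'\<close>,
      then \<open>z'\<close> would have two closer neighbours: \<open>z\<close> and the next vertex
      towards \<open>v\<close>, or \<open>u\<close> when \<open>z' = v\<close>. This contradicts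
      \<open>closer_unique\<close>. The second disjunct absorbs truncated subtraction at 0.\<close>
    have "dst z x \<noteq> dst z' x - 1 \<or> dst z' x = 0"
    proof (rule ccontr)
      assume "\<not> ?thesis"
      then have cz: "dst z x < dst z' x" by auto
      show False
      proof (cases "z' = v")
        case True
        have "u = z"
          using closer_unique[OF assms(2), of v u z] A_sym assms z'(1) True cz by auto
        then show False using z by simp
      next
        case False
        obtain w where w: "(z', w) \<in> A" "Suc (dst w v) = dst z' v"
          using closer_ex[of z' v] z'V V False by auto
        have wV: "w \<in> V" using w A_sub by auto
        have "dst x w = dst x u + 1 + dst v w"
          using less.hyps[OF _ wV down[OF w dz']] z' w by (simp add: dst_sym)
        then have "dst w x < dst z' x" using eq' w by (simp add: dst_sym)
        then have "w = z" using closer_unique[OF assms(2), of z' w z] w z'(1) A_sym cz by auto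
        then show False using w z' by simp
      qed
    qed
    then have "dst z x = Suc (dst z' x)"
      using dst_adj_cases[OF assms(2) z'(1)] by auto
    then show ?thesis using eq' z' by (simp add: dst_sym)
  qed
qed

section \<open>Convex subtrees and nearest-point projections\<close>

definition convex :: "'v set \<Rightarrow> bool" where
  "convex C \<longleftrightarrow> C \<subseteq> V \<and>
     (\<forall>u\<in>C. \<forall>y\<in>C. \<forall>n. (u, n) \<in> A \<longrightarrow> dst n y < dst u y \<longrightarrow> n \<in> C)"

lemma convex_sub: "convex C \<Longrightarrow> C \<subseteq> V"
  unfolding convex_def by blast

lemma convexD: "convex C \<Longrightarrow> u \<in> C \<Longrightarrow> y \<in> C \<Longrightarrow> (u, n) \<in> A \<Longrightarrow> dst n y < dst u y \<Longrightarrow> n \<in> C"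
  unfolding convex_def by blast

definition gate :: "'v set \<Rightarrow> 'v \<Rightarrow> 'v" where
  "gate C x = (ARG_MIN (dst x) p. p \<in> C)"

lemma gate_in: "C \<noteq> {} \<Longrightarrow> gate C x \<in> C"
  and gate_min: "c \<in> C \<Longrightarrow> dst x (gate C x) \<le> dst x c"
  unfolding gate_def using arg_min_nat_lemma[of "\<lambda>p. p \<in> C" _ "dst x"] by auto

text \<open>The step from the gate towards \<open>x\<close> leaves \<open>C\<close>, so by convexity
  it leads away from every point of \<open>C\<close>; that edge therefore separates \<open>x\<close>
  from all of \<open>C\<close>.\<close>

lemma dst_gate:
  assumes C: "convex C" and x: "x \<in> V" and c: "c \<in> C"
  shows "dst x c = dst x (gate C x) + dst (gate C x) c"
proof -
  define p where "p = gate C x"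
  have CV: "C \<subseteq> V" using C by (simp add: convex_def)
  have p: "p \<in> C" "p \<in> V" "c \<in> V" using gate_in[of C x] c CV p_def by auto
  show ?thesis
  proof (cases "p = x")
    case True then show ?thesis by (simp add: p_def)
  next
    case False
    obtain p' where p': "(p, p') \<in> A" "Suc (dst p' x) = dst p x" using closer_ex[of p x] p x False by auto
    have p'V: "p' \<in> V" using p' A_sub by auto
    have "p' \<notin> C" using gate_min[of p' C x] p' by (auto simp: p_def dst_sym)
    then have "dst p' c = Suc (dst p c)"
      using convexD[OF C p(1) c p'(1)] dst_adj_cases[OF p(3) p'(1)] by auto
    then have "dst x c = dst x p' + 1 + dst p c"
      using dst_across_edge[OF A_sym[OF p'(1)] x p(3)] p'(2) by simp
    then show ?thesis using p' by (simp add: p_def dst_sym)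
  qed
qed

lemma gate_unique:
  assumes "convex C" "x \<in> V" "c \<in> C" "dst x c \<le> dst x (gate C x)"
  shows "c = gate C x"
proof -
  have CV: "C \<subseteq> V" using assms(1) by (simp add: convex_def)
  have "gate C x \<in> C" using assms(3) by (intro gate_in) auto
  then have "c \<in> V" "gate C x \<in> V" using assms(3) CV by auto
  moreover have "dst (gate C x) c = 0" using dst_gate[OF assms(1-3)] assms(4) by linarith
  ultimately show ?thesis using dst_eq_0 by simp
qed

lemma gate_adj:
  assumes C: "convex C" and c: "c \<in> C" and p: "(c, p) \<in> A" "p \<notin> C"
  shows "gate C p = c"
proof -
  have "p \<in> V" using p A_sub by auto
  moreover have "dst p c = 1" using dst_adj p by (simp add: dst_sym)
  moreover have "dst p (gate C p) \<noteq> 0"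
  proof -
    have "gate C p \<in> C" using c by (intro gate_in) auto
    then have "gate C p \<in> V" "gate C p \<noteq> p" using p(2) convex_sub[OF C] by auto
    then show ?thesis using dst_eq_0[OF \<open>p \<in> V\<close>] by simp
  qed
  ultimately show ?thesis using gate_unique[OF C _ c, of p] by simp
qed

text \<open>At the gate \<open>q\<close> of \<open>z\<close>, the step towards \<open>z\<close>
  leaves \<open>C\<close>, whereas the step towards the gate \<open>p\<close> of \<open>x\<close>,
  which also leads to \<open>x\<close>, stays in \<open>C\<close>. The two differ, so the first edge
  from \<open>q\<close> towards \<open>z\<close> separates \<open>x\<close> from
  \<open>z\<close>.\<close>

lemma dst_gate_gate:
  assumes C: "convex C" "C \<noteq> {}" and x: "x \<in> V" "z \<in> V" and ne: "gate C x \<noteq> gate C z"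
  shows "dst x z = dst x (gate C x) + dst (gate C x) (gate C z) + dst (gate C z) z"
proof -
  define p where "p = gate C x"
  define q where "q = gate C z"
  have pq: "p \<in> C" "q \<in> C" "p \<in> V" "q \<in> V" using gate_in C p_def q_def by (auto simp: convex_def)
  have xq: "dst x q = dst x p + dst p q" using dst_gate[OF C(1) x(1) pq(2)] p_def by simp
  show ?thesis
  proof (cases "q = z")
    case True then show ?thesis using xq by (simp add: p_def q_def)
  next
    case False
    obtain q' where q': "(q, q') \<in> A" "Suc (dst q' z) = dst q z" using closer_ex[of q z] pq x False by auto
    have q'V: "q' \<in> V" using q' A_sub by auto
    have q'C: "q' \<notin> C" using gate_min[of q' C z] q' by (auto simp: q_def dst_sym)
    obtain r where r: "(q, r) \<in> A" "Suc (dst r p) = dst q p"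
      using closer_ex[of q p] pq ne p_def q_def by auto
    have rC: "r \<in> C" using convexD[OF C(1) pq(2,1) r(1)] r by simp
    have "dst r x < dst q x" using dst_gate[OF C(1) x(1) rC] xq r by (simp add: p_def dst_sym)
    then have "\<not> dst q' x < dst q x" using closer_unique[OF x(1) r(1) q'(1)] rC q'C by auto
    then have "dst q' x = Suc (dst q x)" using dst_adj_cases[OF x(1) q'(1)] by auto
    then have "dst x z = dst x q + 1 + dst q' z"
      using dst_across_edge[OF q'(1) x(1,2)] q' by simp
    then show ?thesis using xq q' by (simp add: p_def q_def)
  qed
qed

end

text \<open>A closed walk without backtracking contains a genuine cycle: if \<open>c j\<close> is
  the first vertex that repeats an earlier one \<open>c i\<close>, the stretch between them is
  injective, and its length is at least 3 since lengths 1 and 2 would be a loop and a backtrack.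
  \<open>metric_tree\<close> states acyclicity for such walks because two geodesics can then be
  joined without checking that their vertices are distinct.\<close>

lemma undirected_tree_imp_metric_tree:
  assumes "undirected_tree T"
  shows "metric_tree (pverts T) (parcs T)"
proof -
  interpret pair_bidirected_digraph T using assms by (simp add: undirected_tree_def)
  have sym: "(v, u) \<in> parcs T" if "(u, v) \<in> parcs T" for u v using that by (rule arcs_symmetric)
  have irr: "(u, u) \<notin> parcs T" for u using pair_no_loops[of "(u, u)"] by auto
  show ?thesis
  proof
    fix u v assume "(u, v) \<in> parcs T"
    then show "u \<in> pverts T \<and> v \<in> pverts T" using wellformed' by blast
  next
    fix u v assume uv: "u \<in> pverts T" "v \<in> pverts T"
    have "strongly_connected (mk_symmetric (with_proj T))"
      using assms by (simp add: undirected_tree_def connected_def)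
    then have "(u, v) \<in> rtrancl_on (verts (mk_symmetric (with_proj T))) (arcs_ends (mk_symmetric (with_proj T)))"
      using uv unfolding strongly_connected_def reachable_def by (simp add: mk_symmetric_def)
    moreover have "arcs_ends (mk_symmetric (with_proj T)) = parcs T"
      using sym by (auto simp: mk_symmetric_def)
    ultimately have "(u, v) \<in> (parcs T)\<^sup>*" by (simp add: rtrancl_on_rtranclI)
    then show "\<exists>n. (u, v) \<in> parcs T ^^ n" by (rule rtrancl_imp_relpow)
  next
    fix c :: "nat \<Rightarrow> 'a" and n :: nat
    assume n: "n \<ge> 1" and adj: "\<And>i. i < n \<Longrightarrow> (c i, c (Suc i)) \<in> parcs T"
      and red: "\<And>i. i + 2 \<le> n \<Longrightarrow> c i \<noteq> c (i + 2)"
    show "c 0 \<noteq> c n"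
    proof
      assume "c 0 = c n"
      define Q where "Q j \<longleftrightarrow> j \<le> n \<and> (\<exists>i<j. c i = c j)" for j
      have "Q n" using n \<open>c 0 = c n\<close> by (auto simp: Q_def intro!: exI[of _ 0])
      define j where "j = (LEAST j. Q j)"
      have Qj: "Q j" and min: "\<And>k. k < j \<Longrightarrow> \<not> Q k"
        using \<open>Q n\<close> unfolding j_def by (auto intro: LeastI dest: not_less_Least)
      obtain i where i: "i < j" "c i = c j" "j \<le> n" using Qj by (auto simp: Q_def)
      have inj: "inj_on c {Suc i..j}"
      proof -
        have ne: "c k \<noteq> c l" if kl: "i < k" "k < l" "l \<le> j" for k l
        proof
          assume eq: "c k = c l"
          show False
          proof (cases "l = j")
            case True
            then have "Q k" using i kl eq by (auto simp: Q_def intro!: exI[of _ i])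
            then show False using min kl by auto
          next
            case False
            then have "Q l" using i kl eq by (auto simp: Q_def)
            then show False using min[of l] kl False by auto
          qed
        qed
        show ?thesis by (rule linorder_inj_onI') (use ne in auto)
      qed
      have ge3: "j - i \<ge> 3"
      proof -
        have "j \<noteq> Suc i" using adj[of i] i irr by auto
        moreover have "j \<noteq> i + 2" using red[of i] i by auto
        ultimately show ?thesis using i(1) by linarith
      qed
      define p where "p a m = map (\<lambda>k. (c k, c (Suc k))) [a..<a + m]" for a m
      have p_Suc: "p a (Suc m) = (c a, c (Suc a)) # p (Suc a) m" for a m
        by (simp add: p_def upt_conv_Cons del: upt_Suc)
      have cas: "pcas (c a) (p a m) (c (a + m))" for a m
        by (induction m arbitrary: a) (simp_all add: p_Suc, simp add: p_def, metis add_Suc)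
      have vs: "pawalk_verts (c a) (p a m) = map c [a..<Suc (a + m)]" for a m
      proof (induction m arbitrary: a)
        case (Suc m)
        show ?case unfolding p_Suc by (simp add: Suc upt_conv_Cons del: upt_Suc)
      qed (simp add: p_def)
      have ij: "i + (j - i) = j" using i by simp
      have "pre_digraph.cycle (with_proj T) (p i (j - i))"
        unfolding pre_digraph.cycle_def
      proof (intro exI conjI)
        have "pcas (c i) (p i (j - i)) (c i)" using cas[of i "j - i"] ij i by simp
        moreover have "set (p i (j - i)) \<subseteq> parcs T" using adj i by (auto simp: p_def)
        moreover have "c i \<in> pverts T" using adj[of i] i wellformed' by auto
        ultimately show "pre_digraph.awalk (with_proj T) (c i) (p i (j - i)) (c i)"
          by (simp add: pre_digraph.awalk_def)
        have "tl (pawalk_verts (c i) (p i (j - i))) = map c [Suc i..<Suc j]"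
          using vs[of i "j - i"] ij i by (simp add: upt_conv_Cons del: upt_Suc)
        then show "distinct (tl (pre_digraph.awalk_verts (with_proj T) (c i) (p i (j - i))))"
          using inj by (simp add: distinct_map atLeastLessThanSuc_atLeastAtMost del: upt_Suc)
        show "p i (j - i) \<noteq> []" using i by (simp add: p_def)
      qed
      moreover have "length (p i (j - i)) \<ge> 3" using ge3 by (simp add: p_def)
      ultimately show False using assms by (auto simp: undirected_tree_def)
    qed
  qed (use sym irr in auto)
qed

section \<open>Groups acting on trees\<close>

locale tree_act = group G + metric_tree V A
  for G :: "('a, 'b) monoid_scheme" (structure) and V :: "'v set" and A :: "'v rel" +
  fixes \<phi> :: "'a \<Rightarrow> 'v \<Rightarrow> 'v"
  assumes action: "group_action G V \<phi>"
    and act_adj: "g \<in> carrier G \<Longrightarrow> (u, v) \<in> A \<Longrightarrow> (\<phi> g u, \<phi> g v) \<in> A"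
begin

lemma act_in: "g \<in> carrier G \<Longrightarrow> x \<in> V \<Longrightarrow> \<phi> g x \<in> V"
  using group_action.element_image[OF action] by blast

lemma act_mult: "g \<in> carrier G \<Longrightarrow> h \<in> carrier G \<Longrightarrow> x \<in> V \<Longrightarrow> \<phi> (g \<otimes> h) x = \<phi> g (\<phi> h x)"
  using group_action.composition_rule[OF action] by blast

lemma act_one: "x \<in> V \<Longrightarrow> \<phi> \<one> x = x"
  using group_action.id_eq_one[OF action] by (metis restrict_apply')

lemma act_inv_act: "g \<in> carrier G \<Longrightarrow> x \<in> V \<Longrightarrow> \<phi> (inv g) (\<phi> g x) = x"
  using act_mult[of "inv g" g x] act_one by simp

lemma act_act_inv: "g \<in> carrier G \<Longrightarrow> x \<in> V \<Longrightarrow> \<phi> g (\<phi> (inv g) x) = x"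
  using act_mult[of g "inv g" x] act_one by simp

lemma act_eq_iff: "g \<in> carrier G \<Longrightarrow> x \<in> V \<Longrightarrow> y \<in> V \<Longrightarrow> \<phi> g x = y \<longleftrightarrow> x = \<phi> (inv g) y"
  using act_inv_act act_act_inv by metis

lemma act_relpow: "g \<in> carrier G \<Longrightarrow> (u, v) \<in> A ^^ n \<Longrightarrow> (\<phi> g u, \<phi> g v) \<in> A ^^ n"
proof (induction n arbitrary: v)
  case (Suc n)
  then obtain w where "(u, w) \<in> A ^^ n" "(w, v) \<in> A" by auto
  then have "(\<phi> g u, \<phi> g w) \<in> A ^^ n" "(\<phi> g w, \<phi> g v) \<in> A"
    using Suc act_adj by auto
  then show ?case by auto
qed simp

lemma dst_act:
  assumes "g \<in> carrier G" "u \<in> V" "v \<in> V"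
  shows "dst (\<phi> g u) (\<phi> g v) = dst u v"
proof (rule antisym)
  have le: "dst (\<phi> h x) (\<phi> h y) \<le> dst x y" if "h \<in> carrier G" "x \<in> V" "y \<in> V" for h x y
    using that act_relpow[OF that(1) dst_relpow[OF that(2,3)]] by (rule_tac dst_le)
  show "dst (\<phi> g u) (\<phi> g v) \<le> dst u v" using le assms by blast
  have "dst (\<phi> (inv g) (\<phi> g u)) (\<phi> (inv g) (\<phi> g v)) \<le> dst (\<phi> g u) (\<phi> g v)"
    using le assms act_in by simp
  then show "dst u v \<le> dst (\<phi> g u) (\<phi> g v)" using assms act_inv_act by simp
qed

definition Fix :: "'a \<Rightarrow> 'v set" where
  "Fix e = {x \<in> V. \<phi> e x = x}"

text \<open>An element that fixes \<open>u\<close> and \<open>y\<close> fixes the unique neighbour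
  of \<open>u\<close> closer to \<open>y\<close>.\<close>

lemma convex_Fix:
  assumes "e \<in> carrier G"
  shows "convex (Fix e)"
  unfolding convex_def
proof (intro conjI ballI allI impI)
  fix u y n assume u: "u \<in> Fix e" and y: "y \<in> Fix e" and n: "(u, n) \<in> A" "dst n y < dst u y"
  have V: "u \<in> V" "y \<in> V" "n \<in> V" and f: "\<phi> e u = u" "\<phi> e y = y"
    using u y n A_sub by (auto simp: Fix_def)
  have "(u, \<phi> e n) \<in> A" using act_adj[OF assms n(1)] f by simp
  moreover have "dst (\<phi> e n) y < dst u y" using dst_act[OF assms V(3,2)] f n by simp
  ultimately have "\<phi> e n = n" using closer_unique[OF V(2) _ n(1) _ n(2)] by blast
  then show "n \<in> Fix e" using V by (simp add: Fix_def)
qed (auto simp: Fix_def)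

lemma gate_act:
  assumes C: "convex C" "C \<noteq> {}" and k: "k \<in> carrier G" and x: "x \<in> V"
    and inv: "\<And>c. c \<in> C \<Longrightarrow> \<phi> k c \<in> C" "\<And>c. c \<in> C \<Longrightarrow> \<phi> (inv k) c \<in> C"
  shows "gate C (\<phi> k x) = \<phi> k (gate C x)"
proof -
  define q where "q = gate C (\<phi> k x)"
  have q: "q \<in> C" "q \<in> V" using gate_in[OF C(2)] convex_sub[OF C(1)] by (auto simp: q_def)
  have p: "gate C x \<in> C" "gate C x \<in> V" using gate_in[OF C(2)] convex_sub[OF C(1)] by auto
  have "dst (\<phi> k x) (\<phi> k (gate C x)) = dst x (gate C x)" using dst_act k x p by simp
  also have "\<dots> \<le> dst x (\<phi> (inv k) q)" using gate_min inv q by simp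
  also have "\<dots> = dst (\<phi> k x) (\<phi> k (\<phi> (inv k) q))" using dst_act k x q act_in by simp
  also have "\<dots> = dst (\<phi> k x) q" using act_act_inv k q by simp
  finally have "\<phi> k (gate C x) = q"
    unfolding q_def using gate_unique C(1) act_in k x inv p by simp
  then show ?thesis by (simp add: q_def)
qed

lemma Fix_commute:
  assumes "e \<in> carrier G" "k \<in> carrier G" "e \<otimes> k = k \<otimes> e" "c \<in> Fix e"
  shows "\<phi> k c \<in> Fix e"
  using assms act_mult[of e k c] act_mult[of k e c] act_in by (auto simp: Fix_def)

lemma inv_commute:
  assumes "e \<in> carrier G" "k \<in> carrier G" "e \<otimes> k = k \<otimes> e"
  shows "e \<otimes> inv k = inv k \<otimes> e"
  by (metis assms inv_closed inv_solve_left inv_solve_right m_assoc m_closed)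

lemma gate_Fix:
  assumes "e \<in> carrier G" "k \<in> carrier G" "e \<otimes> k = k \<otimes> e" "Fix e \<noteq> {}" "x \<in> V"
  shows "gate (Fix e) (\<phi> k x) = \<phi> k (gate (Fix e) x)"
  using assms by (intro gate_act convex_Fix Fix_commute inv_commute) auto

text \<open>\<open>k\<close> preserves \<open>Fix e\<close>, hence commutes with the projection to
  it; the projection of a vertex fixed by \<open>k\<close> is fixed by both.\<close>

lemma common_fixed_vertex:
  assumes "e \<in> carrier G" "k \<in> carrier G" "e \<otimes> k = k \<otimes> e" "Fix e \<noteq> {}" "Fix k \<noteq> {}"
  shows "Fix e \<inter> Fix k \<noteq> {}"
proof -
  obtain w where w: "w \<in> V" "\<phi> k w = w" using assms(5) by (auto simp: Fix_def)
  have "\<phi> k (gate (Fix e) w) = gate (Fix e) w"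
    using gate_Fix[OF assms(1-4) w(1)] w by simp
  moreover have "gate (Fix e) w \<in> Fix e" using gate_in assms(4) by simp
  ultimately show ?thesis by (auto simp: Fix_def)
qed

text \<open>The axis of \<open>k\<close> when \<open>k\<close> neither fixes a vertex nor inverts an
  edge. Least displacement spares the construction of a line and makes existence a matter of
  minimising a natural number.\<close>

definition Min_set :: "'a \<Rightarrow> 'v set" where
  "Min_set k = {x \<in> V. \<forall>y\<in>V. dst x (\<phi> k x) \<le> dst y (\<phi> k y)}"

lemma Min_set_nonempty: "V \<noteq> {} \<Longrightarrow> Min_set k \<noteq> {}"
  using arg_min_nat_lemma[of "\<lambda>x. x \<in> V" _ "\<lambda>x. dst x (\<phi> k x)"] unfolding Min_set_def by blast

text \<open>Outside \<open>Fix e\<close>, projecting to \<open>Fix e\<close> strictly decreases the displacement of \<open>k\<close>.\<close>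

lemma Min_set_fixed:
  assumes e: "e \<in> carrier G" "k \<in> carrier G" "e \<otimes> k = k \<otimes> e" "Fix e \<noteq> {}"
    and k: "Fix k = {}" and x: "x \<in> Min_set k"
  shows "\<phi> e x = x"
proof -
  define p where "p = gate (Fix e) x"
  have xV: "x \<in> V" using x by (simp add: Min_set_def)
  have p: "p \<in> Fix e" using gate_in e(4) by (simp add: p_def)
  then have pV: "p \<in> V" by (simp add: Fix_def)
  have kp: "gate (Fix e) (\<phi> k x) = \<phi> k p" using gate_Fix[OF e xV] by (simp add: p_def)
  have "\<phi> k p \<noteq> p" using k pV by (auto simp: Fix_def)
  then have "dst x (\<phi> k x) = dst x p + dst p (\<phi> k p) + dst (\<phi> k p) (\<phi> k x)"
    using dst_gate_gate[OF convex_Fix[OF e(1)] e(4) xV act_in[OF e(2) xV]] kp by (simp add: p_def)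
  moreover have "dst x (\<phi> k x) \<le> dst p (\<phi> k p)" using x pV by (simp add: Min_set_def)
  ultimately have "x = p" using dst_eq_0[OF xV pV] by simp
  then show ?thesis using p by (simp add: Fix_def)
qed

lemma Min_set_commute:
  assumes "k \<in> carrier G" "h \<in> carrier G" "h \<otimes> k = k \<otimes> h" "x \<in> Min_set k"
  shows "\<phi> h x \<in> Min_set k"
proof -
  have x: "x \<in> V" using assms by (simp add: Min_set_def)
  have "\<phi> k (\<phi> h x) = \<phi> h (\<phi> k x)" using act_mult[of k h x] act_mult[of h k x] assms x by simp
  then have "dst (\<phi> h x) (\<phi> k (\<phi> h x)) = dst x (\<phi> k x)" using dst_act assms x act_in by simp
  then show ?thesis using assms act_in by (simp add: Min_set_def)
qed

end

section \<open>Free actions and free groups\<close>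

context metric_tree
begin

text \<open>Every distance from the new vertex to \<open>C\<close> runs through \<open>c\<close>
  (\<open>far\<close>), so only steps out of \<open>p\<close> or towards \<open>p\<close> need
  attention.\<close>

lemma convex_insert:
  assumes C: "convex C" and c: "c \<in> C" and p: "(c, p) \<in> A"
  shows "convex (insert p C)"
proof (cases "p \<in> C")
  case True
  then show ?thesis using C by (simp add: insert_absorb)
next
  case False
  have V: "C \<subseteq> V" "p \<in> V" using convex_sub[OF C] A_sub[OF p] by auto
  have far: "dst p y = Suc (dst c y)" if "y \<in> C" for y
  proof -
    have "\<not> dst p y < dst c y" using convexD[OF C c that p] False by blast
    moreover have "y \<in> V" using that V by blast
    ultimately show ?thesis using dst_adj_cases[OF _ p, of y] by auto
  qed
  have "n \<in> insert p C"
    if u: "u \<in> insert p C" and y: "y \<in> insert p C" and n: "(u, n) \<in> A" "dst n y < dst u y" for u y n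
  proof -
    consider "u = p" "y = p" | "u = p" "y \<in> C" | "u = c" "y = p" | "u \<in> C" "u \<noteq> c" "y = p" | "u \<in> C" "y \<in> C"
      using u y by auto
    then show ?thesis
    proof cases
      case 1 then show ?thesis using n by simp
    next
      case 2
      then have "dst c y < dst u y" using far by simp
      then have "n = c" using closer_unique[of y u n c] 2 V n A_sym[OF p] by auto
      then show ?thesis using c by simp
    next
      case 3
      then have "dst n p = 0" using n dst_adj[OF p] by simp
      then show ?thesis using dst_eq_0[of n p] A_sub[OF n(1)] V by simp
    next
      case 4
      obtain m where m: "(u, m) \<in> A" "Suc (dst m c) = dst u c" using closer_ex[of u c] 4 V c by auto
      have mC: "m \<in> C" using convexD[OF C 4(1) c m(1)] m by simp
      have "dst m p < dst u p" using far[OF mC] far[OF 4(1)] m by (simp add: dst_sym)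
      then have "n = m" using closer_unique[of p u n m] 4 V n m by simp
      then show ?thesis using mC by simp
    next
      case 5 then show ?thesis using convexD[OF C 5 n] by simp
    qed
  qed
  then show ?thesis using V unfolding convex_def by blast
qed

lemma gate_self: "convex C \<Longrightarrow> c \<in> C \<Longrightarrow> gate C c = c"
  using gate_unique[of C c c] convex_sub[of C] by auto

end

context group
begin

definition letter :: "'a \<times> bool \<Rightarrow> 'a" where
  "letter p = (if snd p then fst p else inv (fst p))"

lemma letter_closed [simp]: "fst p \<in> carrier G \<Longrightarrow> letter p \<in> carrier G"
  by (simp add: letter_def)

lemma letter_flip: "fst p \<in> carrier G \<Longrightarrow> letter (fst p, \<not> snd p) = inv (letter p)"
  by (simp add: letter_def)

lemma eval_word_simps:
  "eval_word G [] = \<one>" "eval_word G (p # w) = letter p \<otimes> eval_word G w"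
  by (auto simp: eval_word_def letter_def split: prod.splits)

lemma eval_word_in_carrier: "fst ` set w \<subseteq> carrier G \<Longrightarrow> eval_word G w \<in> carrier G"
  by (induction w) (auto simp: eval_word_simps)

end

section \<open>Free actions and a subtree that meets every orbit once\<close>

locale free_tree_act = tree_act +
  assumes free: "g \<in> carrier G \<Longrightarrow> x \<in> V \<Longrightarrow> \<phi> g x = x \<Longrightarrow> g = \<one>"
    and no_inversion: "g \<in> carrier G \<Longrightarrow> (u, v) \<in> A \<Longrightarrow> \<not> (\<phi> g u = v \<and> \<phi> g v = u)"
    and V_nonempty: "V \<noteq> {}"
begin

text \<open>This lifts a maximal subtree of the quotient graph: Zorn gives a maximal convex
  \<open>C\<close> with at most one vertex from each orbit. If the orbit of \<open>x\<close> is
  missed while a neighbour of \<open>x\<close> lies in a translate of \<open>C\<close>, moving back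
  gives a neighbour \<open>p\<close> of \<open>C\<close> in that orbit, and
  \<open>insert p C\<close> contradicts maximality.\<close>

lemma transversal:
  obtains C where "convex C" "C \<noteq> {}"
    "\<And>g u v. g \<in> carrier G \<Longrightarrow> u \<in> C \<Longrightarrow> v \<in> C \<Longrightarrow> \<phi> g u = v \<Longrightarrow> u = v"
    "\<And>x. x \<in> V \<Longrightarrow> \<exists>g\<in>carrier G. \<exists>c\<in>C. x = \<phi> g c"
proof -
  define P where "P C \<longleftrightarrow> convex C \<and> C \<noteq> {} \<and> (\<forall>g\<in>carrier G. \<forall>u\<in>C. \<forall>v\<in>C. \<phi> g u = v \<longrightarrow> u = v)" for C
  obtain v0 where v0: "v0 \<in> V" using V_nonempty by auto
  have "P {v0}" using v0 by (auto simp: P_def convex_def)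
  moreover have "P (\<Union>\<C>)" if ne: "\<C> \<noteq> {}" and ch: "subset.chain {C. P C} \<C>" for \<C>
  proof -
    have PC: "P C" if "C \<in> \<C>" for C using ch that by (auto simp: subset.chain_def)
    have two: "\<exists>C\<in>\<C>. u \<in> C \<and> v \<in> C" if uv: "u \<in> \<Union>\<C>" "v \<in> \<Union>\<C>" for u v
    proof -
      obtain C D where CD: "C \<in> \<C>" "D \<in> \<C>" "u \<in> C" "v \<in> D" using uv by blast
      then have "C \<subseteq> D \<or> D \<subseteq> C" using ch by (auto simp: subset_chain_def)
      then show ?thesis using CD by blast
    qed
    have "convex (\<Union>\<C>)"
      unfolding convex_def
    proof (intro conjI ballI allI impI)
      show "\<Union>\<C> \<subseteq> V" using PC convex_sub by (auto simp: P_def)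
      fix u y n assume "u \<in> \<Union>\<C>" "y \<in> \<Union>\<C>" and n: "(u, n) \<in> A" "dst n y < dst u y"
      then obtain C where "C \<in> \<C>" "u \<in> C" "y \<in> C" using two by meson
      then show "n \<in> \<Union>\<C>" using PC[of C] convexD[of C u y n] n by (auto simp: P_def)
    qed
    moreover have "\<Union>\<C> \<noteq> {}" using ne PC by (auto simp: P_def)
    moreover have "u = v" if uv: "g \<in> carrier G" "u \<in> \<Union>\<C>" "v \<in> \<Union>\<C>" "\<phi> g u = v" for g u v
    proof -
      obtain C where "C \<in> \<C>" "u \<in> C" "v \<in> C" using two[OF uv(2,3)] by blast
      then show ?thesis using PC[of C] uv unfolding P_def by blast
    qed
    ultimately show ?thesis by (auto simp: P_def)
  qed
  ultimately obtain C where C: "P C" and max: "\<And>D. P D \<Longrightarrow> C \<subseteq> D \<Longrightarrow> D = C"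
    using subset_Zorn_nonempty[of "{C. P C}"] by blast
  have conv: "convex C" "C \<noteq> {}" using C by (auto simp: P_def)
  obtain w where w: "w \<in> C" using conv by auto
  have CV: "C \<subseteq> V" using convex_sub[OF conv(1)] .
  have "\<exists>g\<in>carrier G. \<exists>c\<in>C. x = \<phi> g c" if "x \<in> V" for x
    using that
  proof (induction "dst x w" arbitrary: x rule: less_induct)
    case less
    show ?case
    proof (cases "x = w")
      case True
      then show ?thesis using w CV act_one by (intro bexI[of _ \<one>] bexI[of _ w]) auto
    next
      case False
      then obtain z where z: "(x, z) \<in> A" "Suc (dst z w) = dst x w"
        using closer_ex[of x w] less.prems w CV by auto
      then obtain g c where g: "g \<in> carrier G" "c \<in> C" "z = \<phi> g c"
        using less.hyps[of z] A_sub[OF z(1)] by auto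
      define p where "p = \<phi> (inv g) x"
      have "(\<phi> (inv g) z, \<phi> (inv g) x) \<in> A" using act_adj g A_sym[OF z(1)] by simp
      then have cp: "(c, p) \<in> A" using act_inv_act[of g c] g CV by (auto simp: p_def)
      have xp: "x = \<phi> g p" using act_act_inv[of g x] g less.prems by (simp add: p_def)
      have pV: "p \<in> V" using A_sub[OF cp] by auto
      show ?thesis
      proof (rule ccontr)
        assume no: "\<not> ?thesis"
        have hit: False if "h \<in> carrier G" "v \<in> C" "\<phi> h v = p" for h v
        proof -
          have "x = \<phi> (g \<otimes> h) v" using act_mult[of g h v] xp g that CV by auto
          then show False using no that g by blast
        qed
        have hit': False if h: "h \<in> carrier G" "v \<in> C" "\<phi> h p = v" for h v
        proof -
          have "\<phi> (inv h) v = p" using act_inv_act[of h p] h pV by auto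
          then show False using hit[of "inv h" v] h by simp
        qed
        have "P (insert p C)" unfolding P_def
        proof (intro conjI ballI impI)
          show "convex (insert p C)" using convex_insert[OF conv(1) g(2) cp] .
          fix h u v assume h: "h \<in> carrier G" "u \<in> insert p C" "v \<in> insert p C" "\<phi> h u = v"
          then show "u = v" using hit[of h u] hit'[of h v] C unfolding P_def by auto
        qed simp
        then have "p \<in> C" using max[of "insert p C"] by auto
        then show False using no xp g by auto
      qed
    qed
  qed
  then show ?thesis using that conv C unfolding P_def by blast
qed

end

locale transversal_tree_act = free_tree_act +
  fixes C
  assumes C_convex: "convex C" and C_nonempty: "C \<noteq> {}"
    and C_inj: "g \<in> carrier G \<Longrightarrow> u \<in> C \<Longrightarrow> v \<in> C \<Longrightarrow> \<phi> g u = v \<Longrightarrow> u = v"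
    and C_cover: "x \<in> V \<Longrightarrow> \<exists>g\<in>carrier G. \<exists>c\<in>C. x = \<phi> g c"
begin

lemma C_sub: "c \<in> C \<Longrightarrow> c \<in> V"
  using convex_sub[OF C_convex] by auto

lemma act_notin_C: "x \<in> carrier G \<Longrightarrow> x \<noteq> \<one> \<Longrightarrow> c \<in> C \<Longrightarrow> \<phi> x c \<notin> C"
  using C_inj[of x c "\<phi> x c"] free C_sub by force

text \<open>The elements whose translate of the fundamental tree \<open>C\<close> is adjacent to \<open>C\<close>; they are the
  free generators and their inverses.\<close>

definition gens :: "'a set" where
  "gens = {x \<in> carrier G. x \<noteq> \<one> \<and> (\<exists>u\<in>C. \<exists>v\<in>C. (u, \<phi> x v) \<in> A)}"

text \<open>The edge from \<open>u\<close> to \<open>\<phi> x v\<close> separates \<open>C\<close>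
  from its translate, so the distance from \<open>w\<close> to \<open>\<phi> x z\<close> is 1 plus
  the distances from \<open>w\<close> to \<open>u\<close> and from \<open>\<phi> x v\<close> to
  \<open>\<phi> x z\<close>. The total is 1, hence both vanish.\<close>

lemma edge_unique:
  assumes x: "x \<in> carrier G" "x \<noteq> \<one>" and uv: "u \<in> C" "v \<in> C" "(u, \<phi> x v) \<in> A"
    and wz: "w \<in> C" "z \<in> C" "(w, \<phi> x z) \<in> A"
  shows "u = w \<and> v = z"
proof -
  have V: "u \<in> V" "v \<in> V" "w \<in> V" "z \<in> V" using uv wz C_sub by auto
  have gp: "gate C (\<phi> x v) = u" "gate C (\<phi> x z) = w"
    using gate_adj[OF C_convex] uv wz act_notin_C[OF x] by auto
  have "(v, \<phi> (inv x) u) \<in> A"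
    using act_adj[OF inv_closed[OF x(1)] A_sym[OF uv(3)]] act_inv_act[OF x(1) V(2)] by simp
  moreover have "inv x \<noteq> \<one>" using x by (simp add: inv_eq_1_iff)
  ultimately have gu: "gate C (\<phi> (inv x) u) = v"
    using gate_adj[OF C_convex uv(2)] act_notin_C[of "inv x" u] x uv by simp
  have "dst u (\<phi> x z) = dst (\<phi> (inv x) u) (\<phi> (inv x) (\<phi> x z))"
    using dst_act[of "inv x" u "\<phi> x z"] act_in x V by simp
  also have "\<dots> = dst (\<phi> (inv x) u) z" using act_inv_act x V by simp
  also have "\<dots> = dst (\<phi> (inv x) u) v + dst v z"
    using dst_gate[OF C_convex _ wz(2)] gu act_in x V by simp
  also have "dst (\<phi> (inv x) u) v = dst u (\<phi> x v)"
    using dst_act[of x "\<phi> (inv x) u" v] act_in act_act_inv x V by simp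
  also have "dst v z = dst (\<phi> x v) (\<phi> x z)" using dst_act x V by simp
  finally have 1: "dst u (\<phi> x z) = Suc (dst (\<phi> x v) (\<phi> x z))" using dst_adj[OF uv(3)] by simp
  have 2: "dst (\<phi> x v) w = Suc (dst u w)"
    using dst_gate[OF C_convex _ wz(1), of "\<phi> x v"] gp act_in x V dst_adj[OF uv(3)]
    by (simp add: dst_sym)
  have "dst w (\<phi> x z) = dst w u + 1 + dst (\<phi> x v) (\<phi> x z)"
    using dst_across_edge[OF uv(3) V(3) _ 2 1] act_in x V by simp
  then have "dst w u = 0" "dst (\<phi> x v) (\<phi> x z) = 0" using dst_adj[OF wz(3)] by auto
  then show ?thesis using dst_eq_0 dst_act x V by auto
qed

text \<open>\<open>trg x\<close> is recorded in \<open>C\<close>, before translation by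
  \<open>x\<close>, so that passing to \<open>inv x\<close> swaps \<open>src\<close> and
  \<open>trg\<close>.\<close>

definition src :: "'a \<Rightarrow> 'c" where "src x = (SOME u. u \<in> C \<and> (\<exists>v\<in>C. (u, \<phi> x v) \<in> A))"
definition trg :: "'a \<Rightarrow> 'c" where "trg x = (SOME v. v \<in> C \<and> (src x, \<phi> x v) \<in> A)"

lemma edge:
  assumes "x \<in> gens"
  shows "src x \<in> C" "trg x \<in> C" "(src x, \<phi> x (trg x)) \<in> A" "src x \<in> V" "trg x \<in> V"
proof -
  have "\<exists>u. u \<in> C \<and> (\<exists>v\<in>C. (u, \<phi> x v) \<in> A)" using assms by (auto simp: gens_def)
  from someI_ex[OF this] have s: "src x \<in> C \<and> (\<exists>v\<in>C. (src x, \<phi> x v) \<in> A)" unfolding src_def .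
  then have "\<exists>v. v \<in> C \<and> (src x, \<phi> x v) \<in> A" by auto
  from someI_ex[OF this] have "trg x \<in> C \<and> (src x, \<phi> x (trg x)) \<in> A" unfolding trg_def .
  with s show "src x \<in> C" "trg x \<in> C" "(src x, \<phi> x (trg x)) \<in> A" "src x \<in> V" "trg x \<in> V"
    using C_sub by auto
qed

lemma gens_carrier: "x \<in> gens \<Longrightarrow> x \<in> carrier G"
  by (simp add: gens_def)

lemma gens_inv:
  assumes "x \<in> gens"
  shows "inv x \<in> gens" "src (inv x) = trg x" "trg (inv x) = src x"
proof -
  have x: "x \<in> carrier G" "x \<noteq> \<one>" using assms by (auto simp: gens_def)
  have e: "(trg x, \<phi> (inv x) (src x)) \<in> A"
    using act_adj[OF inv_closed[OF x(1)] A_sym[OF edge(3)[OF assms]]] act_inv_act[OF x(1)] edge[OF assms]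
    by simp
  have n: "inv x \<noteq> \<one>" using x by (simp add: inv_eq_1_iff)
  show i: "inv x \<in> gens" using e n x edge[OF assms] unfolding gens_def by blast
  show "src (inv x) = trg x" "trg (inv x) = src x"
    using edge_unique[OF inv_closed[OF x(1)] n edge(1-3)[OF i] edge(2)[OF assms] edge(1)[OF assms] e]
    by auto
qed

text \<open>A generator of order 2 would exchange the ends of its edge; this is why inversions must
  be excluded.\<close>

lemma gens_inv_neq:
  assumes "x \<in> gens"
  shows "inv x \<noteq> x"
proof
  assume eq: "inv x = x"
  note e = edge[OF assms]
  have st: "trg x = src x" using gens_inv(2)[OF assms] eq by simp
  have "\<phi> x (\<phi> x (src x)) = src x"
    using act_inv_act[OF gens_carrier[OF assms] e(4)] eq by simp
  then show False using no_inversion[OF gens_carrier[OF assms] e(3)] st by simp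
qed

section \<open>Ping-pong with the half-trees beyond the edges that leave the fundamental
  tree\<close>

definition side :: "'a \<Rightarrow> 'c set" where
  "side x = {y \<in> V. dst y (\<phi> x (trg x)) < dst y (src x)}"

lemma gate_side:
  assumes x: "x \<in> gens" and y: "y \<in> side x"
  shows "gate C y = src x"
proof (rule ccontr)
  assume ne: "gate C y \<noteq> src x"
  note e = edge[OF x]
  have yV: "y \<in> V" using y by (simp add: side_def)
  have g: "gate C y \<in> C" "gate C y \<in> V" using gate_in[OF C_nonempty] C_sub by auto
  obtain n where n: "(src x, n) \<in> A" "Suc (dst n (gate C y)) = dst (src x) (gate C y)"
    using closer_ex[of "src x" "gate C y"] g e ne by auto
  have nC: "n \<in> C" using convexD[OF C_convex e(1) g(1) n(1)] n by simp
  have "dst n y < dst (src x) y"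
    using dst_gate[OF C_convex yV nC] dst_gate[OF C_convex yV e(1)] n by (simp add: dst_sym)
  moreover have "dst (\<phi> x (trg x)) y < dst (src x) y" using y by (simp add: side_def dst_sym)
  ultimately have "n = \<phi> x (trg x)" using closer_unique[OF yV n(1) e(3)] by simp
  then show False using nC act_notin_C e x by (auto simp: gens_def)
qed

text \<open>A point of a side determines the edge by which \<open>C\<close> is left on the way to
  it: the gate gives its inner end, \<open>closer_unique\<close> its outer end. \<open>C_inj\<close>
  and freeness then recover the group element.\<close>

lemma side_disjoint:
  assumes x: "x \<in> gens" "x' \<in> gens" and y: "y \<in> side x" "y \<in> side x'"
  shows "x = x'"
proof -
  note e = edge[OF x(1)] and e' = edge[OF x(2)]
  have s: "src x = src x'" using gate_side x y by metis
  have "\<phi> x (trg x) = \<phi> x' (trg x')"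
    using closer_unique[of y "src x" "\<phi> x (trg x)" "\<phi> x' (trg x')"] e(3) e'(3) y s
    by (auto simp: side_def dst_sym)
  then have eq: "\<phi> (inv x' \<otimes> x) (trg x) = trg x'"
    using act_mult[of "inv x'" x "trg x"] act_inv_act e(5) e'(5) gens_carrier x by simp
  have cl: "inv x' \<otimes> x \<in> carrier G" using gens_carrier x by simp
  have "trg x = trg x'" using C_inj[OF cl e(2) e'(2) eq] .
  then have "inv x' \<otimes> x = \<one>" using free[OF cl e(5)] eq by simp
  then show ?thesis using gens_carrier x by (metis inv_closed inv_equality inv_inv)
qed

lemma C_side: "x \<in> gens \<Longrightarrow> y \<in> C \<Longrightarrow> y \<notin> side x"
  using gate_side[of x y] gate_self[OF C_convex, of y] by (auto simp: side_def)

text \<open>\<open>x\<close> carries the edge of \<open>inv x\<close> to the edge of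
  \<open>x\<close> with its ends exchanged, hence the complement of one half-tree into the other;
  ties in distance do not occur.\<close>

lemma act_side:
  assumes x: "x \<in> gens" and y: "y \<in> V" "y \<notin> side (inv x)"
  shows "\<phi> x y \<in> side x"
proof -
  note e = edge[OF x] and i = gens_inv[OF x] and c = gens_carrier[OF x]
  have "(trg x, \<phi> (inv x) (src x)) \<in> A" using edge(3)[OF i(1)] i by simp
  then have "dst (trg x) y \<noteq> dst (\<phi> (inv x) (src x)) y" using dst_adj_neq y by blast
  then have "dst y (trg x) < dst y (\<phi> (inv x) (src x))"
    using y i by (auto simp: side_def dst_sym)
  moreover have "dst (\<phi> x y) (\<phi> x (trg x)) = dst y (trg x)" using dst_act c y e by simp
  moreover have "dst (\<phi> x y) (src x) = dst y (\<phi> (inv x) (src x))"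
    using dst_act[of x y "\<phi> (inv x) (src x)"] act_act_inv act_in c y e by simp
  ultimately show ?thesis using act_in c y by (simp add: side_def)
qed

text \<open>\<open>SOME\<close> sees only the set \<open>{x, inv x}\<close>, which is the same for
  \<open>x\<close> and its inverse, so exactly one element of each pair is kept.\<close>

definition basis :: "'a set" where
  "basis = {x \<in> gens. (SOME y. y \<in> {x, inv x}) = x}"

lemma letter_gens: "fst p \<in> basis \<Longrightarrow> letter p \<in> gens"
  using gens_inv by (auto simp: letter_def basis_def)

lemma letter_inv: "fst p \<in> basis \<Longrightarrow> inv (letter p) = letter (fst p, \<not> snd p)"
  using letter_flip gens_carrier by (simp add: basis_def)

lemma letter_inj:
  assumes "fst p \<in> basis" "fst q \<in> basis" "letter p = letter q"
  shows "p = q"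
proof -
  have c: "fst p \<in> gens" "fst q \<in> gens" "(SOME y. y \<in> {fst p, inv (fst p)}) = fst p"
    "(SOME y. y \<in> {fst q, inv (fst q)}) = fst q"
    using assms by (auto simp: basis_def)
  have cl: "fst p \<in> carrier G" "fst q \<in> carrier G" using c gens_carrier by auto
  then have "fst p = fst q \<or> fst p = inv (fst q)"
    using assms(3) unfolding letter_def by (metis inv_inv)
  then have "{fst p, inv (fst p)} = {fst q, inv (fst q)}" using cl by auto
  then have f: "fst p = fst q" using c by metis
  then have "snd p = snd q"
    using assms(3) gens_inv_neq[OF c(2)] by (auto simp: letter_def split: if_splits)
  then show ?thesis using f by (simp add: prod_eq_iff)
qed

lemma letter_surj:
  assumes "x \<in> gens"
  obtains p where "fst p \<in> basis" "letter p = x"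
proof -
  define y where "y = (SOME y. y \<in> {x, inv x})"
  have y: "y \<in> {x, inv x}" unfolding y_def by (rule someI[of _ x]) simp
  have "{y, inv y} = {x, inv x}" using y assms gens_carrier by auto
  then have "(SOME z. z \<in> {y, inv y}) = y" by (simp only: y_def[symmetric])
  moreover have "y \<in> gens" using y assms gens_inv by auto
  ultimately have "y \<in> basis" unfolding basis_def by blast
  moreover have "letter (y, True) = x \<or> letter (y, False) = x"
    using y assms gens_carrier by (auto simp: letter_def)
  ultimately show ?thesis using that[of "(y, True)"] that[of "(y, False)"] by auto
qed

lemma letter_inv_iff:
  assumes "fst p \<in> basis" "fst q \<in> basis"
  shows "letter q = inv (letter p) \<longleftrightarrow> fst p = fst q \<and> snd p \<noteq> snd q"
proof -
  have "letter q = letter (fst p, \<not> snd p) \<longleftrightarrow> q = (fst p, \<not> snd p)"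
    using letter_inj[of q "(fst p, \<not> snd p)"] assms by auto
  then show ?thesis unfolding letter_inv[OF assms(1)] by (auto simp: prod_eq_iff)
qed

lemma reduced_Cons:
  "p # w \<in> reduced_words basis \<longleftrightarrow> fst p \<in> basis \<and> w \<in> reduced_words basis \<and>
     (w = [] \<or> letter (hd w) \<noteq> inv (letter p))"
  using letter_inv_iff[of p "hd w"] by (cases w) (auto simp: reduced_words_def)

lemma eval_word_closed: "w \<in> reduced_words basis \<Longrightarrow> eval_word G w \<in> carrier G"
  using gens_carrier by (intro eval_word_in_carrier) (auto simp: reduced_words_def basis_def)

text \<open>The next letter is not the inverse of the first, so by disjointness of sides the image
  under the tail avoids the half-tree of \<open>inv (letter p)\<close>, as \<open>act_side\<close>
  requires.\<close>

lemma ping_pong: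
  assumes "w \<in> reduced_words basis" "w \<noteq> []" "v \<in> C"
  shows "\<phi> (eval_word G w) v \<in> side (letter (hd w))"
  using assms(1,2)
proof (induction w)
  case (Cons p w)
  then have p: "fst p \<in> basis" "w \<in> reduced_words basis" "w = [] \<or> letter (hd w) \<noteq> inv (letter p)"
    by (auto simp: reduced_Cons)
  define y where "y = \<phi> (eval_word G w) v"
  have g: "letter p \<in> gens" "inv (letter p) \<in> gens" using letter_gens p gens_inv by auto
  have v: "v \<in> V" using C_sub assms(3) by simp
  have yV: "y \<in> V" using act_in eval_word_closed p v by (simp add: y_def)
  have "y \<notin> side (inv (letter p))"
  proof (cases "w = []")
    case True
    then have "y = v" using act_one v by (simp add: y_def eval_word_simps)
    then show ?thesis using C_side g assms(3) by simp
  next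
    case False
    then have "y \<in> side (letter (hd w))" using Cons.IH p by (simp add: y_def)
    moreover have "letter (hd w) \<in> gens"
      using False p(2) letter_gens by (cases w) (auto simp: reduced_Cons)
    ultimately show ?thesis using side_disjoint g p False by blast
  qed
  then have "\<phi> (letter p) y \<in> side (letter p)" using act_side g yV by simp
  then show ?case
    using act_mult[of "letter p" "eval_word G w" v] eval_word_closed p v gens_carrier g
    by (simp add: y_def eval_word_simps)
qed simp

text \<open>The half-tree that contains the image of a vertex of \<open>C\<close> reveals the first
  letter, which can then be cancelled; the empty word leaves the vertex in \<open>C\<close>, outside
  all half-trees.\<close>

lemma eval_word_inj: "inj_on (eval_word G) (reduced_words basis)"
proof (rule inj_onI)
  fix w w' assume "w \<in> reduced_words basis" "w' \<in> reduced_words basis" "eval_word G w = eval_word G w'"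
  then show "w = w'"
  proof (induction w arbitrary: w')
    case Nil
    obtain v where v: "v \<in> C" using C_nonempty by auto
    show ?case
    proof (rule ccontr)
      assume ne: "[] \<noteq> w'"
      then have "\<phi> \<one> v \<in> side (letter (hd w'))"
        using ping_pong[of w' v] Nil v by (simp add: eval_word_simps)
      moreover have "letter (hd w') \<in> gens"
        using ne Nil(2) letter_gens by (cases w') (auto simp: reduced_Cons)
      ultimately show False using C_side v act_one C_sub by auto
    qed
  next
    case (Cons p w)
    obtain v where v: "v \<in> C" using C_nonempty by auto
    have p: "fst p \<in> basis" "w \<in> reduced_words basis" using Cons.prems by (auto simp: reduced_Cons)
    have s: "\<phi> (eval_word G (p # w)) v \<in> side (letter p)" using ping_pong[OF Cons.prems(1) _ v] by simp
    have "w' \<noteq> []"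
      using s Cons.prems(3) C_side[OF letter_gens[OF p(1)] v] act_one C_sub v by (auto simp: eval_word_simps)
    then obtain q u where w': "w' = q # u" by (cases w') auto
    have q: "fst q \<in> basis" "u \<in> reduced_words basis" using Cons.prems w' by (auto simp: reduced_Cons)
    have "\<phi> (eval_word G (p # w)) v \<in> side (letter q)"
      using ping_pong[OF Cons.prems(2) _ v] Cons.prems(3) w' by simp
    then have "letter p = letter q" using side_disjoint s letter_gens p q by blast
    then have pq: "p = q" using letter_inj p q by simp
    have "eval_word G w = eval_word G u"
      using Cons.prems(3) pq w' eval_word_closed p q gens_carrier letter_gens
      by (simp add: eval_word_simps)
    then show ?case using Cons.IH p q pq w' by simp
  qed
qed

lemma gens_mult_word:
  assumes "x \<in> gens" "g \<in> eval_word G ` reduced_words basis"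
  shows "x \<otimes> g \<in> eval_word G ` reduced_words basis"
proof -
  obtain p where p: "fst p \<in> basis" "letter p = x" using letter_surj assms(1) by blast
  obtain w where w: "w \<in> reduced_words basis" "g = eval_word G w" using assms(2) by auto
  show ?thesis
  proof (cases "w = [] \<or> letter (hd w) \<noteq> inv x")
    case True
    then have "p # w \<in> reduced_words basis" using p w by (simp add: reduced_Cons)
    moreover have "x \<otimes> g = eval_word G (p # w)" using p w by (simp add: eval_word_simps)
    ultimately show ?thesis by blast
  next
    case False
    then obtain q u where u: "w = q # u" "letter q = inv x" by (cases w) auto
    have uR: "u \<in> reduced_words basis" using w u by (simp add: reduced_Cons)
    have "x \<otimes> g = eval_word G u"
      using w u eval_word_closed[OF uR] gens_carrier[OF assms(1)]
      by (simp add: eval_word_simps m_assoc[symmetric])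
    then show ?thesis using uR by blast
  qed
qed

text \<open>Walk from \<open>u\<close> to \<open>\<phi> g v\<close>. A step into another translate
  of \<open>C\<close> gives a generator that is split off from \<open>g\<close>; a step inside
  \<open>C\<close> only moves \<open>u\<close>, which is therefore arbitrary in the
  induction.\<close>

lemma eval_word_surj:
  assumes "g \<in> carrier G" "u \<in> C" "v \<in> C"
  shows "g \<in> eval_word G ` reduced_words basis"
  using assms
proof (induction "dst u (\<phi> g v)" arbitrary: u g rule: less_induct)
  case less
  note g = less.prems(1) and u = less.prems(2) and v = less.prems(3)
  have V: "u \<in> V" "v \<in> V" "\<phi> g v \<in> V" using C_sub act_in g u v by auto
  show ?case
  proof (cases "u = \<phi> g v")
    case True
    then have "g = \<one>" using act_notin_C[OF g _ v] u by auto
    then have "g = eval_word G []" "[] \<in> reduced_words basis"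
      by (auto simp: eval_word_simps reduced_words_def)
    then show ?thesis by blast
  next
    case False
    then obtain z where z: "(u, z) \<in> A" "Suc (dst z (\<phi> g v)) = dst u (\<phi> g v)" using closer_ex V by blast
    have zV: "z \<in> V" using A_sub z by auto
    obtain h c where h: "h \<in> carrier G" "c \<in> C" "z = \<phi> h c" using C_cover zV by blast
    have cV: "c \<in> V" using C_sub h by simp
    show ?thesis
    proof (cases "h = \<one>")
      case True
      then have "z \<in> C" using h act_one cV by simp
      then show ?thesis using less.hyps[of z g] z g v by simp
    next
      case False
      then have hg: "h \<in> gens" using h u z(1) unfolding gens_def by blast
      have "dst c (\<phi> (inv h \<otimes> g) v) = dst (\<phi> h c) (\<phi> h (\<phi> (inv h \<otimes> g) v))"
        using dst_act act_in h g cV V by simp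
      also have "\<phi> h (\<phi> (inv h \<otimes> g) v) = \<phi> g v"
        using act_mult[of h "inv h \<otimes> g" v] h g V by (simp add: m_assoc[symmetric])
      finally have "inv h \<otimes> g \<in> eval_word G ` reduced_words basis"
        using less.hyps[of c "inv h \<otimes> g"] z h g v by simp
      then have "h \<otimes> (inv h \<otimes> g) \<in> eval_word G ` reduced_words basis" using gens_mult_word hg by simp
      then show ?thesis using h g by (simp add: m_assoc[symmetric])
    qed
  qed
qed

lemma free_group: "free_group G"
proof -
  obtain c where c: "c \<in> C" using C_nonempty by auto
  have "bij_betw (eval_word G) (reduced_words basis) (carrier G)"
    using eval_word_inj eval_word_closed eval_word_surj[OF _ c c] by (auto simp: bij_betw_def)
  moreover have "basis \<subseteq> carrier G" using gens_carrier by (auto simp: basis_def)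
  ultimately show ?thesis using is_group by (auto simp: free_group_def)
qed

end

lemma (in free_tree_act) free_action_imp_free_group: "free_group G"
proof (rule transversal)
  fix C assume C: "convex C" "C \<noteq> {}"
    "\<And>g u v. g \<in> carrier G \<Longrightarrow> u \<in> C \<Longrightarrow> v \<in> C \<Longrightarrow> \<phi> g u = v \<Longrightarrow> u = v"
    "\<And>x. x \<in> V \<Longrightarrow> \<exists>g\<in>carrier G. \<exists>c\<in>C. x = \<phi> g c"
  interpret transversal_tree_act G V A \<phi> C using C by unfold_locales
  show "free_group G" by (rule free_group)
qed

section \<open>Elliptic elements and the modular character\<close>

context group
begin

definition conj :: "'a \<Rightarrow> 'a \<Rightarrow> 'a" where
  "conj g x = g \<otimes> x \<otimes> inv g"

lemma conj_closed [simp]: "g \<in> carrier G \<Longrightarrow> x \<in> carrier G \<Longrightarrow> conj g x \<in> carrier G"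
  by (simp add: conj_def)

lemma conj_one [simp]: "x \<in> carrier G \<Longrightarrow> conj \<one> x = x"
  by (simp add: conj_def)

lemma conj_mult:
  assumes "g \<in> carrier G" "x \<in> carrier G" "y \<in> carrier G"
  shows "conj g (x \<otimes> y) = conj g x \<otimes> conj g y"
proof -
  have "inv g \<otimes> (g \<otimes> (y \<otimes> inv g)) = y \<otimes> inv g" using assms by (simp add: m_assoc[symmetric])
  then show ?thesis using assms by (simp add: conj_def m_assoc)
qed

lemma conj_conj: "g \<in> carrier G \<Longrightarrow> h \<in> carrier G \<Longrightarrow> x \<in> carrier G \<Longrightarrow> conj g (conj h x) = conj (g \<otimes> h) x"
  by (simp add: conj_def m_assoc inv_mult_group)

lemma conj_pow:
  assumes "g \<in> carrier G" "x \<in> carrier G"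
  shows "conj g (x [^] (n::int)) = conj g x [^] n"
proof -
  have "conj g \<in> hom G G" using assms conj_mult by (auto simp: hom_def)
  then show ?thesis using hom_int_pow[of "conj g" G G x n] is_group assms by simp
qed

lemma conj_inv_conj: "g \<in> carrier G \<Longrightarrow> x \<in> carrier G \<Longrightarrow> conj (inv g) (conj g x) = x"
  by (simp add: conj_conj)

lemma conj_eq_iff_commute:
  assumes "g \<in> carrier G" "x \<in> carrier G" "y \<in> carrier G"
  shows "conj g x = y \<longleftrightarrow> g \<otimes> x = y \<otimes> g"
  using assms using inv_solve_right'[of y "g \<otimes> x" g] by (auto simp: conj_def)

lemma infinite_cyclic_subgroup_generator:
  assumes "infinite_cyclic_subgroup G H"
  obtains c where "c \<in> H" "c \<in> carrier G" "ord c = 0" "\<And>h. h \<in> H \<Longrightarrow> \<exists>n::int. h = c [^] n"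
proof -
  have H: "subgroup H G" and iso: "G\<lparr>carrier := H\<rparr> \<cong> integer_group"
    using assms by (auto simp: infinite_cyclic_subgroup_def)
  interpret H: group "G\<lparr>carrier := H\<rparr>" using H is_group by (rule subgroup.subgroup_is_group)
  obtain h where h: "h \<in> iso integer_group (G\<lparr>carrier := H\<rparr>)"
    using H.iso_sym[OF iso] by (auto simp: is_iso_def)
  define c where "c = h 1"
  have bij: "bij_betw h UNIV H" using h by (simp add: iso_def)
  have c: "c \<in> H" "c \<in> carrier G" using bij subgroup.subset[OF H] by (auto simp: c_def bij_betw_def)
  have hp: "h n = c [^] n" for n
  proof -
    have "h (1 [^]\<^bsub>integer_group\<^esub> n) = c [^]\<^bsub>G\<lparr>carrier := H\<rparr>\<^esub> n"
      unfolding c_def using h by (intro hom_int_pow) (auto simp: iso_def H.is_group)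
    then show ?thesis using int_pow_consistent[OF H c(1)] by simp
  qed
  have "int (ord c) = 0"
  proof -
    have "h (int (ord c)) = h 0" using hp int_pow_eq_id[OF c(2)] by simp
    then show ?thesis using bij unfolding bij_betw_def inj_on_def by blast
  qed
  moreover have "\<exists>n::int. x = c [^] n" if "x \<in> H" for x
    using bij that hp unfolding bij_betw_def by blast
  ultimately show ?thesis using that c by simp
qed

end

locale gbs = tree_act +
  assumes fin_gen: "finitely_generated G"
    and V_nonempty: "V \<noteq> {}"
    and no_inversion: "g \<in> carrier G \<Longrightarrow> (u, v) \<in> A \<Longrightarrow> \<not> (\<phi> g u = v \<and> \<phi> g v = u)"
    and vertex_stab: "x \<in> V \<Longrightarrow> infinite_cyclic_subgroup G (stabilizer G \<phi> x)"
    and edge_stab: "e \<in> A \<Longrightarrow> infinite_cyclic_subgroup G (edge_stabilizer G \<phi> e)"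
begin

abbreviation "St x \<equiv> stabilizer G \<phi> x"

lemma St_iff: "g \<in> St x \<longleftrightarrow> g \<in> carrier G \<and> \<phi> g x = x"
  by (auto simp: stabilizer_def)

lemma St_carrier: "g \<in> St x \<Longrightarrow> g \<in> carrier G"
  by (simp add: St_iff)

lemma St_subgroup: "x \<in> V \<Longrightarrow> subgroup (St x) G"
  using vertex_stab by (simp add: infinite_cyclic_subgroup_def)

lemma St_mult: "x \<in> V \<Longrightarrow> g \<in> St x \<Longrightarrow> h \<in> St x \<Longrightarrow> g \<otimes> h \<in> St x"
  using St_subgroup subgroup.m_closed by metis

lemma St_pow: "x \<in> V \<Longrightarrow> g \<in> St x \<Longrightarrow> g [^] (n::int) \<in> St x"
  using St_subgroup subgroup_int_pow_closed by metis

lemma St_gen: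
  assumes "x \<in> V"
  obtains c where "c \<in> St x" "ord c = 0" "\<And>h. h \<in> St x \<Longrightarrow> \<exists>n::int. h = c [^] n"
  using infinite_cyclic_subgroup_generator[OF vertex_stab[OF assms]] by metis

lemma St_commute:
  assumes "x \<in> V" "g \<in> St x" "h \<in> St x"
  shows "g \<otimes> h = h \<otimes> g"
proof -
  obtain c where c: "c \<in> St x" "\<And>h. h \<in> St x \<Longrightarrow> \<exists>n::int. h = c [^] n" using St_gen assms by metis
  obtain i j where "g = c [^] (i::int)" "h = c [^] (j::int)" using c assms by metis
  then show ?thesis using int_pow_mult[of c i j] int_pow_mult[of c j i] St_carrier[OF c(1)]
    by (simp add: add.commute)
qed

lemma St_torsion_free:
  assumes "x \<in> V" "g \<in> St x" "g \<noteq> \<one>"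
  shows "ord g = 0"
proof -
  obtain c where c: "c \<in> St x" "ord c = 0" "\<And>h. h \<in> St x \<Longrightarrow> \<exists>n::int. h = c [^] n" using St_gen assms by metis
  obtain i where i: "g = c [^] (i::int)" using c assms by metis
  have cc: "c \<in> carrier G" using St_carrier c by simp
  have "g [^] int (ord g) = \<one>" using int_pow_eq_id[of g "int (ord g)"] St_carrier assms by simp
  then have "i * int (ord g) = 0" using i int_pow_eq_id[OF cc] c int_pow_pow[OF cc] by simp
  then show ?thesis using i assms by auto
qed

section \<open>Commensurability of stabilizers\<close>

lemma commensurable_adj:
  assumes "(u, v) \<in> A"
  obtains k :: int where "k \<noteq> 0" "\<And>c. c \<in> St u \<Longrightarrow> c [^] k \<in> St v"
proof -
  have V: "u \<in> V" "v \<in> V" using A_sub assms by auto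
  obtain e where e: "e \<in> edge_stabilizer G \<phi> (u, v)" "e \<in> carrier G" "ord e = 0"
    using infinite_cyclic_subgroup_generator[OF edge_stab[OF assms]] by metis
  have eu: "e \<in> St u" "e \<in> St v" using e by (auto simp: edge_stabilizer_def St_iff)
  obtain c where c: "c \<in> St u" "\<And>h. h \<in> St u \<Longrightarrow> \<exists>n::int. h = c [^] n" using St_gen V by metis
  obtain k where k: "e = c [^] (k::int)" using c eu by metis
  have "k \<noteq> 0" using k e by (auto simp: ord_id)
  moreover have "d [^] k \<in> St v" if d: "d \<in> St u" for d
  proof -
    obtain n where n: "d = c [^] (n::int)" using c d by metis
    have "d [^] k = e [^] n" using n k int_pow_pow St_carrier[OF c(1)] by (simp add: mult.commute)
    then show ?thesis using St_pow eu V by simp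
  qed
  ultimately show ?thesis using that by metis
qed

lemma commensurable:
  assumes "u \<in> V" "v \<in> V"
  obtains k :: int where "k \<noteq> 0" "\<And>c. c \<in> St u \<Longrightarrow> c [^] k \<in> St v"
proof -
  have "\<exists>k::int. k \<noteq> 0 \<and> (\<forall>c\<in>St u. c [^] k \<in> St v)" if "(u, v) \<in> A ^^ n" for n
    using that
  proof (induction n arbitrary: v)
    case 0
    then have "u = v" by simp
    then show ?case using St_carrier by (intro exI[of _ 1]) auto
  next
    case (Suc n)
    then obtain w where w: "(u, w) \<in> A ^^ n" "(w, v) \<in> A" by auto
    obtain k where k: "k \<noteq> (0::int)" "\<And>c. c \<in> St u \<Longrightarrow> c [^] k \<in> St w" using Suc.IH[OF w(1)] by blast
    obtain l where l: "l \<noteq> (0::int)" "\<And>c. c \<in> St w \<Longrightarrow> c [^] l \<in> St v" using commensurable_adj[OF w(2)] by blast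
    have "c [^] (k * l) \<in> St v" if "c \<in> St u" for c
      using l(2)[OF k(2)[OF that]] int_pow_pow St_carrier[OF that] by simp
    then show ?case using k l by (intro exI[of _ "k * l"]) auto
  qed
  then show ?thesis using dst_relpow[OF assms] that by blast
qed

definition "v0 = (SOME x. x \<in> V)"

lemma v0: "v0 \<in> V"
  unfolding v0_def using V_nonempty by (simp add: some_in_eq)

definition "a = (SOME c. c \<in> St v0 \<and> ord c = 0 \<and> (\<forall>h\<in>St v0. \<exists>n::int. h = c [^] n))"

lemma a: "a \<in> St v0" "a \<in> carrier G" "ord a = 0" "h \<in> St v0 \<Longrightarrow> \<exists>n::int. h = a [^] n"
proof -
  have "\<exists>c. c \<in> St v0 \<and> ord c = 0 \<and> (\<forall>h\<in>St v0. \<exists>n::int. h = c [^] n)"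
    using St_gen[OF v0] by metis
  from someI_ex[OF this] have "a \<in> St v0 \<and> ord a = 0 \<and> (\<forall>h\<in>St v0. \<exists>n::int. h = a [^] n)"
    unfolding a_def .
  then show "a \<in> St v0" "a \<in> carrier G" "ord a = 0" "h \<in> St v0 \<Longrightarrow> \<exists>n::int. h = a [^] n"
    using St_carrier by auto
qed

lemma a_pow_eq: "a [^] (i::int) = a [^] (j::int) \<longleftrightarrow> i = j"
  using int_pow_eq[OF a(2), of j i] a(3) by auto

definition elliptic :: "'a \<Rightarrow> bool" where
  "elliptic e \<longleftrightarrow> e \<in> carrier G \<and> Fix e \<noteq> {}"

lemma ellipticI: "x \<in> V \<Longrightarrow> e \<in> St x \<Longrightarrow> elliptic e"
  by (auto simp: elliptic_def Fix_def St_iff)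

lemma ellipticE:
  assumes "elliptic e"
  obtains x where "x \<in> V" "e \<in> St x"
  using assms by (auto simp: elliptic_def Fix_def St_iff)

lemma elliptic_carrier: "elliptic e \<Longrightarrow> e \<in> carrier G"
  by (simp add: elliptic_def)

text \<open>All elliptic elements are commensurable with \<open>a\<close>; \<open>lam e\<close> is \<open>e\<close> measured in units of \<open>a\<close>.\<close>

definition lam :: "'a \<Rightarrow> rat" where
  "lam e = (THE q. \<exists>k m::int. k \<noteq> 0 \<and> e [^] k = a [^] m \<and> q = of_int m / of_int k)"

lemma lam_unique:
  assumes "e \<in> carrier G" "k \<noteq> 0" "e [^] k = a [^] m" "k' \<noteq> 0" "e [^] k' = a [^] m'"
  shows "of_int m / of_int k = (of_int m' / of_int k' :: rat)"
proof -
  have "a [^] (m * k') = (e [^] k) [^] k'" using assms a(2) by (simp add: int_pow_pow)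
  also have "\<dots> = (e [^] k') [^] k" using assms(1) by (simp add: int_pow_pow mult.commute)
  also have "\<dots> = a [^] (m' * k)" using assms a(2) by (simp add: int_pow_pow)
  finally have "m * k' = m' * k" by (simp add: a_pow_eq)
  then have "(of_int m * of_int k' :: rat) = of_int m' * of_int k" by (metis of_int_mult)
  then show ?thesis using assms by (simp add: frac_eq_eq)
qed

lemma lam_eqI:
  assumes "e \<in> carrier G" "k \<noteq> 0" "e [^] k = a [^] (m::int)"
  shows "lam e = of_int m / of_int k"
  unfolding lam_def
proof (rule the_equality)
  show "\<exists>k' m'::int. k' \<noteq> 0 \<and> e [^] k' = a [^] m' \<and> of_int m / of_int k = (of_int m' / of_int k' :: rat)"
    using assms by blast
qed (use lam_unique assms in blast)

lemma lamE:
  assumes "elliptic e"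
  obtains k m :: int where "k \<noteq> 0" "e [^] k = a [^] m" "lam e = of_int m / of_int k"
proof -
  obtain x where x: "x \<in> V" "e \<in> St x" using assms by (rule ellipticE)
  obtain k where k: "k \<noteq> (0::int)" "e [^] k \<in> St v0" using commensurable[OF x(1) v0] x(2) by metis
  then obtain m where "e [^] k = a [^] (m::int)" using a(4) by blast
  then show ?thesis using that k lam_eqI elliptic_carrier[OF assms] by metis
qed

lemma lam_a [simp]: "lam a = 1"
  using lam_eqI[of a 1 1] a by simp

lemma lam_pow:
  assumes "elliptic e"
  shows "lam (e [^] (n::int)) = of_int n * lam e"
proof -
  obtain k m :: int where km: "k \<noteq> 0" "e [^] k = a [^] m" "lam e = of_int m / of_int k" using lamE assms by metis
  have "(e [^] n) [^] k = (e [^] k) [^] n"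
    using elliptic_carrier[OF assms] by (simp add: int_pow_pow mult.commute)
  also have "\<dots> = a [^] (m * n)" using km a(2) by (simp add: int_pow_pow)
  finally show ?thesis using lam_eqI[of "e [^] n" k "m * n"] km elliptic_carrier[OF assms] by simp
qed

lemma lam_mult:
  assumes "x \<in> V" "e \<in> St x" "f \<in> St x"
  shows "lam (e \<otimes> f) = lam e + lam f"
proof -
  have c: "e \<in> carrier G" "f \<in> carrier G" using St_carrier assms by auto
  obtain k m :: int where km: "k \<noteq> 0" "e [^] k = a [^] m" "lam e = of_int m / of_int k"
    using lamE ellipticI assms by metis
  obtain l n :: int where ln: "l \<noteq> 0" "f [^] l = a [^] n" "lam f = of_int n / of_int l"
    using lamE ellipticI assms by metis
  have "(e \<otimes> f) [^] (k * l) = (e [^] k) [^] l \<otimes> (f [^] l) [^] k"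
    using int_pow_mult_distrib[OF St_commute[OF assms] c] c by (simp add: int_pow_pow mult.commute)
  also have "\<dots> = a [^] (m * l + n * k)" using km ln a(2) by (simp add: int_pow_pow int_pow_mult)
  finally show ?thesis
    using lam_eqI[of "e \<otimes> f" "k * l" "m * l + n * k"] km ln c by (simp add: add_frac_eq)
qed

lemma lam_zero: 
  assumes "elliptic e" "lam e = 0"
  shows "e = \<one>"
proof (rule ccontr)
  assume "e \<noteq> \<one>"
  then have o: "ord e = 0" using ellipticE[OF assms(1)] St_torsion_free by metis
  obtain k m :: int where km: "k \<noteq> 0" "e [^] k = a [^] m" "lam e = of_int m / of_int k" using lamE assms by metis
  then have "e [^] k = \<one>" using assms by simp
  then show False using int_pow_eq_id[OF elliptic_carrier[OF assms(1)]] o km by simp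
qed

lemma lam_inj:
  assumes "x \<in> V" "e \<in> St x" "f \<in> St x" "lam e = lam f"
  shows "e = f"
proof -
  have c: "e \<in> carrier G" "f \<in> carrier G" using St_carrier assms by auto
  have fi: "f [^] (-1::int) \<in> St x" using St_pow assms by simp
  have "lam (e \<otimes> f [^] (-1::int)) = 0"
    using lam_mult[OF assms(1,2) fi] lam_pow[OF ellipticI[OF assms(1,3)], of "-1"] assms(4) by simp
  then have "e \<otimes> f [^] (-1::int) = \<one>" using lam_zero ellipticI St_mult assms fi by metis
  then show ?thesis using c int_pow_neg[of f 1] by (simp add: inv_solve_right')
qed

section \<open>The modular character\<close>

lemma conj_St: "g \<in> carrier G \<Longrightarrow> x \<in> V \<Longrightarrow> e \<in> St x \<Longrightarrow> conj g e \<in> St (\<phi> g x)"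
  by (auto simp: St_iff conj_def act_mult act_in act_inv_act)

lemma conj_elliptic: "g \<in> carrier G \<Longrightarrow> elliptic e \<Longrightarrow> elliptic (conj g e)"
  using ellipticE conj_St ellipticI act_in by metis

text \<open>Normalised by \<open>lam a = 1\<close> so that conjugation multiplies \<open>lam\<close>
  by it; hence it is the reciprocal of \<open>modular_hom\<close>.\<close>

definition Del :: "'a \<Rightarrow> rat" where
  "Del g = lam (conj g a)"

lemma elliptic_a: "elliptic a"
  using ellipticI v0 a by blast

lemma lam_conj:
  assumes "g \<in> carrier G" "elliptic e"
  shows "lam (conj g e) = Del g * lam e"
proof -
  have c: "e \<in> carrier G" using elliptic_carrier assms by blast
  obtain k m :: int where km: "k \<noteq> 0" "e [^] k = a [^] m" "lam e = of_int m / of_int k" using lamE assms by metis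
  obtain l n :: int where ln: "l \<noteq> 0" "conj g a [^] l = a [^] n" "Del g = of_int n / of_int l"
    using lamE[OF conj_elliptic[OF assms(1) elliptic_a]] unfolding Del_def by metis
  have "conj g e [^] (k * l) = conj g (e [^] k) [^] l"
    using conj_pow assms c by (simp add: int_pow_pow)
  also have "\<dots> = (conj g a [^] l) [^] m"
    using km conj_pow assms a(2) by (simp add: int_pow_pow mult.commute)
  also have "\<dots> = a [^] (n * m)" using ln a(2) by (simp add: int_pow_pow)
  finally show ?thesis using lam_eqI[of "conj g e" "k * l" "n * m"] km ln assms c by (simp add: mult.commute)
qed

lemma Del_mult: "g \<in> carrier G \<Longrightarrow> h \<in> carrier G \<Longrightarrow> Del (g \<otimes> h) = Del g * Del h"
  using lam_conj[of g "conj h a"] conj_elliptic elliptic_a conj_conj a(2) unfolding Del_def by metis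

lemma Del_one [simp]: "Del \<one> = 1"
  using a(2) by (simp add: Del_def)

lemma Del_nonzero: "g \<in> carrier G \<Longrightarrow> Del g \<noteq> 0"
  using Del_mult[of g "inv g"] by auto

lemma Del_inv: "g \<in> carrier G \<Longrightarrow> Del (inv g) = 1 / Del g"
  using Del_mult[of g "inv g"] Del_nonzero[of g] by (simp add: field_simps)

text \<open>\<open>e\<close> commutes with itself, so \<open>lam e = Del e * lam e\<close>, and
  \<open>lam e\<close> vanishes only for the identity.\<close>

lemma Del_elliptic:
  assumes "elliptic e"
  shows "Del e = 1"
proof (cases "e = \<one>")
  case False
  have c: "e \<in> carrier G" using elliptic_carrier assms by blast
  then have "conj e e = e" by (simp add: conj_eq_iff_commute)
  then have "lam e = Del e * lam e" using lam_conj[OF c assms] by simp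
  then show ?thesis using lam_zero assms False by auto
qed simp

lemma Del_relation:
  assumes "g \<in> carrier G" "elliptic e" "e \<noteq> \<one>" "m \<noteq> 0" "n \<noteq> 0" "conj g (e [^] (m::int)) = e [^] (n::int)"
  shows "Del g = of_int n / of_int m"
proof -
  have "elliptic (e [^] m)" using assms(2) ellipticE ellipticI St_pow by metis
  then have "lam (e [^] n) = Del g * lam (e [^] m)"
    using lam_conj[OF assms(1), of "e [^] m"] assms(6) by simp
  then have "Del g * (of_int m * lam e) = of_int n * lam e"
    using lam_pow[OF assms(2)] by metis
  moreover have "lam e \<noteq> 0" using lam_zero assms by blast
  ultimately have "Del g * of_int m = of_int n" by (metis mult.assoc mult_cancel_right)
  then show ?thesis using assms by (simp add: eq_divide_eq)
qed

lemma modular_relation: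
  assumes "g \<in> carrier G"
  obtains m n :: int where "m \<noteq> 0" "n \<noteq> 0" "conj g (a [^] m) = a [^] n"
proof -
  obtain m n :: int where mn: "m \<noteq> 0" "conj g a [^] m = a [^] n" "Del g = of_int n / of_int m"
    using lamE[OF conj_elliptic[OF assms elliptic_a]] unfolding Del_def by metis
  then have "n \<noteq> 0" using Del_nonzero assms by auto
  then show ?thesis using that mn conj_pow assms a(2) by simp
qed

lemma a_neq_one: "a \<noteq> \<one>"
  using a(3) ord_id by auto

end

section \<open>The affine representation\<close>

context gbs
begin

section \<open>Orbit representatives and the cocycle at vertices\<close>

definition orb :: "'c \<Rightarrow> 'c set" where
  "orb x = {\<phi> g x |g. g \<in> carrier G}"

lemma orb_act:
  assumes "g \<in> carrier G" "x \<in> V"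
  shows "orb (\<phi> g x) = orb x"
proof -
  have "orb (\<phi> h y) \<subseteq> orb y" if "h \<in> carrier G" "y \<in> V" for h y
    using that act_mult by (auto simp: orb_def) (metis m_closed)
  from this[OF assms] this[of "inv g" "\<phi> g x"] show ?thesis
    using assms act_in act_inv_act by auto
qed

text \<open>The choice depends on \<open>x\<close> only through the set \<open>orb x\<close>, which
  makes \<open>rep\<close> constant on orbits.\<close>

definition rep :: "'c \<Rightarrow> 'c" where "rep x = (SOME y. y \<in> orb x)"
definition tv :: "'c \<Rightarrow> 'a" where "tv x = (SOME t. t \<in> carrier G \<and> \<phi> t (rep x) = x)"

lemma rep_tv:
  assumes "x \<in> V"
  shows "rep x \<in> V" "tv x \<in> carrier G" "\<phi> (tv x) (rep x) = x"
proof -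
  have "x \<in> orb x" using assms act_one by (auto simp: orb_def intro!: exI[of _ \<one>])
  then have "rep x \<in> orb x" unfolding rep_def by (rule someI)
  then obtain g where g: "g \<in> carrier G" "rep x = \<phi> g x" by (auto simp: orb_def)
  then show "rep x \<in> V" using act_in assms by simp
  have "\<exists>t. t \<in> carrier G \<and> \<phi> t (rep x) = x" using g act_inv_act assms by (intro exI[of _ "inv g"]) simp
  from someI_ex[OF this] show "tv x \<in> carrier G" "\<phi> (tv x) (rep x) = x" by (auto simp: tv_def)
qed

lemma rep_act: "g \<in> carrier G \<Longrightarrow> x \<in> V \<Longrightarrow> rep (\<phi> g x) = rep x"
  by (simp add: rep_def orb_act)

text \<open>The choice of \<open>tv\<close> extends \<open>lam\<close> to a cocycle \<open>coc\<close>. On each edge the difference of its values at the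
  two ends is the equivariant coboundary of \<open>tau\<close>, and \<open>tau\<close> integrates to \<open>pot\<close> along the tree, so
  correcting \<open>coc\<close> by \<open>pot\<close> removes the dependence on the vertex (\<open>trans_eq\<close>).\<close>

definition coc :: "'a \<Rightarrow> 'c \<Rightarrow> rat" where
  "coc g x = lam (g \<otimes> tv x \<otimes> inv (tv (\<phi> g x)))"

lemma coc_St:
  assumes "g \<in> carrier G" "x \<in> V"
  shows "g \<otimes> tv x \<otimes> inv (tv (\<phi> g x)) \<in> St (\<phi> g x)"
proof -
  define y where "y = \<phi> g x"
  have y: "y \<in> V" "rep y = rep x" using act_in assms rep_act by (auto simp: y_def)
  note x = rep_tv[OF assms(2)] and y' = rep_tv[OF y(1)]
  have "\<phi> (inv (tv y)) y = rep x" using act_inv_act[OF y'(2) y'(1)] y' y by simp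
  then have "\<phi> (g \<otimes> tv x \<otimes> inv (tv y)) y = y"
    using act_mult[of "g \<otimes> tv x" "inv (tv y)" y] act_mult[of g "tv x" "rep x"] assms x y y'
    by (simp add: y_def[symmetric])
  then show ?thesis using assms x y' by (simp add: St_iff y_def)
qed

text \<open>The stabilizer element that defines the left side is
  \<open>conj g p \<otimes> q\<close>, with \<open>p\<close> and \<open>q\<close> those of
  \<open>h\<close> and \<open>g\<close>. Both factors fix \<open>\<phi> g (\<phi> h x)\<close>, and
  \<open>lam\<close> is additive on one stabilizer.\<close>

lemma coc_mult:
  assumes "g \<in> carrier G" "h \<in> carrier G" "x \<in> V"
  shows "coc (g \<otimes> h) x = coc g (\<phi> h x) + Del g * coc h x"
proof -
  define y where "y = \<phi> h x"
  have yV: "y \<in> V" using act_in assms by (simp add: y_def)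
  have gy: "\<phi> (g \<otimes> h) x = \<phi> g y" "\<phi> g y \<in> V" using act_mult act_in assms by (auto simp: y_def)
  note x = rep_tv(2)[OF assms(3)] and y = rep_tv(2)[OF yV] and z = rep_tv(2)[OF gy(2)]
  define p where "p = h \<otimes> tv x \<otimes> inv (tv y)"
  define q where "q = g \<otimes> tv y \<otimes> inv (tv (\<phi> g y))"
  have p: "p \<in> St y" "p \<in> carrier G" and q: "q \<in> St (\<phi> g y)" "q \<in> carrier G"
    using coc_St[OF assms(2,3)] coc_St[OF assms(1) yV] St_carrier by (auto simp: p_def q_def y_def)
  have "inv (tv y) \<otimes> (inv g \<otimes> (g \<otimes> (tv y \<otimes> inv (tv (\<phi> g y))))) = inv (tv (\<phi> g y))"
    using assms y z inv_solve_left' by (simp add: m_assoc[symmetric])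
  then have "g \<otimes> h \<otimes> tv x \<otimes> inv (tv (\<phi> g y)) = conj g p \<otimes> q"
    using assms x y z by (simp add: p_def q_def conj_def m_assoc)
  then have "coc (g \<otimes> h) x = lam (conj g p \<otimes> q)" by (simp add: coc_def gy)
  also have "\<dots> = lam (conj g p) + lam q"
    using lam_mult[OF gy(2)] conj_St assms yV p q by simp
  also have "lam (conj g p) = Del g * lam p" using lam_conj ellipticI assms yV p by blast
  finally show ?thesis by (simp add: coc_def p_def q_def y_def)
qed

lemma coc_fixed:
  assumes "x \<in> V" "g \<in> St x"
  shows "coc g x = lam g"
proof -
  have "g \<in> carrier G" "\<phi> g x = x" using assms by (auto simp: St_iff)
  then show ?thesis using rep_tv(2)[OF assms(1)] by (simp add: coc_def m_assoc)
qed

section \<open>The cochain on edges\<close>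

definition orbE :: "'c \<times> 'c \<Rightarrow> ('c \<times> 'c) set" where
  "orbE e = {(\<phi> g (fst e), \<phi> g (snd e)) |g. g \<in> carrier G}"

lemma orbE_act:
  assumes "g \<in> carrier G" "u \<in> V" "v \<in> V"
  shows "orbE (\<phi> g u, \<phi> g v) = orbE (u, v)"
proof -
  have "orbE (\<phi> h y, \<phi> h z) \<subseteq> orbE (y, z)" if "h \<in> carrier G" "y \<in> V" "z \<in> V" for h y z
    using that act_mult by (auto simp: orbE_def) (metis m_closed)
  from this[OF assms] this[of "inv g" "\<phi> g u" "\<phi> g v"] show ?thesis
    using assms act_in act_inv_act by auto
qed

definition repE :: "'c \<times> 'c \<Rightarrow> 'c \<times> 'c" where "repE e = (SOME e'. e' \<in> orbE e)"
definition te :: "'c \<times> 'c \<Rightarrow> 'a" where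
  "te e = (SOME t. t \<in> carrier G \<and> (\<phi> t (fst (repE e)), \<phi> t (snd (repE e))) = e)"

lemma repE_te:
  assumes "e \<in> A"
  shows "repE e \<in> A" "te e \<in> carrier G" "(\<phi> (te e) (fst (repE e)), \<phi> (te e) (snd (repE e))) = e"
proof -
  obtain u v where e: "e = (u, v)" "u \<in> V" "v \<in> V" using assms A_sub by (cases e) auto
  have "e \<in> orbE e" using act_one e by (auto simp: orbE_def intro!: exI[of _ \<one>])
  then have "repE e \<in> orbE e" unfolding repE_def by (rule someI)
  then obtain g where g: "g \<in> carrier G" "repE e = (\<phi> g u, \<phi> g v)" using e by (auto simp: orbE_def)
  then show "repE e \<in> A" using act_adj assms e by simp
  have "\<exists>t. t \<in> carrier G \<and> (\<phi> t (fst (repE e)), \<phi> t (snd (repE e))) = e"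
    using g act_inv_act e by (intro exI[of _ "inv g"]) simp
  from someI_ex[OF this]
  show "te e \<in> carrier G" "(\<phi> (te e) (fst (repE e)), \<phi> (te e) (snd (repE e))) = e"
    unfolding te_def by blast+
qed

text \<open>The solution of the equivariance law \<open>sig_act\<close> that vanishes on the chosen
  representative edges.\<close>

definition sig :: "'c \<times> 'c \<Rightarrow> rat" where
  "sig e = coc (te e) (fst (repE e)) - coc (te e) (snd (repE e))"

lemma sig_act:
  assumes "g \<in> carrier G" "(u, v) \<in> A"
  shows "sig (\<phi> g u, \<phi> g v) = Del g * sig (u, v) + coc g u - coc g v"
proof -
  define e where "e = (u, v)"
  define e' where "e' = (\<phi> g u, \<phi> g v)"
  have V: "u \<in> V" "v \<in> V" using assms A_sub by auto
  have e: "e \<in> A" and e': "e' \<in> A" using assms act_adj by (auto simp: e_def e'_def)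
  obtain r s where rs: "repE e = (r, s)" by (cases "repE e")
  have "repE e' = repE e" using orbE_act assms V by (simp add: e_def e'_def repE_def)
  then have rs': "repE e' = (r, s)" using rs by simp
  have rsA: "(r, s) \<in> A" "r \<in> V" "s \<in> V" using repE_te(1)[OF e] rs A_sub by auto
  define t where "t = te e"
  define t' where "t' = te e'"
  have t: "t \<in> carrier G" "\<phi> t r = u" "\<phi> t s = v" using repE_te[OF e] rs by (auto simp: t_def e_def)
  have t': "t' \<in> carrier G" "\<phi> t' r = \<phi> g u" "\<phi> t' s = \<phi> g v"
    using repE_te[OF e'] rs' by (auto simp: t'_def e'_def)
  \<comment> \<open>\<open>h\<close> measures the difference between \<open>g \<otimes> te e\<close>
    and \<open>te e'\<close>. It fixes both ends of the representative edge, so it contributes the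
    same multiple of \<open>lam h\<close> at either end, and this cancels in
    \<open>sig\<close>.\<close>
  define h where "h = inv (g \<otimes> t) \<otimes> t'"
  have hc: "h \<in> carrier G" using t t' assms by (simp add: h_def)
  have ght: "g \<otimes> t \<otimes> h = t'" using t t' assms by (simp add: h_def m_assoc[symmetric])
  have "\<phi> h r = r" "\<phi> h s = s"
    using act_mult[of "inv (g \<otimes> t)" t' r] act_mult[of "inv (g \<otimes> t)" t' s]
      act_mult[of g t r] act_mult[of g t s] act_inv_act[of "g \<otimes> t" r] act_inv_act[of "g \<otimes> t" s]
      rsA t t' assms by (simp_all add: h_def)
  then have hr: "h \<in> St r" "h \<in> St s" using hc by (auto simp: St_iff)
  have *: "coc t' x = coc g (\<phi> t x) + Del g * coc t x + Del (g \<otimes> t) * lam h"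
    if x: "x \<in> V" "h \<in> St x" for x
  proof -
    have "coc t' x = coc (g \<otimes> t) (\<phi> h x) + Del (g \<otimes> t) * coc h x"
      using coc_mult[of "g \<otimes> t" h x] ght hc t assms x by simp
    also have "\<phi> h x = x" using x by (simp add: St_iff)
    finally show ?thesis using coc_mult[of g t x] coc_fixed x t assms by simp
  qed
  have "sig e' = coc t' r - coc t' s" by (simp add: sig_def rs' t'_def)
  also have "\<dots> = coc g u - coc g v + Del g * (coc t r - coc t s)"
    using *[OF rsA(2) hr(1)] *[OF rsA(3) hr(2)] t by (simp add: algebra_simps)
  also have "coc t r - coc t s = sig e" by (simp add: sig_def rs t_def)
  finally show ?thesis by (simp add: e_def e'_def)
qed

text \<open>An edge and its reverse have unrelated representatives, so \<open>sig\<close> need not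
  be antisymmetric, as the increments of a potential must be. Antisymmetrising keeps the
  equivariance law, whose inhomogeneous part is already antisymmetric.\<close>

definition tau :: "'c \<Rightarrow> 'c \<Rightarrow> rat" where
  "tau u v = (sig (u, v) - sig (v, u)) / 2"

lemma tau_anti: "tau v u = - tau u v"
  by (simp add: tau_def field_simps)

lemma tau_act:
  assumes "g \<in> carrier G" "(u, v) \<in> A"
  shows "tau (\<phi> g u) (\<phi> g v) = Del g * tau u v + coc g u - coc g v"
  unfolding tau_def sig_act[OF assms] sig_act[OF assms(1) A_sym[OF assms(2)]] by (simp add: field_simps)

section \<open>The potential and the crossed homomorphism\<close>

definition pot :: "'c \<Rightarrow> rat" where
  "pot x = (\<Sum>i<dst x v0. tau ((nxt v0 ^^ Suc i) x) ((nxt v0 ^^ i) x))"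

lemma pot_nxt:
  assumes "x \<in> V" "x \<noteq> v0"
  shows "pot x = pot (nxt v0 x) + tau (nxt v0 x) x"
proof -
  have "dst x v0 = Suc (dst (nxt v0 x) v0)" using nxt[OF assms(1) v0 assms(2)] by simp
  then show ?thesis
    unfolding pot_def by (simp add: sum.lessThan_Suc_shift funpow_swap1 del: sum.lessThan_Suc)
qed

text \<open>Simple connectivity enters here: the ends of an edge lie at consecutive distances from
  \<open>v0\<close>, and the lower one is the \<open>nxt\<close> of the upper one, so each edge is
  seen by the sum that defines \<open>pot\<close>.\<close>

lemma pot_adj:
  assumes "(u, v) \<in> A"
  shows "pot v = pot u + tau u v"
proof -
  have step: "pot y = pot x + tau x y" if xy: "(x, y) \<in> A" "dst y v0 = Suc (dst x v0)" for x y
  proof -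
    have y: "y \<in> V" "y \<noteq> v0" using xy A_sub by auto
    have "nxt v0 y = x"
      using closer_unique[OF v0 nxt(1)[OF y(1) v0 y(2)] A_sym[OF xy(1)]] nxt(2)[OF y(1) v0 y(2)] xy(2) by simp
    then show ?thesis using pot_nxt[OF y] by simp
  qed
  from dst_adj_cases[OF v0 assms] show ?thesis
    using step[OF assms] step[OF A_sym[OF assms]] tau_anti[of u v] by auto
qed

definition trans :: "'a \<Rightarrow> rat" where
  "trans g = coc g v0 + pot (\<phi> g v0) - Del g * pot v0"

lemma trans_eq:
  assumes "g \<in> carrier G" "x \<in> V"
  shows "trans g = coc g x + pot (\<phi> g x) - Del g * pot x"
proof -
  have "trans g = coc g y + pot (\<phi> g y) - Del g * pot y" if "(v0, y) \<in> A ^^ n" for n y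
    using that
  proof (induction n arbitrary: y)
    case (Suc n)
    then obtain z where z: "(v0, z) \<in> A ^^ n" "(z, y) \<in> A" by auto
    have "pot (\<phi> g y) = pot (\<phi> g z) + tau (\<phi> g z) (\<phi> g y)" using pot_adj act_adj assms(1) z(2) by simp
    then show ?case
      using Suc.IH[OF z(1)] pot_adj[OF z(2)] tau_act[OF assms(1) z(2)] by (simp add: algebra_simps)
  qed (simp add: trans_def)
  then show ?thesis using dst_relpow[OF v0 assms(2)] by blast
qed

text \<open>\<open>trans g\<close> may be evaluated at any vertex; at \<open>\<phi> h v0\<close> the
  intermediate potentials cancel and \<open>coc_mult\<close> remains.\<close>

lemma trans_mult:
  assumes "g \<in> carrier G" "h \<in> carrier G"
  shows "trans (g \<otimes> h) = trans g + Del g * trans h"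
proof -
  have "trans g = coc g (\<phi> h v0) + pot (\<phi> g (\<phi> h v0)) - Del g * pot (\<phi> h v0)"
    using trans_eq[OF assms(1) act_in[OF assms(2) v0]] .
  moreover have "trans (g \<otimes> h) = coc g (\<phi> h v0) + Del g * coc h v0 + pot (\<phi> g (\<phi> h v0))
      - Del g * Del h * pot v0"
    using trans_eq[of "g \<otimes> h" v0] coc_mult act_mult Del_mult v0 assms by simp
  moreover have "Del g * trans h = Del g * coc h v0 + Del g * pot (\<phi> h v0) - Del g * Del h * pot v0"
    unfolding trans_eq[OF assms(2) v0] by (simp add: algebra_simps)
  ultimately show ?thesis by simp
qed

lemma trans_elliptic:
  assumes "elliptic e"
  shows "trans e = lam e"
proof -
  obtain x where x: "x \<in> V" "e \<in> St x" using assms by (rule ellipticE)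
  then show ?thesis
    using trans_eq[of e x] coc_fixed Del_elliptic[OF assms] by (simp add: St_iff)
qed

lemma trans_one [simp]: "trans \<one> = 0"
  using trans_mult[of \<one> \<one>] by simp

lemma trans_inv: "g \<in> carrier G \<Longrightarrow> trans (inv g) = - trans g / Del g"
  using trans_mult[of g "inv g"] Del_nonzero[of g] by (simp add: field_simps)

text \<open>The kernel of the action \<open>g \<mapsto> (x \<mapsto> Del g * x + trans g)\<close> on the affine line.\<close>

definition Ker :: "'a set" where
  "Ker = {g \<in> carrier G. Del g = 1 \<and> trans g = 0}"

lemma Ker_carrier: "k \<in> Ker \<Longrightarrow> k \<in> carrier G"
  by (simp add: Ker_def)

lemma Ker_free:
  assumes "k \<in> Ker" "x \<in> V" "\<phi> k x = x"
  shows "k = \<one>"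
proof -
  have "k \<in> St x" using assms by (simp add: St_iff Ker_def)
  then have "elliptic k" using assms ellipticI by blast
  then show ?thesis using trans_elliptic lam_zero assms by (auto simp: Ker_def)
qed

lemma Ker_subgroup: "subgroup Ker G"
  by unfold_locales (auto simp: Ker_def Del_mult Del_inv trans_mult trans_inv)

lemma Ker_conj: "g \<in> carrier G \<Longrightarrow> k \<in> Ker \<Longrightarrow> conj g k \<in> Ker"
  using Del_nonzero[of g] by (simp add: Ker_def conj_def Del_mult Del_inv trans_mult trans_inv)

end

section \<open>Residually finite and solvable non-unimodular groups\<close>

context group
begin

lemma rcoset_eq_iff:
  assumes "subgroup H G" "x \<in> carrier G" "y \<in> carrier G"
  shows "H #> x = H #> y \<longleftrightarrow> x \<otimes> inv y \<in> H"
proof -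
  have c: "H \<subseteq> carrier G" "x \<otimes> inv y \<in> carrier G" using subgroup.subset assms by auto
  show ?thesis
  proof
    assume "H #> x = H #> y"
    then show "x \<otimes> inv y \<in> H"
      using coset_join1[OF coset_mult_inv2[OF _ assms(2,3) c(1)] c(2) assms(1)] by blast
  next
    assume "x \<otimes> inv y \<in> H"
    then show "H #> x = H #> y"
      using coset_mult_inv1[OF coset_join2[OF c(2) assms(1)] assms(2,3) c(1)] by blast
  qed
qed

text \<open>If \<open>c\<^sup>m = b\<^sup>n\<close> with \<open>m\<close> and \<open>n\<close> coprime, the common order of \<open>b\<close> and \<open>c\<close> is coprime to \<open>m\<close>.\<close>

lemma conjugate_in_powers:
  assumes b: "b \<in> carrier G" and c: "c \<in> carrier G" and ord: "ord b = ord c" "ord c \<noteq> 0"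
    and eq: "c [^] (m::int) = b [^] (n::int)" and cop: "coprime m n"
  shows "\<exists>j::int. c = b [^] j"
proof -
  define r where "r = int (ord c)"
  have r: "r dvd m * k \<longleftrightarrow> r dvd n * k" for k
  proof -
    have "c [^] (m * k) = b [^] (n * k)" using eq b c by (metis int_pow_pow)
    then show ?thesis using int_pow_eq_id[OF c, of "m * k"] int_pow_eq_id[OF b, of "n * k"] ord
      by (simp add: r_def)
  qed
  \<comment> \<open>The common factor \<open>d\<close> of the order and \<open>m\<close> also
    divides \<open>n\<close>, as the equivalence above shows with \<open>k = r div d\<close>. So
    \<open>d\<close> is a unit and \<open>m\<close> can be inverted modulo the order.\<close>
  define d where "d = gcd r m"
  have d: "d dvd r" "d dvd m" "r \<noteq> 0" using ord by (auto simp: d_def r_def)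
  obtain m' where m': "m = d * m'" using d by auto
  have rd: "r = d * (r div d)" using d by simp
  have "r dvd m * (r div d)"
    using rd m' by (metis dvd_triv_left mult.commute mult.left_commute)
  then have "r dvd n * (r div d)" using r by simp
  then have "d * (r div d) dvd n * (r div d)" using rd by simp
  moreover have "r div d \<noteq> 0" using d rd by auto
  ultimately have "d dvd n" by simp
  then have "is_unit d" using cop d(2) by (meson coprime_common_divisor)
  then have "gcd r m = 1" by (simp add: d_def)
  then obtain u v where uv: "u * r + v * m = 1" using bezout_int[of r m] by auto
  have "c = c [^] (u * r + v * m)" using uv c by simp
  also have "\<dots> = c [^] (r * u) \<otimes> c [^] (m * v)" using c by (simp add: int_pow_mult mult.commute)
  also have "c [^] (r * u) = \<one>" using int_pow_eq_id[OF c] by (simp add: r_def)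
  also have "c [^] (m * v) = b [^] (n * v)" using eq b c by (metis int_pow_pow)
  finally show ?thesis using b by auto
qed

lemma conj_ord:
  assumes "g \<in> carrier G" "x \<in> carrier G"
  shows "ord (conj g x) = ord x"
proof -
  have "conj g x [^] int n = \<one> \<longleftrightarrow> x [^] int n = \<one>" for n
  proof -
    have "conj g (x [^] int n) = \<one> \<longleftrightarrow> x [^] int n = \<one>"
      using conj_eq_iff_commute[of g "x [^] int n" \<one>] assms by simp
    then show ?thesis using conj_pow assms by simp
  qed
  then show ?thesis using ord_unique[of "conj g x" "ord x"] assms pow_eq_id[of x] by (simp add: int_pow_int)
qed

end

section \<open>Non-unimodular groups: when the kernel is trivial\<close>

context gbs
begin

text \<open>In \<open>conj s (a [^] m) = a [^] n\<close> a common factor of the exponents cannot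
  simply be cancelled. Replacing \<open>a\<close> by a power whose exponent is a multiple of these
  common factors removes them for all the finitely many generators at once.\<close>

lemma uniform_power:
  obtains b M S where "M \<noteq> (0::int)" "b = a [^] M" "finite S" "S \<subseteq> carrier G" "generate G S = carrier G"
    "\<And>s. s \<in> S \<Longrightarrow> \<exists>m n::int. m \<noteq> 0 \<and> n \<noteq> 0 \<and> coprime m n \<and> conj s (b [^] m) = b [^] n"
proof -
  obtain S where S: "finite S" "S \<subseteq> carrier G" "generate G S = carrier G"
    using fin_gen by (auto simp: finitely_generated_def)
  have "\<forall>s\<in>S. \<exists>d m n::int. d \<noteq> 0 \<and> m \<noteq> 0 \<and> n \<noteq> 0 \<and> coprime m n \<and> conj s (a [^] (d * m)) = a [^] (d * n)"
  proof
    fix s assume "s \<in> S"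
    then have "s \<in> carrier G" using S by auto
    then obtain m n :: int where mn: "m \<noteq> 0" "n \<noteq> 0" "conj s (a [^] m) = a [^] n" by (rule modular_relation)
    define d where "d = gcd m n"
    have d: "d \<noteq> 0" "d * (m div d) = m" "d * (n div d) = n" using mn by (auto simp: d_def)
    have "coprime (m div d) (n div d)" unfolding d_def using mn by (intro div_gcd_coprime) auto
    moreover have "m div d \<noteq> 0" "n div d \<noteq> 0" using d mn by auto
    ultimately show "\<exists>d m n::int. d \<noteq> 0 \<and> m \<noteq> 0 \<and> n \<noteq> 0 \<and> coprime m n \<and> conj s (a [^] (d * m)) = a [^] (d * n)"
      using d mn by (intro exI[of _ d] exI[of _ "m div d"] exI[of _ "n div d"]) simp
  qed
  then obtain d where d: "\<forall>s\<in>S. d s \<noteq> (0::int) \<and> (\<exists>m n::int. m \<noteq> 0 \<and> n \<noteq> 0 \<and> coprime m n \<and>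
      conj s (a [^] (d s * m)) = a [^] (d s * n))"
    by metis
  define M where "M = (\<Prod>s\<in>S. d s)"
  have "M \<noteq> 0" using d S by (simp add: M_def)
  moreover have "\<exists>m n::int. m \<noteq> 0 \<and> n \<noteq> 0 \<and> coprime m n \<and> conj s ((a [^] M) [^] m) = (a [^] M) [^] n"
    if s: "s \<in> S" for s
  proof -
    obtain m n :: int where mn: "m \<noteq> 0" "n \<noteq> 0" "coprime m n" "conj s (a [^] (d s * m)) = a [^] (d s * n)"
      using d s by blast
    obtain e where e: "M = d s * e" using s S by (metis M_def dvd_prodI dvdE)
    have "conj s ((a [^] M) [^] m) = conj s ((a [^] (d s * m)) [^] e)"
      using a(2) e by (simp add: int_pow_pow mult_ac)
    also have "\<dots> = (a [^] (d s * n)) [^] e" using mn conj_pow s S a(2) by auto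
    also have "\<dots> = (a [^] M) [^] n" using a(2) e by (simp add: int_pow_pow mult_ac)
    finally show ?thesis using mn by blast
  qed
  ultimately show ?thesis using that S by blast
qed

text \<open>A conjugacy class cannot stay inside a cyclic group unless \<open>\<bar>Del\<bar> = 1\<close>: look at the conjugate
  with the smallest exponent.\<close>

lemma Del_of_bounded_conjugates:
  assumes x: "x \<in> V" and c: "c \<in> carrier G" "c \<noteq> \<one>" and conj: "\<And>g. g \<in> carrier G \<Longrightarrow> conj g c \<in> St x"
    and g: "g \<in> carrier G"
  shows "Del g \<in> {1, -1}"
proof -
  obtain y where y: "y \<in> St x" "\<And>h. h \<in> St x \<Longrightarrow> \<exists>n::int. h = y [^] n" using St_gen[OF x] by metis
  have yc: "elliptic y" using ellipticI x y by blast
  have cx: "c \<in> St x" using conj[of \<one>] c by simp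
  have ec: "elliptic c" using ellipticI x cx by blast
  have "\<forall>g\<in>carrier G. \<exists>n::int. conj g c = y [^] n" using y conj by blast
  then obtain k :: "'a \<Rightarrow> int" where k: "\<And>g. g \<in> carrier G \<Longrightarrow> conj g c = y [^] k g" by metis
  have lc: "lam c \<noteq> 0" using lam_zero ec c by blast
  have kl: "of_int (k g) * lam y = Del g * lam c" if "g \<in> carrier G" for g
    using lam_conj[OF that ec] k[OF that] lam_pow[OF yc] by simp
  have ly: "lam y \<noteq> 0" using kl[of \<one>] lc by auto
  define m where "m = (ARG_MIN (\<lambda>g. nat \<bar>k g\<bar>) g. g \<in> carrier G)"
  have m: "m \<in> carrier G" "\<And>g. g \<in> carrier G \<Longrightarrow> nat \<bar>k m\<bar> \<le> nat \<bar>k g\<bar>"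
    using arg_min_nat_lemma[of "\<lambda>g. g \<in> carrier G" \<one> "\<lambda>g. nat \<bar>k g\<bar>"] by (auto simp: m_def)
  have km: "k m \<noteq> 0" using kl[OF m(1)] lc ly Del_nonzero[OF m(1)] by auto
  have ge: "\<bar>Del h\<bar> \<ge> 1" if h: "h \<in> carrier G" for h
  proof -
    have "of_int (k (h \<otimes> m)) * lam y = Del h * (of_int (k m) * lam y)"
      using kl[of "h \<otimes> m"] kl[OF m(1)] Del_mult[OF h m(1)] h m(1) by simp
    then have "of_int (k (h \<otimes> m)) = Del h * of_int (k m)" using ly by simp
    then have "\<bar>of_int (k (h \<otimes> m))\<bar> = \<bar>Del h\<bar> * (\<bar>of_int (k m)\<bar> :: rat)" by (simp add: abs_mult)
    moreover have "\<bar>k m\<bar> \<le> \<bar>k (h \<otimes> m)\<bar>" using m(2)[of "h \<otimes> m"] h m(1) by simp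
    then have "(\<bar>of_int (k m)\<bar> :: rat) \<le> \<bar>of_int (k (h \<otimes> m))\<bar>" by (metis of_int_abs of_int_le_iff)
    ultimately have "1 * (\<bar>of_int (k m)\<bar> :: rat) \<le> \<bar>Del h\<bar> * \<bar>of_int (k m)\<bar>" by simp
    then show ?thesis using km by (simp add: mult_le_cancel_right)
  qed
  have "\<bar>Del g\<bar> * \<bar>Del (inv g)\<bar> = 1" using Del_inv[OF g] Del_nonzero[OF g] by (simp add: abs_mult[symmetric])
  moreover have "\<bar>Del g\<bar> * 1 \<le> \<bar>Del g\<bar> * \<bar>Del (inv g)\<bar>" using ge[of "inv g"] g by (intro mult_left_mono) auto
  ultimately have "\<bar>Del g\<bar> = 1" using ge[OF g] by simp
  then show ?thesis by (auto simp: abs_if split: if_splits)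
qed

text \<open>In \<open>G\<close> itself a conjugate of \<open>b\<close> need not be a power of
  \<open>b\<close>. In a finite quotient both have the same finite order, and
  \<open>conjugate_in_powers\<close> turns the coprime relations into powers of \<open>B\<close>,
  first for generators and their inverses, then for all of \<open>G\<close>. So the commutator of
  \<open>b\<close> with a conjugate dies in every finite quotient.\<close>

lemma conjugates_commute:
  assumes rf: "residually_finite G"
    and S: "S \<subseteq> carrier G" "generate G S = carrier G" and b: "b \<in> carrier G"
    and rel: "\<And>s. s \<in> S \<Longrightarrow> \<exists>m n::int. m \<noteq> 0 \<and> n \<noteq> 0 \<and> coprime m n \<and> conj s (b [^] m) = b [^] n"
    and g: "g \<in> carrier G"
  shows "conj g b \<otimes> b = b \<otimes> conj g b"
proof (rule ccontr)
  define x where "x = conj g b"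
  have x: "x \<in> carrier G" using g b by (simp add: x_def)
  assume ne: "conj g b \<otimes> b \<noteq> b \<otimes> conj g b"
  have "(x \<otimes> b) \<otimes> inv (b \<otimes> x) \<noteq> \<one>"
  proof
    assume "(x \<otimes> b) \<otimes> inv (b \<otimes> x) = \<one>"
    then have "x \<otimes> b = \<one> \<otimes> (b \<otimes> x)" using x b by (metis inv_solve_right' m_closed one_closed)
    then show False using ne x b by (simp add: x_def)
  qed
  then obtain N where N: "N \<lhd> G" "finite (carrier (G Mod N))" "(x \<otimes> b) \<otimes> inv (b \<otimes> x) \<notin> N"
    using rf x b by (auto simp: residually_finite_def)
  interpret N: normal N G using N by simp
  interpret Q: group "G Mod N" by (rule N.factorgroup_is_group)
  define \<pi> where "\<pi> = (\<lambda>y. N #> y)"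
  have hom: "\<pi> \<in> hom G (G Mod N)" unfolding \<pi>_def by (rule N.r_coset_hom_Mod)
  interpret \<pi>: group_hom G "G Mod N" \<pi> by unfold_locales (rule hom)
  have pc: "\<pi> (conj h y) = Q.conj (\<pi> h) (\<pi> y)" if "h \<in> carrier G" "y \<in> carrier G" for h y
    using that by (simp add: conj_def Q.conj_def)
  define B where "B = \<pi> b"
  have B: "B \<in> carrier (G Mod N)" using b by (simp add: B_def)
  have "\<exists>j::int. \<pi> (conj h b) = B [^]\<^bsub>G Mod N\<^esub> j" if "h \<in> carrier G" for h
  proof -
    have "h \<in> generate G S" using that S by simp
    then have "h \<in> carrier G \<and> (\<exists>j::int. \<pi> (conj h b) = B [^]\<^bsub>G Mod N\<^esub> j)"
    proof (induction h)
      case one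
      then show ?case using b B by (auto simp: B_def intro!: exI[of _ 1])
    next
      case (incl s)
      then have s: "s \<in> carrier G" using S by auto
      obtain m n :: int where mn: "coprime m n" "conj s (b [^] m) = b [^] n" using rel incl by blast
      define C where "C = \<pi> (conj s b)"
      have C: "C \<in> carrier (G Mod N)" using s b by (simp add: C_def)
      have "\<pi> (conj s b [^] m) = \<pi> (b [^] n)" using mn conj_pow s b by simp
      then have eq: "C [^]\<^bsub>G Mod N\<^esub> m = B [^]\<^bsub>G Mod N\<^esub> n"
        using \<pi>.hom_int_pow s b by (simp add: C_def B_def)
      have "Q.ord B = Q.ord C" using pc[OF s b] Q.conj_ord[of "\<pi> s" "\<pi> b"] s b by (simp add: C_def B_def)
      moreover have "Q.ord C \<noteq> 0" using Q.ord_ge_1[OF N(2) C] by simp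
      ultimately have "\<exists>j::int. C = B [^]\<^bsub>G Mod N\<^esub> j"
        using Q.conjugate_in_powers[OF B C _ _ eq mn(1)] by simp
      then show ?case using s by (simp add: C_def)
    next
      case (inv s)
      then have s: "s \<in> carrier G" using S by auto
      obtain m n :: int where mn: "coprime m n" "conj s (b [^] m) = b [^] n" using rel inv by blast
      define C where "C = \<pi> (conj (inv s) b)"
      have C: "C \<in> carrier (G Mod N)" using s b by (simp add: C_def)
      have "conj (inv s) (b [^] n) = b [^] m" using mn(2) conj_inv_conj[of s "b [^] m"] s b by simp
      then have "\<pi> (conj (inv s) b [^] n) = \<pi> (b [^] m)" using conj_pow s b by simp
      then have eq: "C [^]\<^bsub>G Mod N\<^esub> n = B [^]\<^bsub>G Mod N\<^esub> m"
        using \<pi>.hom_int_pow s b by (simp add: C_def B_def)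
      have "Q.ord B = Q.ord C"
        using pc[of "inv s" b] Q.conj_ord[of "\<pi> (inv s)" "\<pi> b"] s b by (simp add: C_def B_def)
      moreover have "Q.ord C \<noteq> 0" using Q.ord_ge_1[OF N(2) C] by simp
      ultimately have "\<exists>j::int. C = B [^]\<^bsub>G Mod N\<^esub> j"
        using Q.conjugate_in_powers[OF B C _ _ eq] mn(1) by (simp add: coprime_commute)
      then show ?case using s by (simp add: C_def)
    next
      case (eng h1 h2)
      then obtain i j :: int where ij: "h1 \<in> carrier G" "\<pi> (conj h1 b) = B [^]\<^bsub>G Mod N\<^esub> i"
        "h2 \<in> carrier G" "\<pi> (conj h2 b) = B [^]\<^bsub>G Mod N\<^esub> j" by blast
      have "\<pi> (conj (h1 \<otimes> h2) b) = Q.conj (\<pi> h1) (B [^]\<^bsub>G Mod N\<^esub> j)"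
        using pc[of h1 "conj h2 b"] conj_conj[of h1 h2 b] ij b by simp
      also have "\<dots> = (Q.conj (\<pi> h1) B) [^]\<^bsub>G Mod N\<^esub> j" using Q.conj_pow ij B by simp
      also have "Q.conj (\<pi> h1) B = B [^]\<^bsub>G Mod N\<^esub> i" using pc ij b by (simp add: B_def)
      finally show ?case using ij Q.int_pow_pow[OF B] by auto
    qed
    then show ?thesis by simp
  qed
  then obtain j :: int where j: "\<pi> x = B [^]\<^bsub>G Mod N\<^esub> j" using g by (auto simp: x_def)
  have "\<pi> x \<otimes>\<^bsub>G Mod N\<^esub> B = B \<otimes>\<^bsub>G Mod N\<^esub> \<pi> x"
    unfolding j using Q.int_pow_mult[OF B, of j 1] Q.int_pow_mult[OF B, of 1 j] B by (simp add: add.commute)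
  then have "\<pi> (x \<otimes> b) = \<pi> (b \<otimes> x)" using x b by (simp add: B_def)
  then have "(x \<otimes> b) \<otimes> inv (b \<otimes> x) \<in> N"
    using rcoset_eq_iff[OF N.subgroup_axioms] x b by (simp add: \<pi>_def)
  then show False using N by simp
qed

lemma conj_commute_all:
  assumes b: "b \<in> carrier G" and com: "\<And>g. g \<in> carrier G \<Longrightarrow> conj g b \<otimes> b = b \<otimes> conj g b"
    and g: "g \<in> carrier G" "h \<in> carrier G"
  shows "conj g b \<otimes> conj h b = conj h b \<otimes> conj g b"
proof -
  have e: "conj g b = conj h (conj (inv h \<otimes> g) b)" using g b by (simp add: conj_conj m_assoc[symmetric])
  show ?thesis unfolding e using com[of "inv h \<otimes> g"] g b by (simp add: conj_mult[symmetric])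
qed

text \<open>For \<open>k\<close> in \<open>Ker\<close> and a conjugate \<open>c\<close> of
  \<open>b\<close>, \<open>conj k c\<close> is again a conjugate of \<open>b\<close>, so it commutes
  with \<open>c\<close> and shares a fixed vertex with it. As \<open>Del k = 1\<close>, both have
  the same \<open>lam\<close> and are equal: \<open>k\<close> commutes with every
  \<open>c\<close>.\<close>

lemma Ker_trivial_of_commuting:
  assumes b: "elliptic b" "b \<noteq> \<one>" and com: "\<And>g. g \<in> carrier G \<Longrightarrow> conj g b \<otimes> b = b \<otimes> conj g b"
    and nu: "h \<in> carrier G" "Del h \<notin> {1, -1}"
  shows "Ker = {\<one>}"
proof (rule ccontr)
  have bc: "b \<in> carrier G" using elliptic_carrier b by blast
  assume "Ker \<noteq> {\<one>}"
  then obtain k where k: "k \<in> Ker" "k \<noteq> \<one>" using subgroup.one_closed[OF Ker_subgroup] by blast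
  have kc: "k \<in> carrier G" using Ker_carrier k by blast
  have Fk: "Fix k = {}" using Ker_free k by (auto simp: Fix_def)
  obtain x where x: "x \<in> Min_set k" using Min_set_nonempty V_nonempty by blast
  have xV: "x \<in> V" using x by (simp add: Min_set_def)
  have "conj g b \<in> St x" if g: "g \<in> carrier G" for g
  proof -
    define c where "c = conj g b"
    have c: "elliptic c" "c \<in> carrier G" using conj_elliptic g b bc by (auto simp: c_def)
    define c' where "c' = conj k c"
    have c': "elliptic c'" "c' \<in> carrier G" using conj_elliptic kc c by (auto simp: c'_def)
    have "c' = conj (k \<otimes> g) b" using conj_conj kc g bc by (simp add: c'_def c_def)
    then have "c' \<otimes> c = c \<otimes> c'" using conj_commute_all[OF bc com, of "k \<otimes> g" g] kc g by (simp add: c_def)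
    then obtain w where w: "w \<in> Fix c'" "w \<in> Fix c"
      using common_fixed_vertex[OF c'(2) c(2)] c c' by (auto simp: elliptic_def)
    then have "w \<in> V" "c' \<in> St w" "c \<in> St w" using c c' by (auto simp: Fix_def St_iff)
    moreover have "lam c' = lam c" using lam_conj[OF kc c(1)] k by (simp add: c'_def Ker_def)
    ultimately have "c' = c" using lam_inj by blast
    then have "c \<otimes> k = k \<otimes> c" using conj_eq_iff_commute[OF kc c(2) c(2)] by (simp add: c'_def)
    then have "\<phi> c x = x" using Min_set_fixed[OF c(2) kc _ _ Fk x] c by (simp add: elliptic_def)
    then show ?thesis using c by (simp add: St_iff c_def)
  qed
  then show False using Del_of_bounded_conjugates[OF xV bc b(2) _ nu(1)] nu(2) by blast
qed

lemma solvable_of_Ker_trivial: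
  assumes "Ker = {\<one>}"
  shows "solvable G"
proof -
  have D: "subgroup {g \<in> carrier G. Del g = 1} G" by unfold_locales (auto simp: Del_mult Del_inv)
  have "derived_set G (carrier G) \<subseteq> {g \<in> carrier G. Del g = 1}"
    using Del_nonzero by (auto simp: Del_mult Del_inv)
  then have D1: "derived G (carrier G) \<subseteq> {g \<in> carrier G. Del g = 1}"
    unfolding derived_def by (rule generate_subgroup_incl[OF _ D])
  have "derived_set G {g \<in> carrier G. Del g = 1} \<subseteq> Ker"
    by (auto simp: Ker_def Del_mult Del_inv trans_mult trans_inv)
  then have "derived G {g \<in> carrier G. Del g = 1} \<subseteq> {\<one>}"
    unfolding derived_def using generate_subgroup_incl[OF _ Ker_subgroup] assms by blast
  moreover have "derived G (derived G (carrier G)) \<subseteq> derived G {g \<in> carrier G. Del g = 1}"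
    by (rule mono_derived[OF D1])
  moreover have "\<one> \<in> derived G (derived G (carrier G))"
    unfolding derived_def by (rule generate.one)
  ultimately have "(derived G ^^ 2) (carrier G) = {\<one>}" by (auto simp: numeral_2_eq_2)
  then show ?thesis using solvable_iff_trivial_derived_seq by blast
qed

theorem residually_finite_imp_solvable:
  assumes rf: "residually_finite G" and nu: "h \<in> carrier G" "Del h \<notin> {1, -1}"
  shows "solvable G"
proof -
  obtain b M S where bMS: "M \<noteq> (0::int)" "b = a [^] M" "finite S" "S \<subseteq> carrier G" "generate G S = carrier G"
    "\<And>s. s \<in> S \<Longrightarrow> \<exists>m n::int. m \<noteq> 0 \<and> n \<noteq> 0 \<and> coprime m n \<and> conj s (b [^] m) = b [^] n"
    by (rule uniform_power) blast
  have b: "b \<in> carrier G" "elliptic b" using bMS a St_pow[OF v0 a(1)] ellipticI v0 by auto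
  have "b \<noteq> \<one>" using bMS a_pow_eq[of M 0] by simp
  then show ?thesis
    using solvable_of_Ker_trivial Ker_trivial_of_commuting[OF b(2) _ _ nu]
      conjugates_commute[OF rf bMS(4,5) b(1) bMS(6)] by blast
qed

lemma Ker_trivial_of_solvable:
  assumes sol: "solvable G" and nu: "h \<in> carrier G" "Del h \<notin> {1, -1}"
  shows "Ker = {\<one>}"
proof (rule ccontr)
  assume ne: "Ker \<noteq> {\<one>}"
  define D where "D n = (derived G ^^ n) (carrier G)" for n
  have Dn: "D n \<lhd> G" for n
    by (induction n) (auto simp: D_def normal_self derived_is_normal)
  obtain n where n: "D n = {\<one>}" using sol solvable_iff_trivial_derived_seq by (auto simp: D_def)
  have one: "\<one> \<in> Ker" "\<one> \<in> D n" for n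
    using subgroup.one_closed[OF Ker_subgroup] subgroup.one_closed[OF normal_imp_subgroup[OF Dn]] by auto
  \<comment> \<open>The last nontrivial intersection of \<open>Ker\<close> with the derived series,
    called \<open>B\<close> below, is an abelian normal subgroup of \<open>G\<close> that acts
    freely.\<close>
  define i where "i = (LEAST i. Ker \<inter> D i = {\<one>})"
  have i: "Ker \<inter> D i = {\<one>}" unfolding i_def by (rule LeastI[of _ n]) (use n one in auto)
  have "i \<noteq> 0"
  proof
    assume "i = 0"
    then have "Ker \<inter> carrier G = {\<one>}" using i by (simp add: D_def)
    then show False using ne Ker_carrier by blast
  qed
  then obtain j where j: "i = Suc j" by (cases i) auto
  define B where "B = Ker \<inter> D j"
  have "B \<noteq> {\<one>}" using not_less_Least[of j "\<lambda>i. Ker \<inter> D i = {\<one>}"] j by (simp add: B_def i_def)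
  then obtain k where k: "k \<in> B" "k \<noteq> \<one>" using one by (auto simp: B_def)
  have Bs: "subgroup B G" unfolding B_def
    using subgroups_Inter_pair[OF Ker_subgroup normal_imp_subgroup[OF Dn]] .
  have Bc: "y \<in> carrier G" if "y \<in> B" for y using that Ker_carrier by (auto simp: B_def)
  have Bn: "conj g y \<in> B" if "g \<in> carrier G" "y \<in> B" for g y
    using that Ker_conj normal.inv_op_closed2[OF Dn] by (auto simp: B_def conj_def)
  have Bfree: "y = \<one>" if "y \<in> B" "x \<in> V" "\<phi> y x = x" for x y using that Ker_free by (auto simp: B_def)
  have Bab: "y \<otimes> z = z \<otimes> y" if yz: "y \<in> B" "z \<in> B" for y z
  proof -
    have "y \<otimes> z \<otimes> inv y \<otimes> inv z \<in> D (Suc j)"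
      unfolding D_def funpow.simps comp_def derived_def[of _ "(derived G ^^ j) (carrier G)"]
      by (rule generate.incl) (use yz in \<open>auto simp: B_def D_def\<close>)
    moreover have "y \<otimes> z \<otimes> inv y \<otimes> inv z \<in> B"
      using yz Bs by (simp add: subgroup.m_closed subgroup.m_inv_closed)
    ultimately have "y \<otimes> z \<otimes> inv y \<otimes> inv z = \<one>" using i j by (auto simp: B_def)
    then have "(y \<otimes> z) \<otimes> inv (z \<otimes> y) = \<one>"
      using Bc[OF yz(1)] Bc[OF yz(2)] by (simp add: inv_mult_group m_assoc)
    then show ?thesis using Bc[OF yz(1)] Bc[OF yz(2)] inv_solve_right'[of \<one> "y \<otimes> z" "z \<otimes> y"] by simp
  qed
  have kc: "k \<in> carrier G" using Bc k by blast
  \<comment> \<open>By normality \<open>conj e y \<otimes> inv y\<close> lies in \<open>B\<close>;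
    it fixes \<open>\<phi> y x\<close>, so freeness makes it trivial.\<close>
  have commute: "e \<otimes> y = y \<otimes> e"
    if "e \<in> carrier G" "y \<in> B" "x \<in> V" "\<phi> e x = x" "\<phi> e (\<phi> y x) = \<phi> y x" for e x y
  proof -
    note yc = Bc[OF that(2)]
    have "conj e y \<otimes> inv y \<in> B" using Bn that Bs by (simp add: subgroup.m_closed subgroup.m_inv_closed)
    moreover have "\<phi> (conj e y \<otimes> inv y) (\<phi> y x) = \<phi> y x"
    proof -
      have "\<phi> (inv e) x = x" using act_eq_iff[of "inv e" x x] that by simp
      then show ?thesis
        using that yc act_mult[of "conj e y" "inv y" "\<phi> y x"] act_in act_inv_act
        by (simp add: conj_def act_mult)
    qed
    ultimately have "conj e y \<otimes> inv y = \<one>" using Bfree[of _ "\<phi> y x"] act_in yc that by simp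
    then have "conj e y = y" using yc that(1) by (simp add: inv_solve_right')
    then show ?thesis using conj_eq_iff_commute[of e y y] yc that(1) by simp
  qed
  have Fk: "Fix y = {}" if "y \<in> B" "y \<noteq> \<one>" for y using that Bfree by (auto simp: Fix_def)
  obtain x where x: "x \<in> Min_set k" using Min_set_nonempty V_nonempty by blast
  have xV: "x \<in> V" using x by (simp add: Min_set_def)
  obtain q where q: "q \<in> St x" "ord q = 0" using St_gen[OF xV] by metis
  have qc: "q \<in> carrier G" using St_carrier q by blast
  \<comment> \<open>A power of \<open>q\<close> that fixes both \<open>x\<close> and
    \<open>\<phi> k x\<close>, so that it commutes with \<open>k\<close>.\<close>
  obtain l where l: "l \<noteq> (0::int)" "q [^] l \<in> St (\<phi> k x)"
    using commensurable[OF xV act_in[OF kc xV]] q by metis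
  define c where "c = q [^] l"
  have c: "c \<in> St x" "c \<in> carrier G" "c \<noteq> \<one>" "elliptic c"
    using St_pow xV q l qc int_pow_eq_id[OF qc, of l] ellipticI[OF xV] by (auto simp: c_def)
  have ck: "c \<otimes> k = k \<otimes> c"
    using commute[OF c(2) k(1) xV] c l by (simp add: St_iff c_def)
  have "conj g c \<in> St x" if g: "g \<in> carrier G" for g
  proof -
    \<comment> \<open>That \<open>conj g c\<close> commutes with \<open>k\<close> means that
      \<open>c\<close> commutes with \<open>k'\<close>. Since \<open>k'\<close> commutes with
      \<open>k\<close>, it keeps \<open>x\<close> on the axis of \<open>k\<close>, which
      \<open>c\<close> fixes pointwise; so \<open>commute\<close> applies.\<close>
    define k' where "k' = conj (inv g) k"
    have k': "k' \<in> B" "k' \<in> carrier G" using Bn k g Bc by (auto simp: k'_def)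
    have "\<phi> c (\<phi> k' x) = \<phi> k' x"
      using Min_set_fixed[OF c(2) kc ck _ Fk[OF k] Min_set_commute[OF kc k'(2) Bab[OF k'(1) k(1)] x]] c
      by (simp add: elliptic_def)
    then have ck': "c \<otimes> k' = k' \<otimes> c" using commute[OF c(2) k'(1) xV] c by (simp add: St_iff)
    have gk: "conj g k' = k" using conj_conj[of g "inv g" k] g kc by (simp add: k'_def)
    have "conj g c \<otimes> k = k \<otimes> conj g c"
      using ck' conj_mult[OF g c(2) k'(2)] conj_mult[OF g k'(2) c(2)] gk by simp
    then have "\<phi> (conj g c) x = x"
      using Min_set_fixed[OF _ kc _ _ Fk[OF k] x, of "conj g c"] conj_elliptic[OF g c(4)] g c(2)
      by (simp add: elliptic_def)
    then show ?thesis using g c by (simp add: St_iff)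
  qed
  then show False using Del_of_bounded_conjugates[OF xV c(2,3) _ nu(1)] nu(2) by blast
qed

end

section \<open>Finite index subgroups and residual finiteness\<close>

context group
begin

text \<open>The finite index statements below rest on this: it suffices to find an invariant with
  finitely many values that tells the cosets apart.\<close>

lemma rcosets_finiteI:
  assumes H: "subgroup H G" and fin: "finite (code ` carrier G)"
    and code: "\<And>x y. x \<in> carrier G \<Longrightarrow> y \<in> carrier G \<Longrightarrow> code x = code y \<Longrightarrow> x \<otimes> inv y \<in> H"
  shows "finite (rcosets H)"
proof -
  have "rcosets H \<subseteq> (\<lambda>t. H #> (SOME x. x \<in> carrier G \<and> code x = t)) ` code ` carrier G"
  proof
    fix P assume "P \<in> rcosets H"
    then obtain x where x: "x \<in> carrier G" "P = H #> x" by (auto simp: RCOSETS_def)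
    define y where "y = (SOME y. y \<in> carrier G \<and> code y = code x)"
    have "y \<in> carrier G \<and> code y = code x" unfolding y_def by (rule someI[of _ x]) (use x in simp)
    then have "P = H #> y" using rcoset_eq_iff[OF H] code x by metis
    then show "P \<in> (\<lambda>t. H #> (SOME x. x \<in> carrier G \<and> code x = t)) ` code ` carrier G"
      using x unfolding y_def by blast
  qed
  then show ?thesis using fin by (meson finite_imageI finite_subset)
qed

text \<open>Residual finiteness with arbitrary finite index subgroups in place of normal ones; in
  this form it passes easily through preimages and from a finite index subgroup to the whole
  group.\<close>

definition separated :: bool where
  "separated \<longleftrightarrow> (\<forall>g\<in>carrier G. g \<noteq> \<one> \<longrightarrow> (\<exists>L. subgroup L G \<and> finite (rcosets L) \<and> g \<notin> L))"

text \<open>The normal core of \<open>L\<close> is the kernel of the permutation action on the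
  finitely many cosets of \<open>L\<close>; the code of an element is its permutation.\<close>

lemma separated_imp_residually_finite:
  assumes sep: separated
  shows "residually_finite G"
  unfolding residually_finite_def
proof (intro ballI impI)
  fix g assume g: "g \<in> carrier G" "g \<noteq> \<one>"
  then obtain L where L: "subgroup L G" "finite (rcosets L)" "g \<notin> L" using sep by (auto simp: separated_def)
  have Lc: "L \<subseteq> carrier G" using subgroup.subset L by blast
  define N where "N = {x \<in> carrier G. \<forall>y\<in>carrier G. conj y x \<in> L}"
  have Ns: "subgroup N G"
  proof
    show "x \<otimes> y \<in> N" if "x \<in> N" "y \<in> N" for x y
      using that L by (auto simp: N_def conj_mult subgroup.m_closed)
    show "inv x \<in> N" if x: "x \<in> N" for x
    proof -
      have "conj y (inv x) = inv (conj y x)" if "y \<in> carrier G" for y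
        using x that by (simp add: N_def conj_def inv_mult_group m_assoc)
      then show ?thesis using x L by (auto simp: N_def subgroup.m_inv_closed)
    qed
    show "\<one> \<in> N" using subgroup.one_closed[OF L(1)] by (auto simp: N_def conj_def)
  qed (auto simp: N_def)
  have "conj y x \<in> N" if "y \<in> carrier G" "x \<in> N" for x y
    using that by (auto simp: N_def conj_conj)
  then have "N \<lhd> G" using Ns by (auto simp: normal_inv_iff conj_def)
  moreover have "finite (rcosets N)"
  proof (rule rcosets_finiteI[OF Ns, where code = "\<lambda>x. restrict (\<lambda>P. P #> x) (rcosets L)"])
    have "P #> x \<in> rcosets L" if x: "x \<in> carrier G" and P: "P \<in> rcosets L" for x P
    proof -
      obtain y where "y \<in> carrier G" "P = L #> y" using P by (auto simp: RCOSETS_def)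
      then show ?thesis using coset_mult_assoc[OF Lc _ x] rcosetsI[OF Lc] x by simp
    qed
    then have "(\<lambda>x. restrict (\<lambda>P. P #> x) (rcosets L)) ` carrier G \<subseteq> (\<Pi>\<^sub>E P\<in>rcosets L. rcosets L)"
      by auto
    then show "finite ((\<lambda>x. restrict (\<lambda>P. P #> x) (rcosets L)) ` carrier G)"
      by (rule finite_subset) (intro finite_PiE L)
    fix x y assume xy: "x \<in> carrier G" "y \<in> carrier G"
      and eq: "restrict (\<lambda>P. P #> x) (rcosets L) = restrict (\<lambda>P. P #> y) (rcosets L)"
    have "conj z (x \<otimes> inv y) \<in> L" if z: "z \<in> carrier G" for z
    proof -
      have "L #> z \<in> rcosets L" using rcosetsI Lc z by blast
      then have "L #> z #> x = L #> z #> y" using fun_cong[OF eq, of "L #> z"] by simp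
      then have "L #> (z \<otimes> x) = L #> (z \<otimes> y)" using coset_mult_assoc Lc xy z by simp
      then have "(z \<otimes> x) \<otimes> inv (z \<otimes> y) \<in> L" using rcoset_eq_iff[OF L(1)] xy z by simp
      then show ?thesis using xy z by (simp add: conj_def inv_mult_group m_assoc)
    qed
    then show "x \<otimes> inv y \<in> N" using xy by (simp add: N_def)
  qed
  then have "finite (carrier (G Mod N))" by (simp add: FactGroup_def)
  moreover have "g \<notin> N"
  proof
    assume "g \<in> N"
    then have "conj \<one> g \<in> L" unfolding N_def by blast
    then show False using L g by simp
  qed
  ultimately show "\<exists>N. N \<lhd> G \<and> finite (carrier (G Mod N)) \<and> g \<notin> N" by blast
qed

lemma finite_index_vimage:
  assumes K: "group K" and f: "f \<in> hom G K" and L: "subgroup L K" "finite (rcosets\<^bsub>K\<^esub> L)"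
  shows "subgroup {x \<in> carrier G. f x \<in> L} G" "finite (rcosets {x \<in> carrier G. f x \<in> L})"
proof -
  interpret f: group_hom G K f by (intro group_hom.intro group_hom_axioms.intro is_group K f)
  show sub: "subgroup {x \<in> carrier G. f x \<in> L} G"
    using L(1) by unfold_locales (auto simp: subgroup.m_closed subgroup.one_closed subgroup.m_inv_closed)
  show "finite (rcosets {x \<in> carrier G. f x \<in> L})"
  proof (rule rcosets_finiteI[OF sub, where code = "\<lambda>x. L #>\<^bsub>K\<^esub> f x"])
    have "(\<lambda>x. L #>\<^bsub>K\<^esub> f x) ` carrier G \<subseteq> rcosets\<^bsub>K\<^esub> L"
      by (auto simp: RCOSETS_def intro!: bexI f.hom_closed)
    then show "finite ((\<lambda>x. L #>\<^bsub>K\<^esub> f x) ` carrier G)" using L(2) by (rule finite_subset)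
  next
    fix x y assume "x \<in> carrier G" "y \<in> carrier G" "L #>\<^bsub>K\<^esub> f x = L #>\<^bsub>K\<^esub> f y"
    then show "x \<otimes> inv y \<in> {x \<in> carrier G. f x \<in> L}"
      using group.rcoset_eq_iff[OF K L(1), of "f x" "f y"] by simp
  qed
qed

text \<open>The code pairs the coset of \<open>H\<close> with the coset of \<open>L\<close> of the
  remaining factor in \<open>H\<close>. Equal first entries mean the same representative
  \<open>z\<close>, which then cancels.\<close>

lemma separated_finite_index:
  assumes H: "subgroup H G" "finite (rcosets H)" and sep: "group.separated (G\<lparr>carrier := H\<rparr>)"
  shows separated
  unfolding separated_def
proof (intro ballI impI)
  interpret H: group "G\<lparr>carrier := H\<rparr>" using H(1) is_group by (rule subgroup.subgroup_is_group)
  fix g assume g: "g \<in> carrier G" "g \<noteq> \<one>"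
  show "\<exists>L. subgroup L G \<and> finite (rcosets L) \<and> g \<notin> L"
  proof (cases "g \<in> H")
    case False then show ?thesis using H by blast
  next
    case True
    then obtain L where L: "subgroup L (G\<lparr>carrier := H\<rparr>)" "finite (rcosets\<^bsub>G\<lparr>carrier := H\<rparr>\<^esub> L)" "g \<notin> L"
      using sep g by (auto simp: H.separated_def)
    have LG: "subgroup L G" using incl_subgroup[OF H(1) L(1)] .
    define r where "r P = (SOME x. x \<in> P)" for P :: "'a set"
    have r: "r (H #> x) \<in> carrier G" "x \<otimes> inv (r (H #> x)) \<in> H" if x: "x \<in> carrier G" for x
    proof -
      have "r (H #> x) \<in> H #> x" unfolding r_def using rcos_self[OF x H(1)] by (rule someI)
      then have *: "H #> x = H #> r (H #> x)" "r (H #> x) \<in> carrier G"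
        using repr_independence[OF _ x H(1)] r_coset_subset_G[OF subgroup.subset[OF H(1)] x] by auto
      then show "r (H #> x) \<in> carrier G" "x \<otimes> inv (r (H #> x)) \<in> H"
        using rcoset_eq_iff[OF H(1) x] by auto
    qed
    have "finite (rcosets L)"
    proof (rule rcosets_finiteI[OF LG, where code = "\<lambda>x. (H #> x, L #> (x \<otimes> inv (r (H #> x))))"])
      have "(\<lambda>x. (H #> x, L #> (x \<otimes> inv (r (H #> x))))) ` carrier G
          \<subseteq> (rcosets H) \<times> (rcosets\<^bsub>G\<lparr>carrier := H\<rparr>\<^esub> L)"
        using r by (auto simp: RCOSETS_def r_coset_def)
      then show "finite ((\<lambda>x. (H #> x, L #> (x \<otimes> inv (r (H #> x))))) ` carrier G)"
        using H(2) L(2) by (meson finite_SigmaI finite_subset)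
      fix x y assume xy: "x \<in> carrier G" "y \<in> carrier G"
        and eq: "(H #> x, L #> (x \<otimes> inv (r (H #> x)))) = (H #> y, L #> (y \<otimes> inv (r (H #> y))))"
      define z where "z = r (H #> x)"
      have z: "z \<in> carrier G" using r xy by (simp add: z_def)
      have "r (H #> y) = z" using eq by (simp add: z_def)
      moreover have "L #> (x \<otimes> inv (r (H #> x))) = L #> (y \<otimes> inv (r (H #> y)))"
        using eq by (rule Pair_inject)
      ultimately have "L #> (x \<otimes> inv z) = L #> (y \<otimes> inv z)" by (simp only: z_def)
      then have "(x \<otimes> inv z) \<otimes> inv (y \<otimes> inv z) \<in> L" using rcoset_eq_iff[OF LG] xy z by simp
      moreover have "(x \<otimes> inv z) \<otimes> inv (y \<otimes> inv z) = x \<otimes> (inv z \<otimes> (z \<otimes> inv y))"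
        using xy z by (simp add: inv_mult_group m_assoc)
      moreover have "inv z \<otimes> (z \<otimes> inv y) = inv y" using xy z by (simp add: m_assoc[symmetric])
      ultimately show "x \<otimes> inv y \<in> L" by simp
    qed
    then show ?thesis using LG L by blast
  qed
qed

end

section \<open>Residual finiteness of the integers and of free groups\<close>

lemma separated_integer_group: "group.separated integer_group"
  unfolding group.separated_def[OF group_integer_group]
proof (intro ballI impI)
  fix g assume "g \<in> carrier integer_group" "g \<noteq> \<one>\<^bsub>integer_group\<^esub>"
  then have g: "g \<noteq> 0" by simp
  \<comment> \<open>A modulus larger than \<open>\<bar>g\<bar>\<close> cannot divide the nonzero
    \<open>g\<close>.\<close>
  define m where "m = \<bar>g\<bar> + 1"
  have sub: "subgroup {x. m dvd x} integer_group" by unfold_locales auto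
  have "finite (rcosets\<^bsub>integer_group\<^esub> {x. m dvd x})"
  proof (rule group.rcosets_finiteI[OF group_integer_group sub, where code = "\<lambda>x. x mod m"])
    have "m > 0" by (simp add: m_def)
    then have "(\<lambda>x. x mod m) ` carrier integer_group \<subseteq> {0..<m}" by auto
    then show "finite ((\<lambda>x. x mod m) ` carrier integer_group)" by (rule finite_subset) simp
  qed (simp add: mod_eq_dvd_iff)
  moreover have "g \<notin> {x. m dvd x}" using g zdvd_not_zless[of "\<bar>g\<bar>" m] by (auto simp: m_def)
  ultimately show "\<exists>L. subgroup L integer_group \<and> finite (rcosets\<^bsub>integer_group\<^esub> L) \<and> g \<notin> L"
    using sub by blast
qed

text \<open>The complements of domain and image in \<open>A\<close> have equal size. The identity
  outside \<open>A\<close> makes \<open>p\<close> a bijection of the whole type, so that its inverse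
  is total.\<close>

lemma partial_injection_extends:
  assumes "finite A" "D \<subseteq> A" "inj_on f D" "f ` D \<subseteq> A"
  obtains p where "bij p" "p ` A = A" "\<And>x. x \<in> D \<Longrightarrow> p x = f x"
proof -
  have fin: "finite D" "finite (f ` D)" using assms finite_subset by auto
  have "card (A - D) = card (A - f ` D)"
    using assms fin by (simp add: card_Diff_subset card_image)
  then obtain h where h: "bij_betw h (A - D) (A - f ` D)"
    using finite_same_card_bij[of "A - D" "A - f ` D"] assms by auto
  define p where "p x = (if x \<in> D then f x else if x \<in> A then h x else x)" for x
  have "bij_betw p D (f ` D)" using assms(3) by (simp add: p_def bij_betw_def inj_on_def)
  moreover have "bij_betw p (A - D) (A - f ` D)"
    using h by (subst bij_betw_cong[of _ p h]) (auto simp: p_def)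
  ultimately have "bij_betw p (D \<union> (A - D)) (f ` D \<union> (A - f ` D))" by (rule bij_betw_combine) auto
  then have A: "bij_betw p A A" using assms by (simp add: Un_absorb1)
  moreover have "bij_betw p (- A) (- A)"
    using assms by (subst bij_betw_cong[of _ p id]) (auto simp: p_def)
  ultimately have "bij_betw p (A \<union> - A) (A \<union> - A)" by (rule bij_betw_combine) auto
  then have "bij p" by simp
  then show ?thesis
  proof (rule that)
    show "p ` A = A" using A by (simp add: bij_betw_def)
  qed (simp add: p_def)
qed

text \<open>A reduced word of length \<open>n\<close> prescribes partial injections of \<open>{0..n}\<close>, its \<open>i\<close>-th letter moving
  \<open>i + 1\<close> to \<open>i\<close>. Extending them to permutations gives an action in which the word moves \<open>n\<close> to \<open>0\<close>.\<close>

lemma letter_permutations: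
  assumes w: "w \<in> reduced_words X"
  obtains \<sigma> :: "'a \<Rightarrow> nat \<Rightarrow> nat" where "\<And>x. bij (\<sigma> x)" "\<And>x. \<sigma> x ` {..length w} = {..length w}"
    "\<And>i. i < length w \<Longrightarrow> snd (w ! i) \<Longrightarrow> \<sigma> (fst (w ! i)) (Suc i) = i"
    "\<And>i. i < length w \<Longrightarrow> \<not> snd (w ! i) \<Longrightarrow> \<sigma> (fst (w ! i)) i = Suc i"
proof -
  define n where "n = length w"
  have red: "w ! i = (x, s) \<Longrightarrow> w ! Suc i = (x, \<not> s) \<Longrightarrow> Suc i < n \<Longrightarrow> False" for i x s
    using w successively_nth[of _ w i] unfolding reduced_words_def n_def by fastforce
  define D where "D x = {j. \<exists>i<n. w ! i = (x, True) \<and> j = Suc i \<or> w ! i = (x, False) \<and> j = i}" for x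
  \<comment> \<open>Reducedness is used twice: without a factor \<open>x x^-1\<close> the two
    prescriptions for a point never clash, and without a factor \<open>x^-1 x\<close> no value is
    taken twice.\<close>
  define f where "f x j = (if j > 0 \<and> w ! (j - 1) = (x, True) then j - 1 else Suc j)" for x j
  have down: "f x (Suc i) = i" if "w ! i = (x, True)" for x i
    using that by (simp add: f_def)
  have up: "f x i = Suc i" if "i < n" "w ! i = (x, False)" for x i
    using that red[of "i - 1" x True] by (auto simp: f_def)
  have "\<exists>p. bij p \<and> p ` {..n} = {..n} \<and> (\<forall>j\<in>D x. p j = f x j)" for x
  proof (rule partial_injection_extends[of "{..n}" "D x" "f x"])
    show "f x ` D x \<subseteq> {..n}" using down up by (auto simp: D_def)
    show "inj_on (f x) (D x)"
    proof (rule inj_onI)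
      fix j k assume jk: "j \<in> D x" "k \<in> D x" "f x j = f x k"
      obtain i where i: "i < n" "w ! i = (x, True) \<and> j = Suc i \<or> w ! i = (x, False) \<and> j = i"
        using jk by (auto simp: D_def)
      obtain l where l: "l < n" "w ! l = (x, True) \<and> k = Suc l \<or> w ! l = (x, False) \<and> k = l"
        using jk by (auto simp: D_def)
      show "j = k"
        using i l jk(3) down up red[of i x False] red[of l x False] by auto
    qed
  qed (auto simp: D_def)
  then obtain \<sigma> where \<sigma>: "\<And>x. bij (\<sigma> x)" "\<And>x. \<sigma> x ` {..n} = {..n}" "\<And>x j. j \<in> D x \<Longrightarrow> \<sigma> x j = f x j"
    by metis
  show ?thesis
  proof (rule that)
    fix i assume i: "i < length w"
    { assume "snd (w ! i)"
      then have e: "w ! i = (fst (w ! i), True)" by (simp add: prod_eq_iff)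
      then have "Suc i \<in> D (fst (w ! i))" using i by (auto simp: D_def n_def)
      then show "\<sigma> (fst (w ! i)) (Suc i) = i" using \<sigma>(3) down[OF e] by simp }
    { assume "\<not> snd (w ! i)"
      then have e: "w ! i = (fst (w ! i), False)" by (simp add: prod_eq_iff)
      then have "i \<in> D (fst (w ! i))" using i by (auto simp: D_def n_def)
      then show "\<sigma> (fst (w ! i)) i = Suc i" using \<sigma>(3) up[OF _ e] i by (simp add: n_def) }
  qed (use \<sigma> in \<open>auto simp: n_def\<close>)
qed

text \<open>The permutations attached to the letters of the reduced word of \<open>g\<close> define
  an action of the free group on \<open>{..n}\<close> in which \<open>g\<close> moves
  \<open>n\<close> to 0. The stabilizer of \<open>n\<close> has finite index and omits
  \<open>g\<close>.\<close>

lemma free_group_separated: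
  assumes "free_group F"
  shows "group.separated F"
proof -
  interpret group F using assms by (simp add: free_group_def)
  obtain X where X: "X \<subseteq> carrier F" and bij: "bij_betw (eval_word F) (reduced_words X) (carrier F)"
    using assms by (auto simp: free_group_def)
  show ?thesis
    unfolding separated_def
  proof (intro ballI impI)
    fix g assume g: "g \<in> carrier F" "g \<noteq> \<one>\<^bsub>F\<^esub>"
    define word where "word = inv_into (reduced_words X) (eval_word F)"
    have word: "word k \<in> reduced_words X" "eval_word F (word k) = k" if "k \<in> carrier F" for k
      using that bij unfolding word_def bij_betw_def by (auto intro: inv_into_into f_inv_into_f)
    have word_eval: "word (eval_word F u) = u" if "u \<in> reduced_words X" for u
      using that bij unfolding word_def bij_betw_def by (simp add: inv_into_f_f)
    define w where "w = word g"
    define n where "n = length w"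
    have w: "w \<in> reduced_words X" "eval_word F w = g" using word g by (auto simp: w_def)
    have "n > 0" using w g by (auto simp: n_def eval_word_simps)
    obtain \<sigma> :: "'a \<Rightarrow> nat \<Rightarrow> nat" where \<sigma>: "\<And>x. bij (\<sigma> x)" "\<And>x. \<sigma> x ` {..n} = {..n}"
      "\<And>i. i < n \<Longrightarrow> snd (w ! i) \<Longrightarrow> \<sigma> (fst (w ! i)) (Suc i) = i"
      "\<And>i. i < n \<Longrightarrow> \<not> snd (w ! i) \<Longrightarrow> \<sigma> (fst (w ! i)) i = Suc i"
      using letter_permutations[OF w(1)] unfolding n_def by metis
    define la where "la p = (if snd p then \<sigma> (fst p) else inv_into UNIV (\<sigma> (fst p)))" for p :: "'a \<times> bool"
    have la_flip: "la (x, s) (la (x, \<not> s) j) = j" for x s j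
      using \<sigma>(1)[of x] by (auto simp: la_def bij_is_surj surj_f_inv_f bij_is_inj inv_f_f)
    have la_in: "la p j \<le> n" if "j \<le> n" for p j
    proof -
      have "\<sigma> (fst p) j \<in> {..n}" using \<sigma>(2)[of "fst p"] that by blast
      moreover have "inv_into UNIV (\<sigma> (fst p)) j \<in> {..n}"
      proof -
        have "j \<in> \<sigma> (fst p) ` {..n}" using \<sigma>(2)[of "fst p"] that by simp
        then obtain k where k: "k \<in> {..n}" "j = \<sigma> (fst p) k" by blast
        show ?thesis using k(1) unfolding k(2) inv_f_f[OF bij_is_inj[OF \<sigma>(1)]] .
      qed
      ultimately show ?thesis by (simp add: la_def)
    qed
    define act where "act u = foldr (\<lambda>p f. la p \<circ> f) u id" for u
    define \<Phi> where "\<Phi> k = act (word k)" for k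
    have act_in: "act u j \<le> n" if "j \<le> n" for u j
      using that by (induction u) (auto simp: act_def la_in)
    have act_eval: "\<Phi> (eval_word F u) = act u" if "u \<in> reduced_words X" for u
      using word_eval that by (simp add: \<Phi>_def)
    have Xl: "letter p \<in> carrier F" if "fst p \<in> X" for p using that X by auto
    have step: "\<Phi> (letter p \<otimes>\<^bsub>F\<^esub> k) = la p \<circ> \<Phi> k" if p: "fst p \<in> X" and k: "k \<in> carrier F" for p k
    proof -
      obtain u where u: "u \<in> reduced_words X" "k = eval_word F u" using word k by metis
      show ?thesis
      proof (cases "p # u \<in> reduced_words X")
        case True
        then show ?thesis using act_eval[OF True] act_eval[OF u(1)] u(2) by (simp add: eval_word_simps act_def)
      next
        case False
        then obtain q v where v: "u = q # v" "fst p = fst q" "snd p \<noteq> snd q"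
          using u p by (cases u) (auto simp: reduced_words_def)
        have vR: "v \<in> reduced_words X" and vc: "eval_word F v \<in> carrier F"
          using u v X by (auto simp: reduced_words_def successively_Cons intro!: eval_word_in_carrier)
        have pq: "p = (fst q, \<not> snd q)" using v by (simp add: prod_eq_iff)
        then have "letter p = inv\<^bsub>F\<^esub> (letter q)" using letter_flip[of q] p X by auto
        then have "letter p \<otimes>\<^bsub>F\<^esub> k = eval_word F v"
          using u v vc Xl[of q] p by (simp add: eval_word_simps m_assoc[symmetric])
        then have "\<Phi> (letter p \<otimes>\<^bsub>F\<^esub> k) = act v" using act_eval vR by simp
        moreover have "la p \<circ> \<Phi> k = act v"
          using act_eval[OF u(1)] u(2) v(1) pq la_flip[of "fst q" "\<not> snd q"]
          by (auto simp: act_def fun_eq_iff)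
        ultimately show ?thesis by simp
      qed
    qed
    have hom: "\<Phi> (h \<otimes>\<^bsub>F\<^esub> k) = \<Phi> h \<circ> \<Phi> k" if h: "h \<in> carrier F" and k: "k \<in> carrier F" for h k
    proof -
      have "\<Phi> (eval_word F u \<otimes>\<^bsub>F\<^esub> k) = act u \<circ> \<Phi> k" if "fst ` set u \<subseteq> X" for u
        using that
      proof (induction u)
        case (Cons p u)
        have "eval_word F u \<in> carrier F" using Cons.prems X by (intro eval_word_in_carrier) auto
        then have "\<Phi> (eval_word F (p # u) \<otimes>\<^bsub>F\<^esub> k) = la p \<circ> \<Phi> (eval_word F u \<otimes>\<^bsub>F\<^esub> k)"
          using step[of p "eval_word F u \<otimes>\<^bsub>F\<^esub> k"] Cons.prems Xl[of p] k by (simp add: eval_word_simps m_assoc)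
        then show ?case using Cons by (simp add: act_def comp_assoc)
      qed (use k in \<open>simp add: eval_word_simps act_def\<close>)
      from this[of "word h"] show ?thesis
        using word[OF h] by (simp add: \<Phi>_def reduced_words_def)
    qed
    have one: "\<Phi> \<one>\<^bsub>F\<^esub> = id" using act_eval[of "[]"] by (simp add: eval_word_simps act_def reduced_words_def)
    have cancel: "\<Phi> k (\<Phi> (inv\<^bsub>F\<^esub> k) j) = j" if "k \<in> carrier F" for k j
      using hom[of k "inv\<^bsub>F\<^esub> k"] that one by (simp add: fun_eq_iff)
    define L where "L = {k \<in> carrier F. \<Phi> k n = n}"
    have L: "subgroup L F"
    proof
      show "inv\<^bsub>F\<^esub> x \<in> L" if "x \<in> L" for x
        using that cancel[of "inv\<^bsub>F\<^esub> x" n] by (auto simp: L_def)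
    qed (auto simp: L_def hom one)
    have "finite (rcosets\<^bsub>F\<^esub> L)"
    \<comment> \<open>Right cosets of a point stabilizer correspond to images of the point under
      inverses.\<close>
    proof (rule rcosets_finiteI[OF L, where code = "\<lambda>x. \<Phi> (inv\<^bsub>F\<^esub> x) n"])
      have "(\<lambda>x. \<Phi> (inv\<^bsub>F\<^esub> x) n) ` carrier F \<subseteq> {..n}" using act_in by (auto simp: \<Phi>_def)
      then show "finite ((\<lambda>x. \<Phi> (inv\<^bsub>F\<^esub> x) n) ` carrier F)" by (rule finite_subset) simp
      fix x y assume xy: "x \<in> carrier F" "y \<in> carrier F" "\<Phi> (inv\<^bsub>F\<^esub> x) n = \<Phi> (inv\<^bsub>F\<^esub> y) n"
      then have "\<Phi> (x \<otimes>\<^bsub>F\<^esub> inv\<^bsub>F\<^esub> y) n = n" using hom[of x "inv\<^bsub>F\<^esub> y"] cancel[of x n] by simp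
      then show "x \<otimes>\<^bsub>F\<^esub> inv\<^bsub>F\<^esub> y \<in> L" using xy by (simp add: L_def)
    qed
    \<comment> \<open>Letters act from the right end of the word: the last \<open>i\<close> of them
      have moved \<open>n\<close> down to \<open>n - i\<close>.\<close>
    moreover have "act (drop (n - i) w) n = n - i" if "i \<le> n" for i
      using that
    proof (induction i)
      case (Suc i)
      define j where "j = n - Suc i"
      have j: "j < n" "n - i = Suc j" using Suc.prems by (auto simp: j_def)
      have "drop j w = w ! j # drop (Suc j) w" using j by (simp add: n_def Cons_nth_drop_Suc)
      then have "act (drop j w) n = la (w ! j) (Suc j)" using Suc j by (simp add: act_def)
      also have "\<dots> = j"
        using \<sigma>(3)[OF j(1)] \<sigma>(4)[OF j(1)] \<sigma>(1)[of "fst (w ! j)"]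
        by (auto simp: la_def) (metis bij_is_inj inv_f_f)
      finally show ?case by (simp add: j_def)
    qed (simp add: act_def n_def)
    from this[of n] have "\<Phi> g n = 0" by (simp add: \<Phi>_def w_def)
    then have "g \<notin> L" using \<open>n > 0\<close> by (simp add: L_def)
    ultimately show "\<exists>L. subgroup L F \<and> finite (rcosets\<^bsub>F\<^esub> L) \<and> g \<notin> L" using L by blast
  qed
qed

theorem (in group) virtually_free_times_Z_imp_residually_finite:
  assumes "virtually_free_times_Z G"
  shows "residually_finite G"
proof -
  obtain H and F :: "'a monoid" where H: "subgroup H G" "finite (rcosets H)" and F: "free_group F"
    and iso: "G\<lparr>carrier := H\<rparr> \<cong> F \<times>\<times> integer_group"
    using assms by (auto simp: virtually_free_times_Z_def)
  interpret H: group "G\<lparr>carrier := H\<rparr>" using H(1) is_group by (rule subgroup.subgroup_is_group)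
  have gF: "group F" using F by (simp add: free_group_def)
  have FZ: "group (F \<times>\<times> integer_group)" using gF by (rule DirProd_group) simp
  have sFZ: "group.separated (F \<times>\<times> integer_group)"
    unfolding group.separated_def[OF FZ]
  proof (intro ballI impI)
    fix g assume g: "g \<in> carrier (F \<times>\<times> integer_group)" "g \<noteq> \<one>\<^bsub>F \<times>\<times> integer_group\<^esub>"
    show "\<exists>L. subgroup L (F \<times>\<times> integer_group) \<and> finite (rcosets\<^bsub>F \<times>\<times> integer_group\<^esub> L) \<and> g \<notin> L"
    proof (cases "fst g = \<one>\<^bsub>F\<^esub>")
      case False
      moreover have "fst g \<in> carrier F" using g by (auto simp: DirProd_def)
      ultimately obtain L where L: "subgroup L F" "finite (rcosets\<^bsub>F\<^esub> L)" "fst g \<notin> L"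
        using free_group_separated[OF F] unfolding group.separated_def[OF gF] by blast
      have "fst \<in> hom (F \<times>\<times> integer_group) F" by (auto simp: hom_def DirProd_def)
      from group.finite_index_vimage[OF FZ gF this L(1,2)] show ?thesis using L(3) by blast
    next
      case True
      then have "snd g \<noteq> \<one>\<^bsub>integer_group\<^esub>" using g by (auto simp: DirProd_def prod_eq_iff)
      then obtain L where L: "subgroup L integer_group" "finite (rcosets\<^bsub>integer_group\<^esub> L)" "snd g \<notin> L"
        using separated_integer_group unfolding group.separated_def[OF group_integer_group] by auto
      have "snd \<in> hom (F \<times>\<times> integer_group) integer_group" by (auto simp: hom_def DirProd_def)
      from group.finite_index_vimage[OF FZ group_integer_group this L(1,2)] show ?thesis using L(3) by blast
    qed
  qed
  obtain f where f: "f \<in> iso (G\<lparr>carrier := H\<rparr>) (F \<times>\<times> integer_group)" using iso by (auto simp: is_iso_def)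
  have fh: "f \<in> hom (G\<lparr>carrier := H\<rparr>) (F \<times>\<times> integer_group)" using f by (simp add: iso_def)
  have inj: "inj_on f H" using f by (auto simp: iso_def bij_betw_def)
  have "H.separated"
    unfolding H.separated_def
  proof (intro ballI impI)
    fix g assume g: "g \<in> carrier (G\<lparr>carrier := H\<rparr>)" "g \<noteq> \<one>\<^bsub>G\<lparr>carrier := H\<rparr>\<^esub>"
    have "f \<one> = \<one>\<^bsub>F \<times>\<times> integer_group\<^esub>" using hom_one[OF fh H.is_group FZ] by simp
    moreover have "f g \<noteq> f \<one>" using inj_onD[OF inj, of g \<one>] g subgroup.one_closed[OF H(1)] by auto
    ultimately have "f g \<noteq> \<one>\<^bsub>F \<times>\<times> integer_group\<^esub>" by simp
    moreover have "f g \<in> carrier (F \<times>\<times> integer_group)" using fh g by (auto simp: hom_def)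
    ultimately obtain L where L: "subgroup L (F \<times>\<times> integer_group)"
      "finite (rcosets\<^bsub>F \<times>\<times> integer_group\<^esub> L)" "f g \<notin> L"
      using sFZ unfolding group.separated_def[OF FZ] by blast
    from H.finite_index_vimage[OF FZ fh L(1,2)]
    show "\<exists>L. subgroup L (G\<lparr>carrier := H\<rparr>) \<and> finite (rcosets\<^bsub>G\<lparr>carrier := H\<rparr>\<^esub> L) \<and> g \<notin> L"
      using L(3) by blast
  qed
  then show ?thesis using separated_imp_residually_finite separated_finite_index[OF H] by blast
qed

section \<open>Reduction modulo a prime\<close>

text \<open>The localisation of the integers at \<open>p\<close>, inside the rationals;
  \<open>\<not> p dvd m\<close> already excludes \<open>m = 0\<close>.\<close>

definition local_at :: "int \<Rightarrow> rat set" where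
  "local_at p = {x. \<exists>u m. \<not> p dvd m \<and> x = of_int u / of_int m}"

context
  fixes p :: int
  assumes p: "prime p"
begin

lemma local_atI: "\<not> p dvd m \<Longrightarrow> of_int u / of_int m \<in> local_at p"
  unfolding local_at_def by blast

lemma local_at_int: "of_int u \<in> local_at p"
  using local_atI[of 1 u] p by (auto dest: not_prime_unit)

lemma local_at_mult:
  assumes "x \<in> local_at p" "y \<in> local_at p"
  shows "x * y \<in> local_at p"
proof -
  obtain u m v n where "\<not> p dvd m" "x = of_int u / of_int m" "\<not> p dvd n" "y = of_int v / of_int n"
    using assms by (auto simp: local_at_def)
  then show ?thesis using local_atI[of "m * n" "u * v"] p by (simp add: prime_dvd_mult_iff)
qed

lemma local_at_add:
  assumes "x \<in> local_at p" "y \<in> local_at p"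
  shows "x + y \<in> local_at p"
proof -
  obtain u m v n where *: "\<not> p dvd m" "x = of_int u / of_int m" "\<not> p dvd n" "y = of_int v / of_int n"
    using assms by (auto simp: local_at_def)
  then have "m \<noteq> 0" "n \<noteq> 0" by auto
  then show ?thesis using local_atI[of "m * n" "u * n + v * m"] p * by (simp add: prime_dvd_mult_iff add_frac_eq)
qed

lemma local_at_uminus: "x \<in> local_at p \<Longrightarrow> - x \<in> local_at p"
  using local_at_mult[OF local_at_int[of "- 1"]] by fastforce

text \<open>The maximal ideal of \<open>local_at p\<close>; \<open>residue\<close> picks
  representatives of the quotient field with \<open>p\<close> elements.\<close>

definition max_at :: "rat set" where
  "max_at = {of_int p * y |y. y \<in> local_at p}"

lemma max_at_mult: "x \<in> max_at \<Longrightarrow> y \<in> local_at p \<Longrightarrow> x * y \<in> max_at"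
  unfolding max_at_def using local_at_mult by (auto simp: mult.assoc)

lemma max_at_add:
  assumes "x \<in> max_at" "y \<in> max_at"
  shows "x + y \<in> max_at"
proof -
  obtain u v where uv: "x = of_int p * u" "y = of_int p * v" "u \<in> local_at p" "v \<in> local_at p"
    using assms by (auto simp: max_at_def)
  then have "x + y = of_int p * (u + v)" by (simp add: distrib_left)
  then show ?thesis unfolding max_at_def using local_at_add uv by blast
qed

lemma max_at_uminus: "x \<in> max_at \<Longrightarrow> - x \<in> max_at"
  using max_at_mult[of x "of_int (-1)"] local_at_int[of "-1"] by simp

lemma max_at_0: "0 \<in> max_at"
  unfolding max_at_def using local_at_int[of 0] by force

lemma unit_not_max_at:
  assumes "inverse x \<in> local_at p" "x \<noteq> 0"
  shows "x \<notin> max_at"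
proof
  assume "x \<in> max_at"
  then have "x * inverse x \<in> max_at" using max_at_mult assms by blast
  then obtain y where "1 = of_int p * y" "y \<in> local_at p" using assms by (auto simp: max_at_def)
  then obtain u m where um: "\<not> p dvd m" "1 = of_int p * (of_int u / of_int m :: rat)"
    unfolding local_at_def by blast
  then have "m \<noteq> 0" by auto
  then have "(of_int m :: rat) = of_int (p * u)" using um by (simp add: field_simps)
  then show False using um(1) by (metis dvd_triv_left of_int_eq_iff)
qed

definition residue :: "rat \<Rightarrow> int" where
  "residue x = (SOME i. i \<in> {0..<p} \<and> x - of_int i \<in> max_at)"

lemma residue:
  assumes "x \<in> local_at p"
  shows "residue x \<in> {0..<p}" "x - of_int (residue x) \<in> max_at"
proof -
  obtain u m where um: "\<not> p dvd m" "x = of_int u / of_int m" using assms by (auto simp: local_at_def)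
  have "coprime p m" using um p by (simp add: prime_imp_coprime)
  then have "gcd p m = 1" by (simp add: coprime_iff_gcd_eq_1)
  then obtain s t where st: "s * p + t * m = 1" using bezout_int[of p m] by auto
  \<comment> \<open>\<open>t\<close> inverts \<open>m\<close> modulo \<open>p\<close>, so
    \<open>u * t\<close> represents the class of \<open>u / m\<close>.\<close>
  define i where "i = (u * t) mod p"
  have i: "i \<in> {0..<p}" using prime_gt_0_int[OF p] by (simp add: i_def)
  have eq: "u - i * m = p * (u * s + (u * t) div p * m)"
  proof -
    have "i = u * t - p * ((u * t) div p)" by (simp add: i_def minus_mult_div_eq_mod)
    then have "i * m = u * (t * m) - p * ((u * t) div p) * m"
      by (simp only: left_diff_distrib mult.assoc)
    also have "t * m = 1 - s * p" using st by simp
    finally show ?thesis by (simp add: algebra_simps)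
  qed
  have m: "m \<noteq> 0" using um by auto
  have "x - of_int i = of_int (u - i * m) / of_int m" using um m by (simp add: field_simps)
  also have "\<dots> = of_int p * (of_int (u * s + (u * t) div p * m) / of_int m)" unfolding eq by simp
  finally have "x - of_int i \<in> max_at" unfolding max_at_def using local_atI[OF um(1)] by blast
  then have "\<exists>i. i \<in> {0..<p} \<and> x - of_int i \<in> max_at" using i by blast
  from someI_ex[OF this] show "residue x \<in> {0..<p}" "x - of_int (residue x) \<in> max_at"
    unfolding residue_def by auto
qed

lemma residue_eq_imp:
  assumes "x \<in> local_at p" "y \<in> local_at p" "residue x = residue y"
  shows "x - y \<in> max_at"
  using max_at_add[OF residue(2)[OF assms(1)] max_at_uminus[OF residue(2)[OF assms(2)]]] assms(3) by simp

end

text \<open>A prime above all numerators and denominators divides no nonzero one among them. For 0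
  the convention \<open>inverse 0 = 0\<close> applies.\<close>

lemma good_prime:
  assumes "finite Q"
  obtains p :: int where "prime p" "Q \<subseteq> local_at p" "inverse ` Q \<subseteq> local_at p"
proof -
  define N where "N q = nat \<bar>fst (quotient_of q)\<bar> + nat \<bar>snd (quotient_of q)\<bar>" for q
  obtain r :: nat where r: "prime r" "(\<Sum>q\<in>Q. N q) < r" using bigger_prime by blast
  define p where "p = int r"
  have p: "prime p" using r by (simp add: p_def)
  have *: "q \<in> local_at p \<and> inverse q \<in> local_at p" if "q \<in> Q" for q
  proof -
    obtain u m where um: "quotient_of q = (u, m)" by (cases "quotient_of q")
    have m: "m > 0" and q: "q = of_int u / of_int m"
      using quotient_of_denom_pos[OF um] quotient_of_div[OF um] by auto
    have "N q \<le> (\<Sum>q\<in>Q. N q)" using that assms by (intro member_le_sum) auto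
    then have less: "\<bar>u\<bar> < p" "\<bar>m\<bar> < p" using r um by (auto simp: N_def p_def)
    have ndvd: "\<not> p dvd z" if "z \<noteq> 0" "\<bar>z\<bar> < p" for z
      using that dvd_imp_le_int[of z p] by auto
    have "q \<in> local_at p" using local_atI[OF p ndvd[of m]] m less q by simp
    moreover have "inverse q \<in> local_at p"
    proof (cases "u = 0")
      case True then show ?thesis using q local_at_int[OF p, of 0] by simp
    next
      case False then show ?thesis using local_atI[OF p ndvd[of u], of m] less q by simp
    qed
    ultimately show ?thesis by simp
  qed
  then show ?thesis using that[OF p] by blast
qed

context gbs
begin

lemma Ker_trivial_imp_residually_finite:
  assumes "Ker = {\<one>}"
  shows "residually_finite G"
proof (rule separated_imp_residually_finite, unfold separated_def, intro ballI impI)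
  obtain S where S: "finite S" "S \<subseteq> carrier G" "generate G S = carrier G"
    using fin_gen by (auto simp: finitely_generated_def)
  fix g assume g: "g \<in> carrier G" "g \<noteq> \<one>"
  \<comment> \<open>The values on \<open>S\<close> let all of \<open>G\<close> act over
    \<open>local_at p\<close>. One of \<open>Del g - 1\<close> and \<open>trans g\<close> is nonzero
    and becomes a unit there, so \<open>g\<close> still acts nontrivially modulo
    \<open>p\<close>.\<close>
  define Q where "Q = {Del g - 1, trans g} \<union> Del ` S \<union> trans ` S"
  have "finite Q" using S by (simp add: Q_def)
  then obtain p :: int where p: "prime p" and Q: "Q \<subseteq> local_at p" "inverse ` Q \<subseteq> local_at p"
    by (rule good_prime)
  note R_mult = local_at_mult[OF p] and R_add = local_at_add[OF p] and R_neg = local_at_uminus[OF p]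
  note I_mult = max_at_mult[OF p] and I_add = max_at_add[OF p] and I_neg = max_at_uminus[OF p]
  have R: "Del h \<in> local_at p \<and> inverse (Del h) \<in> local_at p \<and> trans h \<in> local_at p" if "h \<in> carrier G" for h
  proof -
    have "h \<in> generate G S" using that S by simp
    then have "h \<in> carrier G \<and> Del h \<in> local_at p \<and> inverse (Del h) \<in> local_at p \<and> trans h \<in> local_at p"
    proof (induction h)
      case one
      show ?case using local_at_int[OF p, of 1] local_at_int[OF p, of 0] by simp
    next
      case (incl s)
      then show ?case using S Q by (auto simp: Q_def)
    next
      case (inv s)
      then have s: "s \<in> carrier G" "Del s \<in> local_at p" "inverse (Del s) \<in> local_at p" "trans s \<in> local_at p"
        using S Q by (auto simp: Q_def)
      have "- trans s * inverse (Del s) \<in> local_at p" using R_mult R_neg s by blast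
      then show ?case using s by (simp add: Del_inv trans_inv divide_inverse)
    next
      case (eng h k)
      then show ?case using R_mult R_add by (simp add: Del_mult trans_mult)
    qed
    then show ?thesis by simp
  qed
  define I where "I = max_at p"
  \<comment> \<open>The kernel of the action on the affine line over the field with \<open>p\<close>
    elements.\<close>
  define L where "L = {h \<in> carrier G. Del h - 1 \<in> I \<and> trans h \<in> I}"
  have L: "subgroup L G"
  proof
    show "h \<otimes> k \<in> L" if hk: "h \<in> L" "k \<in> L" for h k
    proof -
      have c: "h \<in> carrier G" "k \<in> carrier G" using hk by (auto simp: L_def)
      have "(Del k - 1) * Del h + (Del h - 1) \<in> I" "trans h + trans k * Del h \<in> I"
        using hk R[OF c(1)] I_mult I_add by (auto simp: L_def I_def)
      then show ?thesis using c by (simp add: L_def Del_mult trans_mult algebra_simps)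
    qed
    show "inv h \<in> L" if h: "h \<in> L" for h
    proof -
      have c: "h \<in> carrier G" using h by (auto simp: L_def)
      have "- (Del h - 1) * inverse (Del h) \<in> I" "- trans h * inverse (Del h) \<in> I"
        using h R[OF c] I_mult I_neg by (auto simp: L_def I_def simp del: minus_diff_eq)
      moreover have "- (Del h - 1) * inverse (Del h) = inverse (Del h) - 1"
        using Del_nonzero[OF c] by (simp add: field_simps)
      ultimately show ?thesis using c by (simp add: L_def Del_inv trans_inv divide_inverse)
    qed
  qed (auto simp: L_def I_def max_at_0[OF p])
  have "finite (rcosets L)"
  proof (rule rcosets_finiteI[OF L, where code = "\<lambda>h. (residue p (Del h), residue p (trans h))"])
    have "(\<lambda>h. (residue p (Del h), residue p (trans h))) ` carrier G \<subseteq> {0..<p} \<times> {0..<p}"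
      using residue(1)[OF p] R by auto
    then show "finite ((\<lambda>h. (residue p (Del h), residue p (trans h))) ` carrier G)"
      by (rule finite_subset) simp
    fix h k assume c: "h \<in> carrier G" "k \<in> carrier G"
      and eq: "(residue p (Del h), residue p (trans h)) = (residue p (Del k), residue p (trans k))"
    have d: "Del h - Del k \<in> I" "trans h - trans k \<in> I"
      using residue_eq_imp[OF p] R c eq by (auto simp: I_def)
    have D: "Del (h \<otimes> inv k) - 1 = (Del h - Del k) * inverse (Del k)"
      using c Del_nonzero[OF c(2)] by (simp add: Del_mult Del_inv field_simps)
    have T: "trans (h \<otimes> inv k) = (trans h - trans k) + - ((Del h - Del k) * (inverse (Del k) * trans k))"
      using c Del_nonzero[OF c(2)] by (simp add: trans_mult trans_inv field_simps)
    have "Del (h \<otimes> inv k) - 1 \<in> I" "trans (h \<otimes> inv k) \<in> I"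
      unfolding D T I_def using d R[OF c(2)] unfolding I_def
      by (intro I_add I_neg I_mult R_mult; simp)+
    then show "h \<otimes> inv k \<in> L" using c by (simp add: L_def)
  qed
  moreover have "g \<notin> L"
  proof
    assume "g \<in> L"
    then have "Del g - 1 \<in> I" "trans g \<in> I" by (auto simp: L_def)
    moreover have "inverse (Del g - 1) \<in> local_at p" "inverse (trans g) \<in> local_at p"
      using Q by (auto simp: Q_def)
    ultimately have "Del g - 1 = 0" "trans g = 0" using unit_not_max_at[OF p] unfolding I_def by blast+
    then have "g \<in> Ker" using g by (simp add: Ker_def)
    then show False using assms g by simp
  qed
  ultimately show "\<exists>L. subgroup L G \<and> finite (rcosets L) \<and> g \<notin> L" using L by blast
qed

text \<open>Rebuilt without the extension fields of \<open>G\<close>, to match the type of the free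
  factor in \<open>virtually_free_times_Z\<close>.\<close>

definition Ker_group :: "'a monoid" where
  "Ker_group = \<lparr>carrier = Ker, monoid.mult = (\<otimes>), one = \<one>\<rparr>"

lemma Ker_group_simps [simp]:
  "carrier Ker_group = Ker" "x \<otimes>\<^bsub>Ker_group\<^esub> y = x \<otimes> y" "\<one>\<^bsub>Ker_group\<^esub> = \<one>"
  by (auto simp: Ker_group_def)

lemma group_Ker_group: "group Ker_group"
proof (rule groupI)
  fix x assume x: "x \<in> carrier Ker_group"
  then show "\<exists>y\<in>carrier Ker_group. y \<otimes>\<^bsub>Ker_group\<^esub> x = \<one>\<^bsub>Ker_group\<^esub>"
    using subgroup.m_inv_closed[OF Ker_subgroup] Ker_carrier by (intro bexI[of _ "inv x"]) auto
qed (use Ker_carrier Ker_subgroup in \<open>auto simp: m_assoc subgroup.m_closed subgroup.one_closed\<close>)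

lemma Ker_group_free: "free_group Ker_group"
proof -
  interpret K: group Ker_group by (rule group_Ker_group)
  interpret \<phi>: group_hom G "BijGroup V" \<phi> using action by (simp add: group_action_def)
  have "group_action Ker_group V \<phi>"
    unfolding group_action_def
  proof (intro group_hom.intro group_hom_axioms.intro K.is_group \<phi>.H.is_group)
    show "\<phi> \<in> hom Ker_group (BijGroup V)"
      using Ker_carrier by (auto simp: hom_def intro: \<phi>.hom_closed)
  qed
  then have "tree_act Ker_group V A \<phi>"
    using act_adj Ker_carrier
    by (intro tree_act.intro tree_act_axioms.intro K.is_group metric_tree_axioms) auto
  then have "free_tree_act Ker_group V A \<phi>"
    using Ker_carrier Ker_free no_inversion V_nonempty
    by (intro free_tree_act.intro free_tree_act_axioms.intro) auto
  then show ?thesis by (rule free_tree_act.free_action_imp_free_group)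
qed

text \<open>The power \<open>b\<close> from \<open>uniform_power\<close> generates a normal subgroup
  of \<open>G\<close>, and elements with \<open>Del g = 1\<close> centralise it because they
  preserve \<open>lam\<close>. This makes the product of \<open>Ker\<close> and the powers of
  \<open>b\<close> direct.\<close>

theorem unimodular_imp_virtually_free_times_Z:
  assumes uni: "\<And>g. g \<in> carrier G \<Longrightarrow> Del g \<in> {1, -1}"
  shows "virtually_free_times_Z G"
proof -
  obtain b M S where M: "M \<noteq> (0::int)" "b = a [^] M" and S: "finite S" "S \<subseteq> carrier G" "generate G S = carrier G"
    and rel: "\<And>s. s \<in> S \<Longrightarrow> \<exists>m n::int. m \<noteq> 0 \<and> n \<noteq> 0 \<and> coprime m n \<and> conj s (b [^] m) = b [^] n"
    by (rule uniform_power) blast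
  have b: "b \<in> carrier G" "elliptic b" "b \<in> St v0" using M a St_pow[OF v0 a(1)] ellipticI v0 by auto
  have b1: "b \<noteq> \<one>" using M a_pow_eq[of M 0] by simp
  have lb: "lam b = of_int M" using lam_pow[OF elliptic_a] M by simp
  have conj_b: "\<exists>n::int. conj g b = b [^] n" if "g \<in> carrier G" for g
  proof -
    have gen: "conj s b = b [^] (1::int) \<or> conj s b = b [^] (-1::int)" if s: "s \<in> S" for s
    proof -
      have sc: "s \<in> carrier G" using s S by auto
      obtain m n :: int where mn: "m \<noteq> 0" "n \<noteq> 0" "coprime m n" "conj s (b [^] m) = b [^] n"
        using rel s by blast
      have "Del s = of_int n / of_int m" using Del_relation[OF sc b(2) b1 mn(1,2,4)] .
      then have "(of_int n :: rat) = of_int m \<or> (of_int n :: rat) = of_int (- m)"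
        using uni[OF sc] mn by (auto simp: field_simps)
      then have nm: "n = m \<or> n = - m" by (metis of_int_eq_iff)
      \<comment> \<open>Since \<open>m\<close> divides \<open>n\<close>, coprimality leaves only
        units: each generator sends \<open>b\<close> to itself or to its inverse.\<close>
      then have "is_unit m" using mn(3) by (auto simp: coprime_def)
      then have m: "m = 1 \<or> m = -1" by auto
      have "conj s b = conj s ((b [^] m) [^] m)" using m b by (auto simp: int_pow_pow)
      also have "\<dots> = (b [^] n) [^] m" using mn conj_pow sc b by simp
      also have "\<dots> = b [^] (n * m)" using b by (simp add: int_pow_pow)
      finally show ?thesis using nm m by auto
    qed
    have "g \<in> generate G S" using that S by simp
    then have "g \<in> carrier G \<and> (\<exists>n::int. conj g b = b [^] n)"
    proof (induction g)
      case one
      show ?case using b by (auto intro!: exI[of _ 1])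
    next
      case (incl s)
      then show ?case using gen S by blast
    next
      case (inv s)
      then have sc: "s \<in> carrier G" using S by auto
      obtain n :: int where n: "conj s b = b [^] n" "n * n = 1" using gen[OF inv] by force
      have "conj s (b [^] n) = b" using conj_pow sc b n by (simp add: int_pow_pow)
      then have "conj (inv s) b = b [^] n" using conj_inv_conj[of s "b [^] n"] sc b by simp
      then show ?case using sc by auto
    next
      case (eng h k)
      then obtain i j :: int where "h \<in> carrier G" "conj h b = b [^] i" "k \<in> carrier G" "conj k b = b [^] j"
        by blast
      then have "conj (h \<otimes> k) b = b [^] (i * j)"
        using conj_conj[of h k b] b conj_pow by (simp add: int_pow_pow)
      then show ?case using \<open>h \<in> carrier G\<close> \<open>k \<in> carrier G\<close> by auto
    qed
    then show ?thesis by simp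
  qed
  have central: "g \<otimes> b [^] n = b [^] n \<otimes> g" if g: "g \<in> carrier G" "Del g = 1" for g and n :: int
  proof -
    obtain i :: int where i: "conj g b = b [^] i" using conj_b g by blast
    have "lam (conj g b) = lam b" using lam_conj[OF g(1) b(2)] g by simp
    then have "conj g b = b" using lam_inj[OF v0 St_pow[OF v0 b(3), of i] b(3)] i by simp
    then have "conj g (b [^] n) = b [^] n" using conj_pow g b by simp
    then show ?thesis using conj_eq_iff_commute g b by simp
  qed
  have Db: "Del (b [^] n) = 1" "trans (b [^] n) = of_int (n * M)" for n :: int
  proof -
    have e: "elliptic (b [^] n)" using ellipticI[OF v0] St_pow[OF v0 b(3)] by blast
    show "Del (b [^] n) = 1" using Del_elliptic e by blast
    show "trans (b [^] n) = of_int (n * M)" using trans_elliptic[OF e] lam_pow[OF b(2)] lb by simp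
  qed
  define H where "H = {g \<in> carrier G. Del g = 1 \<and> (\<exists>n::int. trans g = of_int (n * M))}"
  have Hs: "subgroup H G"
  proof
    show "x \<otimes> y \<in> H" if xy: "x \<in> H" "y \<in> H" for x y
    proof -
      obtain i j :: int where ij: "trans x = of_int (i * M)" "trans y = of_int (j * M)"
        using xy unfolding H_def by blast
      have c: "x \<in> carrier G" "y \<in> carrier G" "Del x = 1" "Del y = 1" using xy by (auto simp: H_def)
      have "trans (x \<otimes> y) = of_int ((i + j) * M)" using ij c by (simp add: trans_mult distrib_right)
      moreover have "x \<otimes> y \<in> carrier G" "Del (x \<otimes> y) = 1" using c by (auto simp: Del_mult)
      ultimately show ?thesis unfolding H_def by blast
    qed
    show "inv x \<in> H" if x: "x \<in> H" for x
    proof -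
      obtain i :: int where i: "trans x = of_int (i * M)" using x unfolding H_def by blast
      have c: "x \<in> carrier G" "Del x = 1" using x by (auto simp: H_def)
      have "trans (inv x) = of_int ((- i) * M)" using i c by (simp add: trans_inv)
      moreover have "inv x \<in> carrier G" "Del (inv x) = 1" using c by (auto simp: Del_inv)
      ultimately show ?thesis unfolding H_def by blast
    qed
    show "\<one> \<in> H" by (auto simp: H_def intro!: exI[of _ 0])
  qed (auto simp: H_def)
  define f where "f = (\<lambda>(k, n::int). k \<otimes> b [^] n)"
  have KD: "k \<in> carrier G" "Del k = 1" "trans k = 0" if "k \<in> Ker" for k using that by (auto simp: Ker_def)
  \<comment> \<open>\<open>trans\<close> reads off the exponent \<open>n\<close>. This gives
    injectivity of \<open>f\<close>, and surjectivity as dividing by that power of \<open>b\<close>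
    leaves an element of \<open>Ker\<close>.\<close>
  have tf: "trans (k \<otimes> b [^] n) = of_int (n * M)" if "k \<in> Ker" for k n
    using KD[OF that] b Db by (simp add: trans_mult)
  interpret K: group Ker_group by (rule group_Ker_group)
  interpret H: group "G\<lparr>carrier := H\<rparr>" using Hs is_group by (rule subgroup.subgroup_is_group)
  have KZ: "group (Ker_group \<times>\<times> integer_group)" by (rule DirProd_group) (auto intro: K.is_group)
  have "f \<in> iso (Ker_group \<times>\<times> integer_group) (G\<lparr>carrier := H\<rparr>)"
  proof (rule isoI)
    show "f \<in> hom (Ker_group \<times>\<times> integer_group) (G\<lparr>carrier := H\<rparr>)"
    proof (rule homI)
      fix x assume "x \<in> carrier (Ker_group \<times>\<times> integer_group)"
      then obtain k n where x: "x = (k, n)" "k \<in> Ker" by (auto simp: DirProd_def)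
      then have "k \<otimes> b [^] n \<in> H" using tf[OF x(2)] KD[OF x(2)] Db b by (auto simp: H_def Del_mult)
      then show "f x \<in> carrier (G\<lparr>carrier := H\<rparr>)" using x by (simp add: f_def)
    next
      fix x y assume "x \<in> carrier (Ker_group \<times>\<times> integer_group)" "y \<in> carrier (Ker_group \<times>\<times> integer_group)"
      then obtain k n l m where x: "x = (k, n)" "k \<in> Ker" and y: "y = (l, m)" "l \<in> Ker" by (auto simp: DirProd_def)
      note k = KD(1)[OF x(2)] and l = KD(1)[OF y(2)]
      have "k \<otimes> l \<otimes> b [^] (n + m) = k \<otimes> (l \<otimes> b [^] n) \<otimes> b [^] m"
        using k l b by (simp add: int_pow_mult m_assoc)
      also have "l \<otimes> b [^] n = b [^] n \<otimes> l" using central KD[OF y(2)] by blast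
      finally show "f (x \<otimes>\<^bsub>Ker_group \<times>\<times> integer_group\<^esub> y) = f x \<otimes>\<^bsub>G\<lparr>carrier := H\<rparr>\<^esub> f y"
        using x y k l b by (simp add: f_def m_assoc)
    qed
    show "bij_betw f (carrier (Ker_group \<times>\<times> integer_group)) (carrier (G\<lparr>carrier := H\<rparr>))"
      unfolding bij_betw_def
    proof
      show "inj_on f (carrier (Ker_group \<times>\<times> integer_group))"
      proof (rule inj_onI)
        fix x y assume "x \<in> carrier (Ker_group \<times>\<times> integer_group)" "y \<in> carrier (Ker_group \<times>\<times> integer_group)"
          and eq: "f x = f y"
        then obtain k n l m where x: "x = (k, n)" "k \<in> Ker" and y: "y = (l, m)" "l \<in> Ker" by (auto simp: DirProd_def)
        have e: "k \<otimes> b [^] n = l \<otimes> b [^] m" using eq x y by (simp add: f_def)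
        then have "(of_int (n * M) :: rat) = of_int (m * M)" using tf[OF x(2)] tf[OF y(2)] by metis
        then have "n * M = m * M" by (simp only: of_int_eq_iff)
        then have nm: "n = m" using M(1) by simp
        then have "k = l" using e KD(1)[OF x(2)] KD(1)[OF y(2)] b by simp
        then show "x = y" using x y nm by simp
      qed
      have "H \<subseteq> f ` (carrier (Ker_group \<times>\<times> integer_group))"
      proof
        fix g assume g: "g \<in> H"
        then obtain n :: int where n: "g \<in> carrier G" "Del g = 1" "trans g = of_int (n * M)" by (auto simp: H_def)
        define k where "k = g \<otimes> b [^] (- n)"
        have "k \<in> Ker"
          using n b Db[of "- n"] by (simp add: k_def Ker_def Del_mult trans_mult)
        moreover have "g = k \<otimes> b [^] n"
          using n b int_pow_mult[of b "- n" n] by (simp add: k_def m_assoc)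
        ultimately show "g \<in> f ` (carrier (Ker_group \<times>\<times> integer_group))"
          by (auto simp: f_def DirProd_def image_iff)
      qed
      moreover have "f ` (carrier (Ker_group \<times>\<times> integer_group)) \<subseteq> H"
        using tf KD Db b by (auto simp: f_def DirProd_def H_def Del_mult)
      ultimately show "f ` carrier (Ker_group \<times>\<times> integer_group) = carrier (G\<lparr>carrier := H\<rparr>)" by auto
    qed
  qed
  then have "Ker_group \<times>\<times> integer_group \<cong> G\<lparr>carrier := H\<rparr>" by (auto simp: is_iso_def)
  then have iso: "G\<lparr>carrier := H\<rparr> \<cong> Ker_group \<times>\<times> integer_group" by (rule group.iso_sym[OF KZ])
  \<comment> \<open>A common denominator for the translations of the generators. As
    \<open>Del\<close> only changes signs, it serves all of \<open>G\<close>.\<close>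
  define N where "N = (\<Prod>s\<in>S. snd (quotient_of (trans s)))"
  have "N > 0" unfolding N_def by (rule prod_pos) (simp add: quotient_of_denom_pos')
  have N: "of_int N * trans g \<in> \<int>" if "g \<in> carrier G" for g
  proof -
    have gen: "of_int N * trans s \<in> \<int>" if s: "s \<in> S" for s
    proof -
      obtain u m where um: "quotient_of (trans s) = (u, m)" by (cases "quotient_of (trans s)")
      have "m dvd N" using dvd_prodI[OF S(1) s, of "\<lambda>s. snd (quotient_of (trans s))"] um by (simp add: N_def)
      then obtain e where e: "N = m * e" by auto
      have "m \<noteq> 0" "trans s = of_int u / of_int m"
        using quotient_of_denom_pos[OF um] quotient_of_div[OF um] by auto
      then have "of_int N * trans s = of_int (e * u)" using e by simp
      then show ?thesis by (metis Ints_of_int)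
    qed
    have DZ: "Del k * x \<in> \<int>" if "k \<in> carrier G" "x \<in> \<int>" for k x using uni[OF that(1)] that(2) by auto
    have "g \<in> generate G S" using that S by simp
    then have "g \<in> carrier G \<and> of_int N * trans g \<in> \<int>"
    proof (induction g)
      case (incl s)
      then show ?case using gen S by auto
    next
      case (inv s)
      then have s: "s \<in> carrier G" using S by auto
      have "of_int N * trans (inv s) = - (Del (inv s) * (of_int N * trans s))"
        using s by (simp add: trans_inv Del_inv)
      then show ?case using DZ[of "inv s"] gen[OF inv] s by simp
    next
      case (eng h k)
      then have "of_int N * trans (h \<otimes> k) = of_int N * trans h + Del h * (of_int N * trans k)"
        by (simp add: trans_mult algebra_simps)
      then show ?case using eng DZ by simp
    qed simp
    then show ?thesis by simp
  qed
  have "finite (rcosets H)"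
  \<comment> \<open>The sign and the translation modulo \<open>M\<close>, measured in units of
    \<open>1 / N\<close>; the floor only turns an integral rational into an integer, and
    \<open>M\<close> may be negative.\<close>
  proof (rule rcosets_finiteI[OF Hs, where code = "\<lambda>g. (Del g, \<lfloor>of_int N * trans g\<rfloor> mod (N * \<bar>M\<bar>))"])
    have "N * \<bar>M\<bar> > 0" using \<open>N > 0\<close> M by simp
    then have "(\<lambda>g. (Del g, \<lfloor>of_int N * trans g\<rfloor> mod (N * \<bar>M\<bar>))) ` carrier G \<subseteq> {1, -1} \<times> {0..<N * \<bar>M\<bar>}"
      using uni by auto
    then show "finite ((\<lambda>g. (Del g, \<lfloor>of_int N * trans g\<rfloor> mod (N * \<bar>M\<bar>))) ` carrier G)"
      by (rule finite_subset) simp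
    fix x y assume c: "x \<in> carrier G" "y \<in> carrier G"
      and eq: "(Del x, \<lfloor>of_int N * trans x\<rfloor> mod (N * \<bar>M\<bar>)) = (Del y, \<lfloor>of_int N * trans y\<rfloor> mod (N * \<bar>M\<bar>))"
    then have D: "Del x = Del y" by simp
    obtain i j where ij: "of_int N * trans x = of_int i" "of_int N * trans y = of_int j"
      using N[OF c(1)] N[OF c(2)] by (auto elim!: Ints_cases)
    then have "i mod (N * \<bar>M\<bar>) = j mod (N * \<bar>M\<bar>)" using eq by simp
    then have "N * \<bar>M\<bar> dvd i - j" by (simp add: mod_eq_dvd_iff)
    then have "N * M dvd i - j" by (metis abs_dvd_iff abs_mult dvd_abs_iff mult_dvd_mono dvd_refl dvd_trans abs_ge_zero abs_idempotent)
    then obtain e where e: "i - j = N * M * e" by auto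
    have "of_int N * (trans x - trans y) = (of_int (i - j) :: rat)" using ij by (simp add: right_diff_distrib)
    then have "of_int N * (trans x - trans y) = (of_int N * of_int (e * M) :: rat)" using e by (simp add: mult_ac)
    then have "trans x - trans y = of_int (e * M)" using \<open>N > 0\<close> by simp
    moreover have "trans (x \<otimes> inv y) = trans x - trans y"
      using c D Del_nonzero[OF c(2)] by (simp add: trans_mult trans_inv)
    ultimately have "trans (x \<otimes> inv y) = of_int (e * M)" by (simp only:)
    moreover have "x \<otimes> inv y \<in> carrier G" "Del (x \<otimes> inv y) = 1"
      using c D Del_nonzero[OF c(2)] by (auto simp: Del_mult Del_inv)
    ultimately show "x \<otimes> inv y \<in> H" unfolding H_def by blast
  qed
  then show ?thesis
    using Hs iso Ker_group_free unfolding virtually_free_times_Z_def by blast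
qed

theorem solvable_imp_residually_finite:
  assumes "solvable G"
  shows "residually_finite G"
proof (cases "\<forall>g\<in>carrier G. Del g \<in> {1, -1}")
  case True
  then show ?thesis
    using unimodular_imp_virtually_free_times_Z virtually_free_times_Z_imp_residually_finite by blast
next
  case False
  then show ?thesis using Ker_trivial_of_solvable[OF assms] Ker_trivial_imp_residually_finite by blast
qed

text \<open>\<open>Del_relation\<close> gives the same value for all elliptic elements and
  exponents, as \<open>THE\<close> requires. The reciprocal arises because \<open>lam\<close> scales
  by \<open>n / m\<close> where the modular homomorphism is \<open>m / n\<close>.\<close>

lemma modular_hom_eq:
  assumes V: "V = pverts T" and g: "g \<in> carrier G"
  shows "modular_hom G T \<phi> g = 1 / Del g"
  unfolding modular_hom_def
proof (rule the_equality)
  obtain m n :: int where mn: "m \<noteq> 0" "n \<noteq> 0" "conj g (a [^] m) = a [^] n" using g by (rule modular_relation)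
  then have "Del g = of_int n / of_int m" using Del_relation[OF g elliptic_a a_neq_one] by simp
  then have "1 / Del g = of_int m / of_int n" by simp
  then show "\<exists>v\<in>pverts T. \<exists>a\<in>St v. \<exists>m n::int. a \<noteq> \<one> \<and> m \<noteq> 0 \<and> n \<noteq> 0 \<and>
      g \<otimes> a [^] m \<otimes> inv g = a [^] n \<and> 1 / Del g = of_int m / of_int n"
    using v0 a(1) a_neq_one mn unfolding conj_def V by blast
next
  fix q :: rat
  assume "\<exists>v\<in>pverts T. \<exists>a\<in>St v. \<exists>m n::int. a \<noteq> \<one> \<and> m \<noteq> 0 \<and> n \<noteq> 0 \<and>
      g \<otimes> a [^] m \<otimes> inv g = a [^] n \<and> q = of_int m / of_int n"
  then obtain v c m n where v: "v \<in> V" "c \<in> St v" "c \<noteq> \<one>" "m \<noteq> (0::int)" "n \<noteq> (0::int)"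
    "conj g (c [^] m) = c [^] n" "q = of_int m / of_int n"
    unfolding conj_def V by blast
  then show "q = 1 / Del g" using Del_relation[OF g ellipticI[OF v(1,2)] v(3-6)] by simp
qed

end

theorem corollary7p7:
  fixes G :: "('a, 'b) monoid_scheme"
    and T :: "'v pair_pre_digraph"
    and \<phi> :: "'a \<Rightarrow> 'v \<Rightarrow> 'v"
  assumes "gbs_group G T \<phi>"
  shows "(residually_finite G \<longleftrightarrow> solvable G \<or> unimodular G T \<phi>) \<and>
         (residually_finite G \<longleftrightarrow> solvable G \<or> virtually_free_times_Z G)"
proof -
  have T: "undirected_tree T" using assms by (simp add: gbs_group_def tree_action_def)
  have "metric_tree (pverts T) (parcs T)" by (rule undirected_tree_imp_metric_tree[OF T])
  then have "tree_act G (pverts T) (parcs T) \<phi>"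
    using assms by (intro tree_act.intro tree_act_axioms.intro) (auto simp: gbs_group_def tree_action_def)
  moreover have "pverts T \<noteq> {}"
    using T by (auto simp: undirected_tree_def connected_def strongly_connected_def)
  ultimately interpret gbs G "pverts T" "parcs T" \<phi>
    using assms by (intro gbs.intro gbs_axioms.intro) (auto simp: gbs_group_def without_inversions_def)
  \<comment> \<open>\<open>modular_hom\<close> and \<open>Del\<close> are reciprocal, and the set
    \<open>{1, -1}\<close> is stable under reciprocals.\<close>
  have uni: "unimodular G T \<phi> \<longleftrightarrow> (\<forall>g\<in>carrier G. Del g \<in> {1, -1})"
  proof -
    have "1 / x \<in> {1, -1} \<longleftrightarrow> x \<in> {1, -1}" if "x \<noteq> 0" for x :: rat
      using that by (auto simp: field_simps)
    then show ?thesis using modular_hom_eq Del_nonzero by (auto simp: unimodular_def)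
  qed
  show ?thesis
    using uni residually_finite_imp_solvable solvable_imp_residually_finite
      unimodular_imp_virtually_free_times_Z virtually_free_times_Z_imp_residually_finite by metis
qed

end
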